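(* For all but finitely many pairs of integers $(n,m)$ with $n>3$ and $m>3$ even, the simple random walk on $\Gamma_{n,m}$, with $\Gamma_{n,m}$ endowed with the geometric distance $d=d_{\mathbb{H}^2}$, satisfies \[ h_{\mu} < l_{d,\mu}\, v_d . \]
   Context: For integers $n\ge 3$ and $m$, let $\Delta_{n,m}\subset\mathbb{H}^2$ be a regular hyperbolic polygon with $n$ sides and all interior angles equal to $\frac{2\pi}{m}$ (whenever such a hyperbolic polygon exists). For even $m\ge 4$, the hyperbolic Coxeter group $\Gamma_{n,m}$ is the group generated by the reflections $r_1,\dots,r_n$ in the sides of $\Delta_{n,m}$ (sides labelled cyclically); it has presentation $\langle r_1,\dots,r_n \mid r_i^2=(r_ir_{i+1})^{m/2}=e\rangle$ (indices mod $n$) and acts geometrically on $\mathbb{H}^2$. The geometric distance: fix $x_0\in\mathbb{H}^2$ with trivial stabilizer and set $d_{\mathbb{H}^2}(g,h):=d_{\mathbb{H}^2}(g.x_0,h.x_0)$. The simple random walk is $X_k=\xi_1\cdots\xi_k$, $X_0=e$, where the $\xi_i$ are i.i.d. uniformly distributed on $\{r_1,\dots,r_n\}$; $\mu$ is its step distribution and $\mu_k$ the law of $X_k$. Invariants: logarithmic volume $v_d=\lim_{k\to\infty}\frac{\log|B_k|}{k}$ with $B_k=\{g: d(e,g)\le k\}$; Avez entropy $h_\mu=\lim_{k\to\infty}\frac{-\mathbb{E}[\log\mu_k(X_k)]}{k}$; drift $l_{d,\mu}=\lim_{k\to\infty}\frac{\mathbb{E}[d(e,X_k)]}{k}$. 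*)

theory Defs
  imports "HOL-Analysis.Analysis"
begin

(* Hyperboloid model of H^2 inside R^3 with the Minkowski form x1y1 + x2y2 - x3y3 *)
definition mink :: "real^3 \<Rightarrow> real^3 \<Rightarrow> real" where
  "mink x y = x$1 * y$1 + x$2 * y$2 - x$3 * y$3"

definition hyp_plane :: "(real^3) set" where
  "hyp_plane = {x. mink x x = -1 \<and> x$3 > 0}"

definition hdist :: "real^3 \<Rightarrow> real^3 \<Rightarrow> real" where
  "hdist x y = arcosh (- mink x y)"

(* inradius of the regular hyperbolic n-gon with interior angles 2 pi / m, centred at (0,0,1) *)
definition inradius :: "nat \<Rightarrow> nat \<Rightarrow> real" where
  "inradius n m = arcosh (cos (pi / real m) / sin (pi / real n))"

(* unit spacelike (outward) normal of the i-th side, i < n *)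
definition side_normal :: "nat \<Rightarrow> nat \<Rightarrow> nat \<Rightarrow> real^3" where
  "side_normal n m i = (let r = inradius n m; t = 2 * pi * real i / real n in
     (\<chi> a. if a = 1 then cosh r * cos t else if a = 2 then cosh r * sin t else sinh r))"

(* matrix of the hyperbolic reflection x \<mapsto> x - 2 <x,u> u in the i-th side *)
definition refl_mat :: "nat \<Rightarrow> nat \<Rightarrow> nat \<Rightarrow> real^3^3" where
  "refl_mat n m i = (let u = side_normal n m i in
     (\<chi> a b. (if a = b then 1 else 0) - 2 * u$a * (if b = 3 then - (u$b) else u$b)))"

definition words :: "nat \<Rightarrow> nat \<Rightarrow> nat list set" where
  "words n k = {ws. set ws \<subseteq> {..<n} \<and> length ws = k}"

definition word_prod :: "nat \<Rightarrow> nat \<Rightarrow> nat list \<Rightarrow> real^3^3" where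
  "word_prod n m ws = foldr (\<lambda>i A. refl_mat n m i ** A) ws (mat 1)"

(* the Coxeter group Gamma_{n,m}, realised as the group of isometries generated by the reflections *)
definition Gamma :: "nat \<Rightarrow> nat \<Rightarrow> (real^3^3) set" where
  "Gamma n m = {word_prod n m ws | ws. set ws \<subseteq> {..<n}}"

definition trivial_stab :: "nat \<Rightarrow> nat \<Rightarrow> real^3 \<Rightarrow> bool" where
  "trivial_stab n m x0 \<longleftrightarrow> (\<forall>g \<in> Gamma n m. g *v x0 = x0 \<longrightarrow> g = mat 1)"

(* law of X_k for the simple random walk *)
definition mu_k :: "nat \<Rightarrow> nat \<Rightarrow> nat \<Rightarrow> real^3^3 \<Rightarrow> real" where
  "mu_k n m k g = real (card {ws \<in> words n k. word_prod n m ws = g}) / real n ^ k"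

definition gdist :: "nat \<Rightarrow> nat \<Rightarrow> real^3 \<Rightarrow> real^3^3 \<Rightarrow> real" where
  "gdist n m x0 g = hdist x0 (g *v x0)"

definition ball_card :: "nat \<Rightarrow> nat \<Rightarrow> real^3 \<Rightarrow> nat \<Rightarrow> nat" where
  "ball_card n m x0 k = card {g \<in> Gamma n m. gdist n m x0 g \<le> real k}"

definition entropy_k :: "nat \<Rightarrow> nat \<Rightarrow> nat \<Rightarrow> real" where
  "entropy_k n m k = (\<Sum>ws \<in> words n k. - ln (mu_k n m k (word_prod n m ws)) / real n ^ k)"

definition drift_k :: "nat \<Rightarrow> nat \<Rightarrow> real^3 \<Rightarrow> nat \<Rightarrow> real" where
  "drift_k n m x0 k = (\<Sum>ws \<in> words n k. gdist n m x0 (word_prod n m ws) / real n ^ k)"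

end

theory Submission
  imports Defs "HOL-Real_Asymp.Real_Asymp"
begin

text \<open>
  Let \<open>D g\<close> be the third coordinate (height) of the image under \<open>g\<close> of the centre of the polygon.
  The displacement of any base point under \<open>g\<close> differs from \<open>ln (D g)\<close> by a bounded amount, so drift
  and volume can be computed with \<open>ln D\<close>. All limits exist by subadditivity.

  Entropy. The group is a quotient of the free product of \<open>n\<close> copies of \<open>Z/2\<close>, so the entropy is at
  most the one of the simple random walk on the \<open>n\<close>-regular tree, \<open>(n-2)/n * ln (n-1)\<close>.

  Volume. Reflecting a point repeatedly in a side that separates it from the polygon is a game in
  which all plays have the same length and the same end; hence the polygon is a fundamental domain and
  the group is discrete. Points spread over a large circle lie near distinct orbit points, so the
  logarithmic volume is at least 1.

  Drift. With \<open>a = cosh r\<close>, \<open>b = sinh r\<close> for the inradius \<open>r\<close>, the product of the heights of all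
  reflections of a light-like vector of height 1 in direction \<open>\<theta>\<close> is
  \<open>a^(2n) - 2 a^n b^n cos (n \<theta>) + b^(2n)\<close>. Hence the drift is at least \<open>2/n * ln (a^n - b^n)\<close>.
  This exceeds the entropy bound for all large \<open>n\<close>, and for each \<open>n \<ge> 5\<close> once \<open>m\<close> is large. For
  \<open>n = 4\<close> the two bounds have the same limit \<open>(ln 3)/2\<close> as \<open>m\<close> grows, and the drift bound is improved
  slightly by looking at the directions of the reflected vectors.
\<close>

section \<open>Subadditive sequences\<close>

text \<open>Since the volume is at least 1, only entropy < drift remains, a comparison of two
  explicit functions of \<open>n\<close> and \<open>m\<close>. Finiteness of the exceptional set
  needs it in two regimes: uniformly in \<open>m\<close> for large \<open>n\<close>, and for each
  remaining \<open>n\<close> as \<open>m\<close> grows. The drift is usually an integral against a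
  stationary measure on the circle at infinity, which is not explicit here. It is avoided by
  bounding the mean logarithmic increment from below in every direction at once. Light-like vectors
  represent these directions, and for them the increment is the logarithm of a product over roots of
  unity. Discreteness cannot be skipped: \<open>card\<close> of an infinite set is 0, so balls must
  be shown finite before their growth says anything. The group relations enter only geometrically,
  through the alternating reflections in two adjacent sides. The tie at \<open>n = 4\<close> comes
  from \<open>a\<^sup>2\<close> tending to 2 and \<open>b\<^sup>2\<close> to 1: then
  \<open>a ^ 4 - b ^ 4\<close> tends to 3, and 3 is also \<open>n - 1\<close>.\<close>

lemma subadditive_mult_add:
  fixes a :: "nat \<Rightarrow> real"
  assumes "\<And>j k. a (j + k) \<le> a j + a k"
  shows "a (q * p + s) \<le> real q * a p + a s"
proof (induction q)
  case (Suc q)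
  have "a (Suc q * p + s) = a (p + (q * p + s))" by (simp add: algebra_simps)
  also have "\<dots> \<le> a p + a (q * p + s)" by (rule assms)
  finally show ?case using Suc by (simp add: algebra_simps)
qed simp

text \<open>Fekete's lemma: the limit is the infimum of \<open>a k / k\<close> over positive
  \<open>k\<close>, and nonnegativity makes this infimum finite.\<close>

lemma subadditive_convergent:
  fixes a :: "nat \<Rightarrow> real"
  assumes sub: "\<And>j k. a (j + k) \<le> a j + a k" and nonneg: "\<And>k. a k \<ge> 0"
  shows "\<exists>L. (\<lambda>k. a k / real k) \<longlonglongrightarrow> L"
proof -
  define S where "S = (\<lambda>k. a k / real k) ` {1..}"
  define L where "L = Inf S"
  have bdd: "bdd_below S" unfolding S_def by (rule bdd_belowI2[of _ 0]) (simp add: nonneg)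
  have low: "L \<le> a k / real k" if "k \<ge> 1" for k
    unfolding L_def by (rule cInf_lower[OF _ bdd]) (use that in \<open>auto simp: S_def\<close>)
  have "(\<lambda>k. a k / real k) \<longlonglongrightarrow> L"
  proof (rule LIMSEQ_I)
    fix e :: real assume e: "e > 0"
    have "\<exists>x\<in>S. x < L + e / 2"
      using cInf_lessD[of S "L + e/2"] e unfolding L_def S_def by force
    then obtain p where p: "p \<ge> 1" "a p / real p < L + e / 2" unfolding S_def by auto
    \<comment> \<open>\<open>M\<close> dominates \<open>a (k mod p)\<close> for all \<open>k\<close>
      simultaneously, so the incomplete last block costs only \<open>M / k\<close>.\<close>
    define M where "M = (\<Sum>s<p. a s)"
    have M: "a s \<le> M" if "s < p" for s
      unfolding M_def by (rule member_le_sum) (use that nonneg in auto)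
    obtain K :: nat where K: "2 * M / e < real K" using reals_Archimedean2 by blast
    have "norm (a k / real k - L) < e" if k: "k \<ge> max 1 K" for k
    proof -
      have kpos: "real k > 0" using k by auto
      have "a k \<le> real (k div p) * a p + a (k mod p)"
        using subadditive_mult_add[of a "k div p" p "k mod p"] sub by simp
      also have "a (k mod p) \<le> M" using p by (intro M) simp
      also have "real (k div p) * a p = real (k div p * p) * (a p / real p)" using p by simp
      also have "\<dots> \<le> real k * (a p / real p)"
        by (intro mult_right_mono) (auto simp: nonneg simp del: of_nat_mult)
      finally have "a k / real k \<le> a p / real p + M / real k" using kpos by (simp add: field_simps)
      moreover have "M / real k < e / 2"
      proof -
        have "2 * M < e * real K" using K e by (simp add: field_simps)
        also have "\<dots> \<le> e * real k" using k e by simp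
        finally show ?thesis using kpos by (simp add: field_simps)
      qed
      moreover have "L \<le> a k / real k" using low k by simp
      ultimately show ?thesis using p unfolding real_norm_def by linarith
    qed
    then show "\<exists>no. \<forall>k\<ge>no. norm (a k / real k - L) < e" by blast
  qed
  then show ?thesis ..
qed

section \<open>Words\<close>

lemma words_0 [simp]: "words n 0 = {[]}"
  by (auto simp: words_def)

lemma finite_words [simp]: "finite (words n k)"
  unfolding words_def by (rule finite_lists_length_eq) simp

lemma card_words: "card (words n k) = n ^ k"
  unfolding words_def by (subst card_lists_length_eq) auto

text \<open>The new letter goes in front because it then acts last on a vector: averages over words
  become iterates of a Markov chain on vectors, or on reduced words.\<close>

lemma sum_words_Suc: "(\<Sum>ws\<in>words n (Suc k). f ws) = (\<Sum>ws\<in>words n k. \<Sum>i<n. f (i # ws))"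
  for f :: "nat list \<Rightarrow> real"
proof -
  have eq: "words n (Suc k) = (\<lambda>(ws, i). i # ws) ` (words n k \<times> {..<n})"
    by (auto simp: words_def image_iff length_Suc_conv)
  have inj: "inj_on (\<lambda>(ws, i). i # ws) (words n k \<times> {..<n})" by (auto simp: inj_on_def)
  show ?thesis
    unfolding eq by (subst sum.reindex[OF inj]) (auto simp: sum.cartesian_product intro!: sum.cong)
qed

lemma sum_words_add:
  fixes f :: "nat list \<Rightarrow> real"
  shows "(\<Sum>ws\<in>words n (j + k). f ws) = (\<Sum>u\<in>words n j. \<Sum>w\<in>words n k. f (u @ w))"
proof (induction j arbitrary: f)
  case (Suc j)
  have "(\<Sum>ws\<in>words n (Suc j + k). f ws) = (\<Sum>ws\<in>words n (j + k). \<Sum>i<n. f (i # ws))"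
    by (simp add: sum_words_Suc)
  also have "\<dots> = (\<Sum>u\<in>words n j. \<Sum>i<n. \<Sum>w\<in>words n k. f (i # u @ w))"
    unfolding Suc by (subst sum.swap[of _ "{..<n}"]) simp
  also have "\<dots> = (\<Sum>u\<in>words n (Suc j). \<Sum>w\<in>words n k. f (u @ w))"
    by (simp add: sum_words_Suc)
  finally show ?case .
qed simp

text \<open>Independence of the first \<open>j\<close> and the last \<open>k\<close> letters; shared
  by the subadditivity of entropy and of drift.\<close>

lemma average_words_add:
  fixes f g :: "nat list \<Rightarrow> real"
  assumes "n > 0"
  shows "(\<Sum>u\<in>words n j. \<Sum>w\<in>words n k. f u + g w) / real n ^ (j + k)
    = (\<Sum>u\<in>words n j. f u) / real n ^ j + (\<Sum>w\<in>words n k. g w) / real n ^ k"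
  using assms by (simp add: sum.distrib card_words power_add sum_distrib_left[symmetric]
    sum_distrib_right[symmetric] field_simps)

lemma append_in_words: "u \<in> words n j \<Longrightarrow> w \<in> words n k \<Longrightarrow> u @ w \<in> words n (j + k)"
  by (auto simp: words_def)

lemma word_prod_Nil [simp]: "word_prod n m [] = mat 1"
  by (simp add: word_prod_def)

lemma word_prod_Cons [simp]: "word_prod n m (i # ws) = refl_mat n m i ** word_prod n m ws"
  by (simp add: word_prod_def)

lemma word_prod_append: "word_prod n m (u @ w) = word_prod n m u ** word_prod n m w"
  by (induction u) (auto simp: matrix_mul_assoc)

section \<open>Reflections in Minkowski space\<close>

lemma mink_add_left: "mink (x + y) z = mink x z + mink y z"
  by (simp add: mink_def algebra_simps)

lemma mink_add_right: "mink x (y + z) = mink x y + mink x z"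
  by (simp add: mink_def algebra_simps)

lemma mink_diff_left: "mink (x - y) z = mink x z - mink y z"
  by (simp add: mink_def algebra_simps)

lemma mink_diff_right: "mink x (y - z) = mink x y - mink x z"
  by (simp add: mink_def algebra_simps)

lemma mink_scale_left: "mink (c *\<^sub>R x) y = c * mink x y"
  by (simp add: mink_def algebra_simps)

lemma mink_scale_right: "mink x (c *\<^sub>R y) = c * mink x y"
  by (simp add: mink_def algebra_simps)

lemmas mink_simps = mink_add_left mink_add_right mink_diff_left mink_diff_right
  mink_scale_left mink_scale_right

lemma mink_commute: "mink x y = mink y x"
  by (simp add: mink_def algebra_simps)

lemma mink_side_normal_self [simp]: "mink (side_normal n m i) (side_normal n m i) = 1"
proof -
  have "cosh r * cos t * (cosh r * cos t) + cosh r * sin t * (cosh r * sin t) - sinh r * sinh r = 1"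
    for r t :: real
  proof -
    have "cosh r * cos t * (cosh r * cos t) + cosh r * sin t * (cosh r * sin t)
        = (cosh r)\<^sup>2 * ((sin t)\<^sup>2 + (cos t)\<^sup>2)" by algebra
    then show ?thesis by (simp add: power2_eq_square[symmetric] cosh_square_eq)
  qed
  then show ?thesis by (simp add: mink_def side_normal_def Let_def)
qed

lemma refl_mat_mult:
  "refl_mat n m i *v x = x - (2 * mink x (side_normal n m i)) *\<^sub>R side_normal n m i"
  by (simp add: vec_eq_iff forall_3 matrix_vector_mult_def sum_3 refl_mat_def Let_def mink_def
      algebra_simps)

lemma mink_refl [simp]: "mink (refl_mat n m i *v x) (refl_mat n m i *v y) = mink x y"
  by (simp add: refl_mat_mult mink_simps mink_commute[of "side_normal n m i"] algebra_simps)

lemma refl_mat_mult_self [simp]: "refl_mat n m i *v (refl_mat n m i *v x) = x"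
  by (simp add: vec_eq_iff refl_mat_mult mink_simps algebra_simps)

lemma refl_mat_square [simp]: "refl_mat n m i ** refl_mat n m i = mat 1"
  by (simp add: matrix_eq matrix_vector_mul_assoc[symmetric])

lemma refl_mat_cancel [simp]: "refl_mat n m i ** (refl_mat n m i ** A) = A"
  by (metis matrix_mul_assoc matrix_mul_lid refl_mat_square)

section \<open>Entropy\<close>

text \<open>The Chapman-Kolmogorov sum with a single intermediate element kept.\<close>

lemma mu_k_mult_le:
  assumes "n > 0"
  shows "mu_k n m j g * mu_k n m k h \<le> mu_k n m (j + k) (g ** h)"
proof -
  let ?A = "{ws \<in> words n j. word_prod n m ws = g}"
  let ?B = "{ws \<in> words n k. word_prod n m ws = h}"
  let ?C = "{ws \<in> words n (j + k). word_prod n m ws = g ** h}"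
  have "card (?A \<times> ?B) \<le> card ?C"
  proof (rule card_inj_on_le)
    show "inj_on (\<lambda>(u, w). u @ w) (?A \<times> ?B)" by (auto simp: inj_on_def words_def)
    show "(\<lambda>(u, w). u @ w) ` (?A \<times> ?B) \<subseteq> ?C"
      by (auto simp: append_in_words word_prod_append)
  qed simp
  then have "real (card ?A) * real (card ?B) \<le> real (card ?C)"
    by (simp add: card_cartesian_product flip: of_nat_mult)
  then show ?thesis using assms by (simp add: mu_k_def power_add divide_right_mono)
qed

lemma mu_k_pos:
  assumes "n > 0" "ws \<in> words n k"
  shows "mu_k n m k (word_prod n m ws) > 0"
proof -
  have "card {us \<in> words n k. word_prod n m us = word_prod n m ws} > 0"
    using assms by (subst card_gt_0_iff) auto
  then show ?thesis using assms by (simp add: mu_k_def)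
qed

lemma mu_k_le_1:
  assumes "n > 0"
  shows "mu_k n m k g \<le> 1"
proof -
  have "card {us \<in> words n k. word_prod n m us = g} \<le> card (words n k)"
    by (rule card_mono) auto
  then have "real (card {us \<in> words n k. word_prod n m us = g}) \<le> real n ^ k"
    by (simp add: card_words flip: of_nat_power)
  then show ?thesis using assms by (simp add: mu_k_def)
qed

lemma entropy_k_subadditive:
  assumes "n > 0"
  shows "entropy_k n m (j + k) \<le> entropy_k n m j + entropy_k n m k"
proof -
  let ?e = "\<lambda>k ws. - ln (mu_k n m k (word_prod n m ws))"
  have "entropy_k n m (j + k) = (\<Sum>u\<in>words n j. \<Sum>w\<in>words n k. ?e (j + k) (u @ w)) / real n ^ (j + k)"
    by (simp add: entropy_k_def sum_words_add sum_divide_distrib)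
  also have "\<dots> \<le> (\<Sum>u\<in>words n j. \<Sum>w\<in>words n k. ?e j u + ?e k w) / real n ^ (j + k)"
  proof (intro divide_right_mono sum_mono)
    fix u w assume u: "u \<in> words n j" and w: "w \<in> words n k"
    note pos = mu_k_pos[OF assms u, of m] mu_k_pos[OF assms w, of m]
    have "ln (mu_k n m j (word_prod n m u)) + ln (mu_k n m k (word_prod n m w))
      = ln (mu_k n m j (word_prod n m u) * mu_k n m k (word_prod n m w))"
      using pos by (simp add: ln_mult)
    also have "\<dots> \<le> ln (mu_k n m (j + k) (word_prod n m (u @ w)))"
      using pos mu_k_mult_le[OF assms] mu_k_pos[OF assms append_in_words[OF u w]]
      by (subst ln_le_cancel_iff) (auto simp: word_prod_append)
    finally show "?e (j + k) (u @ w) \<le> ?e j u + ?e k w" by linarith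
  qed simp
  also have "\<dots> = entropy_k n m j + entropy_k n m k"
    by (simp only: average_words_add[OF assms] entropy_k_def sum_divide_distrib[symmetric])
  finally show ?thesis .
qed

lemma entropy_k_nonneg:
  assumes "n > 0"
  shows "entropy_k n m k \<ge> 0"
  unfolding entropy_k_def
  by (intro sum_nonneg divide_nonneg_nonneg)
    (auto simp: mu_k_pos[OF assms] mu_k_le_1[OF assms])

lemma sum_words_by_product:
  fixes F :: "real^3^3 \<Rightarrow> real"
  shows "(\<Sum>ws\<in>words n k. F (word_prod n m ws))
    = (\<Sum>g\<in>word_prod n m ` words n k. real (card {ws \<in> words n k. word_prod n m ws = g}) * F g)"
  by (subst sum.image_gen[of _ _ "word_prod n m"]) (auto intro!: sum.cong)

text \<open>Gibbs' inequality, from \<open>ln x \<le> x - 1\<close>. Allowing total mass below 1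
  makes an exact normalisation of the reference weights unnecessary.\<close>

lemma entropy_k_le_cross_entropy:
  fixes q :: "real^3^3 \<Rightarrow> real"
  assumes n: "n > 0" and pos: "\<And>ws. ws \<in> words n k \<Longrightarrow> q (word_prod n m ws) > 0"
    and sum: "(\<Sum>g\<in>word_prod n m ` words n k. q g) \<le> 1"
  shows "entropy_k n m k \<le> (\<Sum>ws\<in>words n k. - ln (q (word_prod n m ws))) / real n ^ k"
proof -
  let ?p = "word_prod n m"
  have cancel: "c * (Q / (c / N)) = N * Q" if "c / N > 0" for c N Q :: real
    using that by auto
  have "(\<Sum>ws\<in>words n k. - ln (mu_k n m k (?p ws)) + ln (q (?p ws)))
      \<le> (\<Sum>ws\<in>words n k. q (?p ws) / mu_k n m k (?p ws) - 1)"
  proof (rule sum_mono)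
    fix ws assume ws: "ws \<in> words n k"
    show "- ln (mu_k n m k (?p ws)) + ln (q (?p ws)) \<le> q (?p ws) / mu_k n m k (?p ws) - 1"
      using ln_le_minus_one[of "q (?p ws) / mu_k n m k (?p ws)"] pos[OF ws] mu_k_pos[OF n ws, of m]
      by (simp add: ln_div)
  qed
  also have "\<dots> = (\<Sum>ws\<in>words n k. q (?p ws) / mu_k n m k (?p ws)) - real n ^ k"
    by (simp add: sum_subtractf card_words)
  also have "(\<Sum>ws\<in>words n k. q (?p ws) / mu_k n m k (?p ws))
      = (\<Sum>g\<in>?p ` words n k. real n ^ k * q g)"
    unfolding sum_words_by_product[where F = "\<lambda>g. q g / mu_k n m k g"]
  proof (rule sum.cong[OF refl])
    fix g assume "g \<in> ?p ` words n k"
    then have "mu_k n m k g > 0" using mu_k_pos[OF n] by auto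
    then show "real (card {ws \<in> words n k. ?p ws = g}) * (q g / mu_k n m k g) = real n ^ k * q g"
      unfolding mu_k_def by (rule cancel)
  qed
  also have "\<dots> \<le> real n ^ k"
    using sum n by (simp add: sum_distrib_left[symmetric] mult_left_le)
  finally have "(\<Sum>ws\<in>words n k. - ln (mu_k n m k (?p ws))) \<le> (\<Sum>ws\<in>words n k. - ln (q (?p ws)))"
    by (simp add: sum_subtractf sum_negf)
  then have "(\<Sum>ws\<in>words n k. - ln (mu_k n m k (?p ws))) / real n ^ k
      \<le> (\<Sum>ws\<in>words n k. - ln (q (?p ws))) / real n ^ k"
    by (rule divide_right_mono) simp
  then show ?thesis by (simp add: entropy_k_def sum_divide_distrib)
qed

section \<open>Free reduction and the n-regular tree\<close>

fun cancel_cons :: "nat \<Rightarrow> nat list \<Rightarrow> nat list" where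
  "cancel_cons i [] = [i]"
| "cancel_cons i (j # w) = (if i = j then w else i # j # w)"

text \<open>Normal form in the free product of copies of Z/2, whose Cayley graph is the regular
  tree: the generators are involutions, so only equal neighbours cancel and no relation between
  different generators is applied.\<close>

definition free_reduce :: "nat list \<Rightarrow> nat list" where
  "free_reduce ws = foldr cancel_cons ws []"

lemma free_reduce_Nil [simp]: "free_reduce [] = []"
  by (simp add: free_reduce_def)

lemma free_reduce_Cons [simp]: "free_reduce (i # ws) = cancel_cons i (free_reduce ws)"
  by (simp add: free_reduce_def)

lemma word_prod_cancel_cons: "word_prod n m (cancel_cons i w) = refl_mat n m i ** word_prod n m w"
  by (cases w) auto

lemma word_prod_free_reduce: "word_prod n m (free_reduce ws) = word_prod n m ws"
  by (induction ws) (auto simp: word_prod_cancel_cons)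

lemma distinct_adj_cancel_cons: "distinct_adj w \<Longrightarrow> distinct_adj (cancel_cons i w)"
  by (cases w) (auto dest: distinct_adj_ConsD)

lemma distinct_adj_free_reduce: "distinct_adj (free_reduce ws)"
  by (induction ws) (auto simp: distinct_adj_cancel_cons)

lemma set_cancel_cons: "set (cancel_cons i w) \<subseteq> insert i (set w)"
  by (cases w) auto

lemma set_free_reduce: "set (free_reduce ws) \<subseteq> set ws"
proof (induction ws)
  case (Cons i ws)
  then show ?case using set_cancel_cons[of i "free_reduce ws"] by auto
qed simp

lemma length_cancel_cons: "length (cancel_cons i w) \<le> Suc (length w)"
  by (cases w) auto

lemma length_free_reduce: "length (free_reduce ws) \<le> length ws"
proof (induction ws)
  case (Cons i ws)
  then show ?case using length_cancel_cons[of i "free_reduce ws"] by auto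
qed simp

definition reduced_words :: "nat \<Rightarrow> nat \<Rightarrow> nat list set" where
  "reduced_words n j = {w \<in> words n j. distinct_adj w}"

lemma finite_reduced_words [simp]: "finite (reduced_words n j)"
  by (simp add: reduced_words_def)

lemma card_reduced_words_Suc: "card (reduced_words n (Suc j)) \<le> n * (n - 1) ^ j"
proof (induction j)
  case 0
  have "card (reduced_words n (Suc 0)) \<le> card (words n (Suc 0))"
    by (intro card_mono) (auto simp: reduced_words_def)
  then show ?case by (simp add: card_words)
next
  case (Suc j)
  have "reduced_words n (Suc (Suc j))
      \<subseteq> (\<Union>w\<in>reduced_words n (Suc j). (\<lambda>i. i # w) ` ({..<n} - {hd w}))"
  proof
    fix v assume v: "v \<in> reduced_words n (Suc (Suc j))"
    then obtain i w where "v = i # w" by (auto simp: reduced_words_def words_def length_Suc_conv)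
    then have "w \<in> reduced_words n (Suc j)" "v \<in> (\<lambda>i. i # w) ` ({..<n} - {hd w})"
      using v by (auto simp: reduced_words_def words_def length_Suc_conv)
    then show "v \<in> (\<Union>w\<in>reduced_words n (Suc j). (\<lambda>i. i # w) ` ({..<n} - {hd w}))" by blast
  qed
  then have "card (reduced_words n (Suc (Suc j)))
      \<le> card (\<Union>w\<in>reduced_words n (Suc j). (\<lambda>i. i # w) ` ({..<n} - {hd w}))"
    by (intro card_mono) auto
  also have "\<dots> \<le> (\<Sum>w\<in>reduced_words n (Suc j). card ((\<lambda>i. i # w) ` ({..<n} - {hd w})))"
    by (rule card_UN_le) simp
  also have "\<dots> \<le> (\<Sum>w\<in>reduced_words n (Suc j). n - 1)"
  proof (rule sum_mono)
    fix w assume "w \<in> reduced_words n (Suc j)"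
    then have "hd w < n" by (auto simp: reduced_words_def words_def length_Suc_conv)
    then show "card ((\<lambda>i. i # w) ` ({..<n} - {hd w})) \<le> n - 1"
      using card_image_le[of "{..<n} - {hd w}" "\<lambda>i. i # w"] by simp
  qed
  also have "\<dots> \<le> n * (n - 1) ^ Suc j" using Suc by simp
  finally show ?case .
qed

text \<open>The factor 2 is a crude replacement for n/(n-1) that also covers the empty word; it
  disappears in the limit of the entropy.\<close>

lemma card_reduced_words:
  assumes "n \<ge> 2"
  shows "real (card (reduced_words n j)) \<le> 2 * (real n - 1) ^ j"
proof (cases j)
  case 0
  then have "reduced_words n j \<subseteq> {[]}" by (auto simp: reduced_words_def)
  then have "card (reduced_words n j) \<le> 1" using card_mono[of "{[]}" "reduced_words n j"] by simp
  then show ?thesis using 0 by simp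
next
  case (Suc i)
  have "real (card (reduced_words n j)) \<le> real (n * (n - 1) ^ i)"
    unfolding Suc using card_reduced_words_Suc of_nat_mono by blast
  also have "\<dots> = real n * (real n - 1) ^ i" using assms by (simp add: of_nat_diff)
  also have "\<dots> \<le> (2 * (real n - 1)) * (real n - 1) ^ i"
    using assms by (intro mult_right_mono) auto
  finally show ?thesis by (simp only: Suc power_Suc mult.assoc)
qed

lemma sum_cancel_cons:
  fixes f :: "nat \<Rightarrow> real"
  assumes "set w \<subseteq> {..<n}" "n \<ge> 1"
  shows "(\<Sum>i<n. f (length (cancel_cons i w))) = (if w = [] then real n * f 1
    else f (length w - 1) + (real n - 1) * f (Suc (length w)))"
proof (cases w)
  case (Cons h t)
  then have h: "h \<in> {..<n}" using assms by auto
  have "(\<Sum>i<n. f (length (cancel_cons i w)))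
      = f (length t) + (\<Sum>i\<in>{..<n} - {h}. f (length (cancel_cons i w)))"
    using h by (simp add: sum.remove Cons)
  also have "(\<Sum>i\<in>{..<n} - {h}. f (length (cancel_cons i w)))
      = (\<Sum>i\<in>{..<n} - {h}. f (Suc (length w)))"
    by (rule sum.cong) (auto simp: Cons)
  also have "\<dots> = (real n - 1) * f (Suc (length w))"
    using h assms by (simp add: of_nat_diff)
  finally show ?thesis by (simp add: Cons)
qed simp

text \<open>Before averaging, the length of the reduced word is corrected by the harmonic function
  $(n-1)^{-|w|}$ of the $n$-regular tree, with a factor making the drift exactly $(n-2)/n$ at
  the root as well.\<close>

lemma sum_length_free_reduce:
  assumes n: "n \<ge> 3"
  defines "c \<equiv> 2 * (real n - 1) / (real n * (real n - 2))"
  defines "\<phi> \<equiv> \<lambda>j. real j + c * (1 / (real n - 1)) ^ j"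
  shows "(\<Sum>ws\<in>words n k. \<phi> (length (free_reduce ws)))
    = real n ^ k * (c + real k * ((real n - 2) / real n))"
proof (induction k)
  case 0
  then show ?case by (simp add: \<phi>_def)
next
  case (Suc k)
  have step: "(\<Sum>i<n. \<phi> (length (cancel_cons i w))) = real n * \<phi> (length w) + (real n - 2)"
    if "set w \<subseteq> {..<n}" for w
  proof (cases w)
    case Nil
    \<comment> \<open>\<open>c\<close> is the solution of this root equation: the root has no
      backward edge, and the larger drop of the exponential term there offsets the larger growth of
      the length.\<close>
    have "real n * (real n - 2) > 0" using n by simp
    then have "real n * \<phi> 1 = real n * \<phi> 0 + (real n - 2)"
      using n by (simp add: \<phi>_def c_def divide_simps) (simp add: algebra_simps)
    then show ?thesis using Nil by (simp add: \<phi>_def)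
  next
    case (Cons h t)
    define p where "p = (1 / (real n - 1))"
    have p: "(real n - 1) * p = 1" using n by (simp add: p_def)
    have "(real n - 1) * p ^ Suc (length w) = p ^ length w"
      using p by (simp add: mult.assoc[symmetric])
    moreover have "p ^ (length w - 1) = (real n - 1) * p ^ length w"
      using p by (simp add: Cons mult.assoc[symmetric])
    ultimately have "c * (p ^ (length w - 1) + (real n - 1) * p ^ Suc (length w))
        = c * (real n * p ^ length w)"
      by (simp add: left_diff_distrib)
    then have "c * p ^ (length w - 1) + (real n - 1) * (c * p ^ Suc (length w))
        = real n * (c * p ^ length w)"
      by (simp add: distrib_left mult.left_commute)
    moreover have "real (length w - 1) = real (length w) - 1" using Cons by simp
    ultimately have "\<phi> (length w - 1) + (real n - 1) * \<phi> (Suc (length w))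
        = real n * \<phi> (length w) + (real n - 2)"
      unfolding \<phi>_def p_def[symmetric] by (simp add: algebra_simps)
    then show ?thesis using sum_cancel_cons[OF that] n Cons by simp
  qed
  have "(\<Sum>ws\<in>words n (Suc k). \<phi> (length (free_reduce ws)))
      = (\<Sum>ws\<in>words n k. real n * \<phi> (length (free_reduce ws)) + (real n - 2))"
    unfolding sum_words_Suc
  proof (rule sum.cong[OF refl])
    fix ws assume "ws \<in> words n k"
    then have "set (free_reduce ws) \<subseteq> {..<n}"
      using set_free_reduce by (fastforce simp: words_def)
    then show "(\<Sum>i<n. \<phi> (length (free_reduce (i # ws))))
        = real n * \<phi> (length (free_reduce ws)) + (real n - 2)"
      using step by simp
  qed
  also have "\<dots> = real n * (\<Sum>ws\<in>words n k. \<phi> (length (free_reduce ws))) + real n ^ k * (real n - 2)"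
    by (simp add: sum.distrib sum_distrib_left[symmetric] card_words)
  also have "\<dots> = real n ^ Suc k * (c + real (Suc k) * ((real n - 2) / real n))"
    unfolding Suc using n by (simp add: field_simps)
  finally show ?case .
qed

lemma average_length_free_reduce:
  assumes n: "n \<ge> 4"
  shows "(\<Sum>ws\<in>words n k. real (length (free_reduce ws))) / real n ^ k
    \<le> 1 + real k * ((real n - 2) / real n)"
proof -
  define c where "c = 2 * (real n - 1) / (real n * (real n - 2))"
  have c: "0 \<le> c" "c \<le> 1"
  proof -
    show "0 \<le> c" using n by (simp add: c_def)
    have "4 * (real n - 2) \<le> real n * (real n - 2)" using n by (intro mult_right_mono) auto
    then have "2 * (real n - 1) \<le> real n * (real n - 2)" using n by simp
    then show "c \<le> 1" using n by (simp add: c_def pos_divide_le_eq)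
  qed
  have "(\<Sum>ws\<in>words n k. real (length (free_reduce ws)))
      \<le> (\<Sum>ws\<in>words n k. real (length (free_reduce ws)) + c * (1 / (real n - 1)) ^ length (free_reduce ws))"
    using n c by (intro sum_mono) auto
  also have "\<dots> = real n ^ k * (c + real k * ((real n - 2) / real n))"
    using sum_length_free_reduce[of n k] n unfolding c_def by simp
  also have "\<dots> \<le> real n ^ k * (1 + real k * ((real n - 2) / real n))"
    using c by (intro mult_left_mono) auto
  finally show ?thesis using n by (simp add: field_simps)
qed

text \<open>The reference law gives a reduced word of length j weight proportional to (n-1)^(-j).
  Each sphere of the tree then has mass at most 2, so \<open>Z = 2 * (k + 1)\<close> normalises, and
  the cross entropy is the mean reduced length times \<open>ln (n - 1)\<close> up to a logarithmic
  term.\<close>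

lemma entropy_k_le:
  assumes n: "n \<ge> 4"
  shows "entropy_k n m k \<le> (1 + real k * ((real n - 2) / real n)) * ln (real n - 1) + ln (2 * (real k + 1))"
proof -
  let ?p = "word_prod n m"
  define R where "R = free_reduce ` words n k"
  define wt where "wt = (\<lambda>w :: nat list. (1 / (real n - 1)) ^ length w)"
  define Z where "Z = 2 * (real k + 1)"
  \<comment> \<open>The weights are summed over fibres: further relations in the group merge words
    and can only increase \<open>q\<close>, hence only decrease the bound.\<close>
  define q where "q = (\<lambda>g. (\<Sum>w\<in>{w\<in>R. ?p w = g}. wt w) / Z)"
  have Z: "Z > 0" by (simp add: Z_def)
  have finR: "finite R" by (simp add: R_def)
  have wt: "wt w > 0" for w using n by (simp add: wt_def)
  have "R \<subseteq> (\<Union>j\<le>k. reduced_words n j)"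
  proof
    fix w assume "w \<in> R"
    then obtain ws where ws: "ws \<in> words n k" "w = free_reduce ws" by (auto simp: R_def)
    then show "w \<in> (\<Union>j\<le>k. reduced_words n j)"
      using length_free_reduce[of ws] set_free_reduce[of ws] distinct_adj_free_reduce[of ws]
      by (auto simp: reduced_words_def words_def)
  qed
  then have "sum wt R \<le> sum wt (\<Union>j\<le>k. reduced_words n j)"
    by (intro sum_mono2) (auto intro: less_imp_le wt)
  also have "\<dots> \<le> (\<Sum>j\<le>k. sum wt (reduced_words n j))"
    by (intro order_eq_refl sum.UNION_disjoint ballI finite_reduced_words finite_atMost impI)
      (auto simp: reduced_words_def words_def)
  also have "\<dots> \<le> (\<Sum>j\<le>k. 2)"
  proof (rule sum_mono)
    fix j
    have "sum wt (reduced_words n j) = (\<Sum>w\<in>reduced_words n j. (1 / (real n - 1)) ^ j)"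
      by (rule sum.cong) (auto simp: reduced_words_def words_def wt_def)
    also have "\<dots> \<le> 2 * (real n - 1) ^ j * (1 / (real n - 1)) ^ j"
      using mult_right_mono[OF card_reduced_words[of n j], of "(1 / (real n - 1)) ^ j"] n by simp
    also have "\<dots> = 2" using n by (simp add: power_divide)
    finally show "sum wt (reduced_words n j) \<le> 2" .
  qed
  finally have sumR: "sum wt R \<le> Z" by (simp add: Z_def)
  have q_ge: "q (?p ws) \<ge> wt (free_reduce ws) / Z" if "ws \<in> words n k" for ws
    unfolding q_def using that Z finR
    by (intro divide_right_mono member_le_sum)
      (auto simp: R_def word_prod_free_reduce intro: less_imp_le wt)
  have "?p ` words n k = ?p ` R"
    by (auto simp: R_def image_image word_prod_free_reduce)
  then have "(\<Sum>g\<in>?p ` words n k. q g) = sum wt R / Z"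
    using finR by (simp add: q_def sum_divide_distrib[symmetric] sum.image_gen[symmetric])
  then have sumq: "(\<Sum>g\<in>?p ` words n k. q g) \<le> 1" using sumR Z by simp
  have q_pos: "q (?p ws) > 0" if "ws \<in> words n k" for ws
    using q_ge[OF that] wt[of "free_reduce ws"] Z by (auto intro: less_le_trans[rotated])
  have "entropy_k n m k \<le> (\<Sum>ws\<in>words n k. - ln (q (?p ws))) / real n ^ k"
    using n q_pos sumq by (intro entropy_k_le_cross_entropy) auto
  also have "\<dots> \<le> (\<Sum>ws\<in>words n k. real (length (free_reduce ws)) * ln (real n - 1) + ln Z) / real n ^ k"
  proof (intro divide_right_mono sum_mono)
    fix ws assume ws: "ws \<in> words n k"
    have "ln (wt (free_reduce ws) / Z) = - (real (length (free_reduce ws)) * ln (real n - 1)) - ln Z"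
      using n Z wt[of "free_reduce ws"] by (simp add: ln_div) (simp add: wt_def ln_realpow ln_div)
    moreover have "ln (wt (free_reduce ws) / Z) \<le> ln (q (?p ws))"
      using q_ge[OF ws] wt Z by (subst ln_le_cancel_iff) (auto simp: q_pos[OF ws])
    ultimately show "- ln (q (?p ws)) \<le> real (length (free_reduce ws)) * ln (real n - 1) + ln Z"
      by linarith
  qed simp
  also have "\<dots> = (\<Sum>ws\<in>words n k. real (length (free_reduce ws))) / real n ^ k * ln (real n - 1) + ln Z"
    using n by (simp add: sum.distrib card_words sum_distrib_right[symmetric] field_simps)
  also have "\<dots> \<le> (1 + real k * ((real n - 2) / real n)) * ln (real n - 1) + ln Z"
    using n average_length_free_reduce[OF n, of k] by (intro add_right_mono mult_right_mono) auto
  finally show ?thesis by (simp add: Z_def)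
qed

lemma entropy_limit:
  assumes n: "n \<ge> 4"
  shows "\<exists>h. (\<lambda>k. entropy_k n m k / real k) \<longlonglongrightarrow> h \<and> h \<le> (real n - 2) / real n * ln (real n - 1)"
proof -
  have "\<exists>h. (\<lambda>k. entropy_k n m k / real k) \<longlonglongrightarrow> h"
    using n by (intro subadditive_convergent entropy_k_subadditive entropy_k_nonneg) auto
  then obtain h where h: "(\<lambda>k. entropy_k n m k / real k) \<longlonglongrightarrow> h" ..
  define L where "L = ln (real n - 1)"
  define d where "d = (real n - 2) / real n"
  have "(\<lambda>k. ((1 + real k * d) * L + ln (2 * (real k + 1))) / real k) \<longlonglongrightarrow> d * L"
    by real_asymp
  moreover have "entropy_k n m k / real k \<le> ((1 + real k * d) * L + ln (2 * (real k + 1))) / real k" for k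
    unfolding L_def d_def by (intro divide_right_mono entropy_k_le n) simp
  ultimately have "h \<le> d * L"
    using h by (intro LIMSEQ_le[of _ h _ "d * L"]) auto
  then show ?thesis using h unfolding L_def d_def by blast
qed

section \<open>The future cone\<close>

text \<open>The closed future cone with its light-like boundary and 0. It defines a partial order on
  vectors preserved by the group, so a single comparison with \<open>origin\<close> can be
  transported by any group element.\<close>

definition fcone :: "real^3 \<Rightarrow> bool" where
  "fcone x \<longleftrightarrow> mink x x \<le> 0 \<and> x$3 \<ge> 0"

lemma cauchy_schwarz_2:
  fixes p q r s :: real
  shows "(p * r + q * s)\<^sup>2 \<le> (p\<^sup>2 + q\<^sup>2) * (r\<^sup>2 + s\<^sup>2)"
proof -
  have "(p\<^sup>2 + q\<^sup>2) * (r\<^sup>2 + s\<^sup>2) - (p * r + q * s)\<^sup>2 = (p * s - q * r)\<^sup>2" by algebra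
  then show ?thesis using zero_le_power2[of "p * s - q * r"] by linarith
qed

lemma fcone_mink_le_0:
  assumes "fcone x" "fcone y"
  shows "mink x y \<le> 0"
proof -
  have x: "(x$1)\<^sup>2 + (x$2)\<^sup>2 \<le> (x$3)\<^sup>2" "x$3 \<ge> 0" and y: "(y$1)\<^sup>2 + (y$2)\<^sup>2 \<le> (y$3)\<^sup>2" "y$3 \<ge> 0"
    using assms by (auto simp: fcone_def mink_def power2_eq_square)
  have "(x$1 * y$1 + x$2 * y$2)\<^sup>2 \<le> ((x$1)\<^sup>2 + (x$2)\<^sup>2) * ((y$1)\<^sup>2 + (y$2)\<^sup>2)"
    by (rule cauchy_schwarz_2)
  also have "\<dots> \<le> (x$3)\<^sup>2 * (y$3)\<^sup>2" using x y by (intro mult_mono) auto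
  also have "\<dots> = (x$3 * y$3)\<^sup>2" by (simp add: power_mult_distrib)
  finally have "x$1 * y$1 + x$2 * y$2 \<le> x$3 * y$3"
    by (rule power2_le_imp_le) (simp add: x(2) y(2))
  then show ?thesis by (simp add: mink_def)
qed

definition origin :: "real^3" where
  "origin = vector [0, 0, 1]"

lemma origin_simps [simp]: "origin $ 1 = 0" "origin $ 2 = 0" "origin $ 3 = 1"
  by (simp_all add: origin_def)

lemma mink_origin: "mink x origin = - x$3" "mink origin x = - x$3"
  by (simp_all add: mink_def)

lemma origin_in_hyp_plane [simp]: "origin \<in> hyp_plane"
  by (simp add: hyp_plane_def mink_def)

lemma hyp_plane_fcone: "x \<in> hyp_plane \<Longrightarrow> fcone x"
  by (auto simp: hyp_plane_def fcone_def)

lemma hyp_plane_mink_self: "x \<in> hyp_plane \<Longrightarrow> mink x x = -1"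
  by (simp add: hyp_plane_def)

lemma hyp_plane_ge_1:
  assumes "x \<in> hyp_plane"
  shows "x$3 \<ge> 1"
proof -
  have "x$1 * x$1 + x$2 * x$2 - x$3 * x$3 = -1" and pos: "x$3 > 0"
    using assms by (auto simp: hyp_plane_def mink_def)
  then have "1\<^sup>2 \<le> (x$3)\<^sup>2"
    using zero_le_square[of "x$1"] zero_le_square[of "x$2"] unfolding power2_eq_square by linarith
  then show ?thesis by (rule power2_le_imp_le) (simp add: pos less_imp_le)
qed

lemma hyp_plane_sq: "x \<in> hyp_plane \<Longrightarrow> (x$1)\<^sup>2 + (x$2)\<^sup>2 = (x$3)\<^sup>2 - 1"
  by (simp add: hyp_plane_def mink_def power2_eq_square)

text \<open>This vector is the point reflection of \<open>x\<close> in \<open>origin\<close>, and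
  the one in \<open>fcone_lower\<close> is that of \<open>origin\<close> in \<open>x\<close>, so
  both lie on the hyperboloid again. In the cone order, \<open>x\<close> is thus caught between two
  multiples of \<open>origin\<close>, which is the source of all bounded-distortion estimates
  below.\<close>

lemma fcone_upper: "x \<in> hyp_plane \<Longrightarrow> fcone ((2 * x$3) *\<^sub>R origin - x)"
  using hyp_plane_mink_self[of x] hyp_plane_ge_1[of x]
  by (auto simp: fcone_def mink_simps mink_origin)

lemma fcone_lower:
  assumes "x \<in> hyp_plane"
  shows "fcone ((2 * x$3) *\<^sub>R x - origin)"
proof -
  have "1 * 1 \<le> x$3 * x$3" using hyp_plane_ge_1[OF assms] by (intro mult_mono) auto
  then show ?thesis using hyp_plane_mink_self[OF assms]
    by (auto simp: fcone_def mink_simps mink_origin)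
qed

text \<open>The reversed Cauchy-Schwarz inequality for time-like vectors; it puts the argument of
  \<open>arcosh\<close> into its domain.\<close>

lemma mink_hyp_plane_le:
  assumes "x \<in> hyp_plane" "y \<in> hyp_plane"
  shows "mink x y \<le> -1"
proof -
  let ?p = "(x$1)\<^sup>2 + (x$2)\<^sup>2" and ?q = "(y$1)\<^sup>2 + (y$2)\<^sup>2"
  let ?s = "x$1 * y$1 + x$2 * y$2"
  note x = hyp_plane_sq[OF assms(1)] and y = hyp_plane_sq[OF assms(2)]
  have "?s \<le> (?p + ?q) / 2"
    using zero_le_power2[of "x$1 - y$1"] zero_le_power2[of "x$2 - y$2"]
    by (simp add: power2_eq_square algebra_simps)
  moreover have "?s\<^sup>2 \<le> ?p * ?q" by (rule cauchy_schwarz_2)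
  ultimately have "(1 + ?s)\<^sup>2 \<le> (1 + ?p) * (1 + ?q)" by (simp add: power2_eq_square algebra_simps)
  also have "\<dots> = (x$3 * y$3)\<^sup>2" using x y by (simp add: power_mult_distrib)
  finally have "1 + ?s \<le> x$3 * y$3"
    by (rule power2_le_imp_le) (use hyp_plane_ge_1[OF assms(1)] hyp_plane_ge_1[OF assms(2)] in simp)
  then show ?thesis by (simp add: mink_def)
qed

lemma mink_hyp_plane_ge:
  assumes "x \<in> hyp_plane" "y \<in> hyp_plane"
  shows "- mink x y \<le> 2 * x$3 * y$3"
  using fcone_mink_le_0[OF fcone_upper[OF assms(1)] hyp_plane_fcone[OF assms(2)]]
  by (simp add: mink_simps mink_origin)

lemma mink_hyp_plane_ge':
  assumes "x \<in> hyp_plane" "y \<in> hyp_plane"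
  shows "y$3 \<le> 2 * x$3 * (- mink x y)"
  using fcone_mink_le_0[OF fcone_lower[OF assms(1)] hyp_plane_fcone[OF assms(2)]]
  by (simp add: mink_simps mink_origin)

lemma arcosh_ge_ln:
  fixes t :: real
  assumes "t \<ge> 1"
  shows "ln t \<le> arcosh t"
proof -
  have "t\<^sup>2 \<ge> 1" using assms by simp
  then have "ln t \<le> ln (t + sqrt (t\<^sup>2 - 1))" using assms by (subst ln_le_cancel_iff) (auto intro: add_pos_nonneg)
  then show ?thesis using assms by (simp add: arcosh_real_def)
qed

lemma arcosh_le_ln:
  fixes t :: real
  assumes "t \<ge> 1"
  shows "arcosh t \<le> ln (2 * t)"
proof -
  have t: "t\<^sup>2 \<ge> 1" using assms by simp
  have "sqrt (t\<^sup>2 - 1) \<le> t" using assms by (intro real_le_lsqrt) auto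
  then have "ln (t + sqrt (t\<^sup>2 - 1)) \<le> ln (2 * t)"
    using assms t by (subst ln_le_cancel_iff) (auto intro: add_pos_nonneg)
  then show ?thesis using assms by (simp add: arcosh_real_def)
qed

lemma sin_pi_fraction_compl:
  assumes "d < N"
  shows "sin (pi * real (N - d) / real N) = sin (pi * real d / real N)"
proof -
  have "pi * real (N - d) / real N = pi - pi * real d / real N"
    using assms by (simp add: of_nat_diff field_simps)
  then show ?thesis by simp
qed

text \<open>The symmetry d to N - d folds the decreasing half of the sine arch onto the increasing
  one. Used for non-adjacent sides and for points on a circle.\<close>

lemma sin_pi_fraction_mono:
  assumes "e \<le> d" "d + e \<le> N" "e > 0"
  shows "sin (pi * real e / real N) \<le> sin (pi * real d / real N)"
proof -
  have N: "N > 0" using assms by simp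
  have mono: "sin (pi * real e / real N) \<le> sin (pi * real d / real N)"
    if "e \<le> d" "2 * d \<le> N" for d
  proof (rule sin_monotone_2pi_le)
    show "- (pi / 2) \<le> pi * real e / real N" by (rule order_trans[of _ 0]) auto
    show "pi * real e / real N \<le> pi * real d / real N" using that by (intro divide_right_mono) auto
    have "2 * real d \<le> real N" using that by linarith
    then show "pi * real d / real N \<le> pi / 2" using N by (simp add: field_simps)
  qed
  show ?thesis
  proof (cases "2 * d \<le> N")
    case False
    then have "sin (pi * real e / real N) \<le> sin (pi * real (N - d) / real N)"
      using assms by (intro mono) auto
    then show ?thesis using sin_pi_fraction_compl[of d N] assms by simp
  qed (use mono assms in auto)
qed

section \<open>The polygon and its reflection group\<close>

text \<open>With \<open>n\<close> and \<open>m\<close> at least 4, the excluded pair (4, 4) is the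
  Euclidean square; all other pairs give a positive inradius, see \<open>a_gt_1\<close>.\<close>

locale hyperbolic_polygon =
  fixes n m :: nat
  assumes n4: "n \<ge> 4" and m4: "m \<ge> 4" and even_m: "even m" and not44: "(n, m) \<noteq> (4, 4)"
begin

definition a where "a = cos (pi / real m) / sin (pi / real n)"
definition b where "b = sqrt (a\<^sup>2 - 1)"

abbreviation "u \<equiv> side_normal n m"
abbreviation "R i x \<equiv> refl_mat n m i *v x"

lemma sin_pi_n: "sin (pi / real n) > 0"
  using n4 by (intro sin_gt_zero) (auto simp: field_simps)

lemma a_gt_1: "a > 1"
proof -
  have m6: "m \<ge> 6" if "m \<noteq> 4" using that m4 even_m by presburger
  have neg: "- (pi / 2) \<le> pi / real n" by (rule order_trans[of _ 0]) auto
  have "sin (pi / real n) \<le> sin (pi / 4)"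
    using n4 by (intro sin_monotone_2pi_le neg) (auto simp: field_simps)
  moreover have "cos (pi / 4) \<le> cos (pi / real m)"
    using m4 by (intro cos_monotone_0_pi_le) (auto simp: field_simps)
  moreover have "sin (pi / real n) < sin (pi / 4) \<or> cos (pi / 4) < cos (pi / real m)"
  proof (cases "n = 4")
    case True
    then have "m > 4" using not44 m4 by auto
    then have "cos (pi / 4) < cos (pi / real m)"
      by (intro cos_monotone_0_pi) (auto simp: field_simps)
    then show ?thesis ..
  next
    case False
    then have "n > 4" using n4 by simp
    then have "sin (pi / real n) < sin (pi / 4)"
      by (intro sin_monotone_2pi neg) (auto simp: field_simps)
    then show ?thesis ..
  qed
  ultimately have "sin (pi / real n) < cos (pi / real m)"
    unfolding sin_45 cos_45 by linarith
  then show ?thesis using sin_pi_n by (simp add: a_def)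
qed

lemma a_sin: "a * sin (pi / real n) = cos (pi / real m)"
  using sin_pi_n by (simp add: a_def)

lemma b_pos: "b > 0"
  using a_gt_1 by (simp add: b_def)

lemma a_sq: "a\<^sup>2 = 1 + b\<^sup>2"
  using a_gt_1 by (simp add: b_def)

lemma b_less_a: "b < a"
proof (rule power2_less_imp_less)
  show "b\<^sup>2 < a\<^sup>2" unfolding a_sq by simp
  show "0 \<le> a" using a_gt_1 by simp
qed

lemma u_components:
  "u i $ 1 = a * cos (2 * pi * real i / real n)"
  "u i $ 2 = a * sin (2 * pi * real i / real n)"
  "u i $ 3 = b"
  using a_gt_1 unfolding side_normal_def inradius_def a_def[symmetric] b_def
  by (auto simp: Let_def sinh_arcosh_real)

lemma mink_u: "mink x (u i) = a * (x$1 * cos (2 * pi * real i / real n)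
    + x$2 * sin (2 * pi * real i / real n)) - b * x$3"
  by (simp add: mink_def u_components algebra_simps)

lemma gram:
  "mink (u i) (u j) = 1 - 2 * a\<^sup>2 * (sin (pi * (real i - real j) / real n))\<^sup>2"
proof -
  let ?s = "2 * pi * real i / real n" and ?t = "2 * pi * real j / real n"
  have "mink (u i) (u j) = a\<^sup>2 * (cos ?s * cos ?t + sin ?s * sin ?t) - b\<^sup>2"
    by (simp add: mink_u u_components power2_eq_square algebra_simps)
  also have "cos ?s * cos ?t + sin ?s * sin ?t = cos (?s - ?t)" by (simp add: cos_diff)
  also have "?s - ?t = 2 * (pi * (real i - real j) / real n)" by (simp add: diff_divide_distrib algebra_simps)
  also have "cos (2 * (pi * (real i - real j) / real n))
      = 1 - 2 * (sin (pi * (real i - real j) / real n))\<^sup>2"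
    by (rule cos_double_sin)
  finally show ?thesis using a_sq by (simp add: algebra_simps)
qed

lemma cos_sq_ge_half: "k \<ge> 4 \<Longrightarrow> (cos (pi / real k))\<^sup>2 \<ge> 1 / 2"
proof -
  assume "k \<ge> 4"
  then have "cos (pi / 4) \<le> cos (pi / real k)"
    by (intro cos_monotone_0_pi_le) (auto simp: field_simps)
  then have "(cos (pi / 4))\<^sup>2 \<le> (cos (pi / real k))\<^sup>2" by (intro power_mono) (auto simp: cos_45)
  then show ?thesis by (simp add: cos_45 power_divide)
qed

text \<open>Adjacent sides meet at the interior angle, all other pairs are disjoint. For these, the
  double angle formula turns the smallest relevant value of \<open>a * sin\<close> into 2 cos(pi/m)
  cos(pi/n), which is at least 1 because both squared cosines are at least 1/2.\<close>

lemma gram_cases: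
  assumes "i < n" "j < n" "i \<noteq> j"
  shows "mink (u i) (u j) = - cos (2 * pi / real m) \<or> mink (u i) (u j) \<le> -1"
proof -
  define d where "d = (if i < j then j - i else i - j)"
  have d: "1 \<le> d" "d \<le> n - 1" using assms by (auto simp: d_def)
  have sin_d: "(sin (pi * (real i - real j) / real n))\<^sup>2 = (sin (pi * real d / real n))\<^sup>2"
  proof (cases "i < j")
    case True
    then have "pi * (real i - real j) / real n = - (pi * real d / real n)"
      using n4 by (simp add: d_def of_nat_diff divide_simps) (simp add: algebra_simps)
    then show ?thesis by simp
  qed (use assms in \<open>simp add: d_def of_nat_diff\<close>)
  consider "d = 1 \<or> d = n - 1" | "2 \<le> d" "d \<le> n - 2" using d by linarith
  then show ?thesis
  proof cases
    case 1
    then have "(sin (pi * real d / real n))\<^sup>2 = (sin (pi / real n))\<^sup>2"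
      using sin_pi_fraction_compl[of d n] d by auto
    then have "mink (u i) (u j) = 1 - 2 * (a * sin (pi / real n))\<^sup>2"
      using gram[of i j] sin_d by (simp add: power_mult_distrib)
    also have "\<dots> = - cos (2 * (pi / real m))"
      unfolding a_sin by (subst cos_double_cos) simp
    finally show ?thesis by simp
  next
    case 2
    then have "sin (pi * real 2 / real n) \<le> sin (pi * real d / real n)"
      using n4 by (intro sin_pi_fraction_mono) auto
    moreover have "sin (pi * 2 / real n) \<ge> 0" using n4 by (intro sin_ge_zero) (auto simp: field_simps)
    ultimately have "(sin (2 * (pi / real n)))\<^sup>2 \<le> (sin (pi * real d / real n))\<^sup>2"
      by (intro power_mono) (auto simp: mult.commute)
    then have "a\<^sup>2 * (2 * sin (pi / real n) * cos (pi / real n))\<^sup>2 \<le> a\<^sup>2 * (sin (pi * real d / real n))\<^sup>2"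
      unfolding sin_double by (intro mult_left_mono) auto
    moreover have "a\<^sup>2 * (2 * sin (pi / real n) * cos (pi / real n))\<^sup>2
        = 4 * ((a * sin (pi / real n))\<^sup>2 * (cos (pi / real n))\<^sup>2)"
      by (simp add: power_mult_distrib)
    moreover have "(cos (pi / real m))\<^sup>2 * (cos (pi / real n))\<^sup>2 \<ge> 1 / 2 * (1 / 2)"
      using cos_sq_ge_half[OF n4] cos_sq_ge_half[OF m4] by (intro mult_mono) auto
    ultimately have "a\<^sup>2 * (sin (pi * real d / real n))\<^sup>2 \<ge> 1" unfolding a_sin by linarith
    then show ?thesis using gram[of i j] sin_d by simp
  qed
qed

lemma refl_third: "R i x $ 3 = (1 + 2 * b\<^sup>2) * x$3
    - 2 * a * b * (x$1 * cos (2 * pi * real i / real n) + x$2 * sin (2 * pi * real i / real n))"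
  by (simp add: refl_mat_mult mink_u u_components power2_eq_square algebra_simps)

text \<open>\<open>(a - b)\<^sup>2\<close> is exp(-2r) for the inradius r, the strongest possible
  contraction of heights. Its positivity keeps points on the upper sheet and light-like vectors
  pointing to the future.\<close>

lemma fcone_refl:
  assumes "fcone x"
  shows "fcone (R i x)" "(a - b)\<^sup>2 * x$3 \<le> R i x $ 3"
proof -
  let ?t = "2 * pi * real i / real n"
  have x: "(x$1)\<^sup>2 + (x$2)\<^sup>2 \<le> (x$3)\<^sup>2" "x$3 \<ge> 0"
    using assms by (auto simp: fcone_def mink_def power2_eq_square)
  have "(x$1 * cos ?t + x$2 * sin ?t)\<^sup>2 \<le> ((x$1)\<^sup>2 + (x$2)\<^sup>2) * ((cos ?t)\<^sup>2 + (sin ?t)\<^sup>2)"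
    by (rule cauchy_schwarz_2)
  also have "\<dots> \<le> (x$3)\<^sup>2" using x by simp
  finally have "x$1 * cos ?t + x$2 * sin ?t \<le> x$3" by (rule power2_le_imp_le) (rule x(2))
  then have "2 * a * b * (x$1 * cos ?t + x$2 * sin ?t) \<le> 2 * a * b * x$3"
    using a_gt_1 b_pos by (intro mult_left_mono) auto
  moreover have "(a - b)\<^sup>2 = 1 + 2 * b\<^sup>2 - 2 * a * b" using a_sq by (simp add: power2_diff)
  then have "(a - b)\<^sup>2 * x$3 = (1 + 2 * b\<^sup>2) * x$3 - 2 * a * b * x$3"
    by (simp only: left_diff_distrib)
  ultimately show *: "(a - b)\<^sup>2 * x$3 \<le> R i x $ 3" unfolding refl_third by linarith
  have "0 \<le> (a - b)\<^sup>2 * x$3" using x by simp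
  then have "0 \<le> R i x $ 3" using * by (rule order_trans)
  then show "fcone (R i x)" using assms by (simp add: fcone_def)
qed

lemma hyp_plane_refl:
  assumes "x \<in> hyp_plane"
  shows "R i x \<in> hyp_plane"
proof -
  have "0 < (a - b)\<^sup>2 * x$3" using assms b_less_a by (simp add: hyp_plane_def)
  also have "\<dots> \<le> R i x $ 3" using assms by (intro fcone_refl hyp_plane_fcone)
  finally show ?thesis using assms by (simp add: hyp_plane_def)
qed

subsection \<open>Group elements\<close>

text \<open>Letters are unrestricted here, so facts true of every single reflection need no index
  bound; \<open>Gamma n m\<close> is contained in this set.\<close>

definition G where "G = range (word_prod n m)"

lemma word_prod_in_G [simp]: "word_prod n m ws \<in> G"
  by (simp add: G_def)

lemma Gamma_subset_G: "Gamma n m \<subseteq> G"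
  by (auto simp: Gamma_def)

lemma one_in_G [simp]: "mat 1 \<in> G"
  using word_prod_in_G[of "[]"] by (simp del: word_prod_in_G)

lemma G_induct [consumes 1, case_names one refl]:
  assumes "g \<in> G" "P (mat 1)" "\<And>i g. g \<in> G \<Longrightarrow> P g \<Longrightarrow> P (refl_mat n m i ** g)"
  shows "P g"
proof -
  have "P (word_prod n m ws)" for ws
    by (induction ws) (auto intro: assms(2) assms(3)[of "word_prod n m _"])
  then show ?thesis using assms(1) by (auto simp: G_def)
qed

lemma mink_G: "g \<in> G \<Longrightarrow> mink (g *v x) (g *v y) = mink x y"
  by (induction g rule: G_induct) (auto simp: matrix_vector_mul_assoc[symmetric])

lemma fcone_G: "g \<in> G \<Longrightarrow> fcone x \<Longrightarrow> fcone (g *v x)"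
  by (induction g rule: G_induct) (auto simp: matrix_vector_mul_assoc[symmetric] fcone_refl)

lemma hyp_plane_G: "g \<in> G \<Longrightarrow> x \<in> hyp_plane \<Longrightarrow> g *v x \<in> hyp_plane"
  by (induction g rule: G_induct) (auto simp: matrix_vector_mul_assoc[symmetric] hyp_plane_refl)

lemma third_mono_G:
  assumes "g \<in> G" "fcone (y - x)"
  shows "(g *v x) $ 3 \<le> (g *v y) $ 3"
  using fcone_G[OF assms] by (simp add: fcone_def matrix_vector_mult_diff_distrib)

definition D where "D g = (g *v origin) $ 3"

lemma D_ge_1: "g \<in> G \<Longrightarrow> D g \<ge> 1"
  unfolding D_def by (intro hyp_plane_ge_1 hyp_plane_G) auto

lemma third_le_D:
  assumes "g \<in> G" "x \<in> hyp_plane"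
  shows "(g *v x) $ 3 \<le> 2 * x$3 * D g" "D g \<le> 2 * x$3 * (g *v x) $ 3"
  using third_mono_G[OF assms(1) fcone_upper[OF assms(2)]]
    third_mono_G[OF assms(1) fcone_lower[OF assms(2)]]
  by (simp_all add: D_def matrix_vector_mult_scaleR)

lemma D_mult_le:
  assumes "g \<in> G" "h \<in> G"
  shows "D (g ** h) \<le> 2 * D g * D h"
  using third_le_D(1)[OF assms(1) hyp_plane_G[OF assms(2) origin_in_hyp_plane]]
  by (simp add: D_def matrix_vector_mul_assoc[symmetric] mult_ac)

text \<open>Moving from the base point to \<open>origin\<close> costs a factor 2z in each of the two
  arguments, and \<open>arcosh t \<le> ln (2 * t)\<close> a further 2; together 8z^2 for a base
  point of height z.\<close>

lemma gdist_D:
  assumes "g \<in> G" "x0 \<in> hyp_plane"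
  shows "\<bar>gdist n m x0 g - ln (D g)\<bar> \<le> ln (8 * (x0$3)\<^sup>2)"
proof -
  define z where "z = x0$3"
  define t where "t = - mink x0 (g *v x0)"
  have z: "z \<ge> 1" using hyp_plane_ge_1 assms by (simp add: z_def)
  note y = hyp_plane_G[OF assms]
  have t1: "t \<ge> 1" using mink_hyp_plane_le[OF assms(2) y] by (simp add: t_def)
  have "t \<le> 2 * z * (g *v x0) $ 3" using mink_hyp_plane_ge[OF assms(2) y] by (simp add: t_def z_def)
  also have "\<dots> \<le> 2 * z * (2 * z * D g)"
    using third_le_D(1)[OF assms] z by (intro mult_left_mono) (auto simp: z_def)
  finally have up: "t \<le> 4 * z\<^sup>2 * D g" by (simp add: power2_eq_square)
  have "D g \<le> 2 * z * (g *v x0) $ 3" using third_le_D(2)[OF assms] by (simp add: z_def)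
  also have "\<dots> \<le> 2 * z * (2 * z * t)"
    using mink_hyp_plane_ge'[OF assms(2) y] z by (intro mult_left_mono) (auto simp: z_def t_def)
  finally have low: "D g \<le> 4 * z\<^sup>2 * t" by (simp add: power2_eq_square)
  have D: "D g \<ge> 1" using D_ge_1 assms by simp
  have "arcosh t \<le> ln (2 * t)" using t1 by (rule arcosh_le_ln)
  also have "\<dots> \<le> ln (8 * z\<^sup>2 * D g)" using up t1 z D by (subst ln_le_cancel_iff) (auto simp: algebra_simps)
  also have "\<dots> = ln (8 * z\<^sup>2) + ln (D g)" using z D by (subst ln_mult) auto
  finally have 1: "arcosh t - ln (D g) \<le> ln (8 * z\<^sup>2)" by simp
  have "4 * z\<^sup>2 * t \<le> 8 * z\<^sup>2 * t" using t1 by (intro mult_right_mono) auto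
  then have "ln (D g) \<le> ln (8 * z\<^sup>2 * t)" using low t1 z D by (subst ln_le_cancel_iff) auto
  also have "\<dots> = ln (8 * z\<^sup>2) + ln t" using z t1 by (subst ln_mult) auto
  also have "ln t \<le> arcosh t" using t1 by (rule arcosh_ge_ln)
  finally have "ln (D g) - arcosh t \<le> ln (8 * z\<^sup>2)" by simp
  then show ?thesis using 1 unfolding gdist_def hdist_def z_def[symmetric] t_def[symmetric] by linarith
qed

end

section \<open>The polygon is a fundamental domain\<close>

lemma cos_ge_parabola: "cos x \<ge> 1 - x\<^sup>2 / 2" for x :: real
proof -
  have "(sin (x / 2))\<^sup>2 \<le> (x / 2)\<^sup>2"
    using abs_sin_x_le_abs_x[of "x / 2"] by (simp only: abs_le_square_iff)
  moreover have "cos (2 * (x / 2)) = 1 - 2 * (sin (x / 2))\<^sup>2" by (rule cos_double_sin)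
  ultimately show ?thesis by (simp add: power_divide)
qed

lemma sin_ge_cubic:
  fixes x :: real
  assumes "x \<ge> 0"
  shows "sin x \<ge> x - x ^ 3 / 6"
proof -
  have "(\<lambda>x. sin x - x + x ^ 3 / 6) 0 \<le> (\<lambda>x. sin x - x + x ^ 3 / 6) x"
  proof (rule DERIV_nonneg_imp_nondecreasing[OF assms])
    fix t :: real
    have "((\<lambda>x. sin x - x + x ^ 3 / 6) has_real_derivative (cos t - 1 + t\<^sup>2 / 2)) (at t)"
      by (auto intro!: derivative_eq_intros simp: power2_eq_square)
    then show "\<exists>y. ((\<lambda>x. sin x - x + x ^ 3 / 6) has_real_derivative y) (at t) \<and> 0 \<le> y"
      using cos_ge_parabola[of t] by (intro exI[of _ "cos t - 1 + t\<^sup>2 / 2"]) auto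
  qed
  then show ?thesis by simp
qed

context hyperbolic_polygon
begin

definition \<alpha> where "\<alpha> = 2 * pi / real m"
text \<open>Half the order of the dihedral group of a vertex is \<open>m / 2\<close>; the identity
  \<open>q * \<alpha> = pi\<close> is where evenness of \<open>m\<close> enters.\<close>

definition q where "q = m div 2"

lemma q_ge_2: "q \<ge> 2" and q_alpha: "real q * \<alpha> = pi"
proof -
  show "q \<ge> 2" using m4 by (simp add: q_def)
  have "real m = 2 * real q" using even_m by (auto simp: q_def elim!: evenE)
  then show "real q * \<alpha> = pi" using m4 by (simp add: \<alpha>_def)
qed

lemma alpha_bounds: "0 < \<alpha>" "\<alpha> < pi"
  using m4 by (auto simp: \<alpha>_def field_simps)

lemma sin_alpha: "sin \<alpha> > 0"
  using alpha_bounds by (intro sin_gt_zero) auto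

definition outside :: "nat \<Rightarrow> real^3 \<Rightarrow> bool" where
  "outside i y \<longleftrightarrow> mink y (u i) > 0"

definition move :: "real^3 \<Rightarrow> real^3 \<Rightarrow> bool" where
  "move y z \<longleftrightarrow> (\<exists>i<n. outside i y \<and> z = R i y)"

definition inside :: "real^3 \<Rightarrow> bool" where
  "inside z \<longleftrightarrow> (\<forall>i<n. \<not> outside i z)"

lemma not_move_inside: "inside z \<Longrightarrow> \<not> move z y"
  by (auto simp: inside_def move_def)

lemma move_hyp_plane: "y \<in> hyp_plane \<Longrightarrow> move y z \<Longrightarrow> z \<in> hyp_plane"
  by (auto simp: move_def hyp_plane_refl)

text \<open>For two sides that are not adjacent, the sum of the normals is a future causal vector.\<close>

lemma outside_both:
  assumes "i < n" "j < n" "i \<noteq> j" "y \<in> hyp_plane" "outside i y" "outside j y"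
  shows "mink (u i) (u j) = - cos \<alpha>"
proof (rule ccontr)
  assume "mink (u i) (u j) \<noteq> - cos \<alpha>"
  then have "mink (u i) (u j) \<le> -1" using gram_cases[of i j] assms by (auto simp: \<alpha>_def)
  then have "fcone (u i + u j)"
    using b_pos by (simp add: fcone_def mink_simps mink_commute[of "u j" "u i"] u_components)
  then have "mink y (u i + u j) \<le> 0"
    by (rule fcone_mink_le_0[OF hyp_plane_fcone[OF assms(4)]])
  then show False using assms by (simp add: mink_simps outside_def)
qed

section \<open>Alternating reflections in two adjacent sides\<close>

primrec alternate :: "nat \<Rightarrow> nat \<Rightarrow> real^3 \<Rightarrow> nat \<Rightarrow> real^3" where
  "alternate i j y 0 = y"
| "alternate i j y (Suc k) = R (if even k then i else j) (alternate i j y k)"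

text \<open>Both products follow the recurrence x(k+1) = 2 cos(\<alpha>) x(k) - x(k-1), solved by
  sines. The parity selects the next mirror in the first claim and the previous one in the second,
  and each claim needs the other in the induction.\<close>

lemma mink_alternate:
  assumes "mink (u i) (u j) = - cos \<alpha>"
  shows "sin \<alpha> * mink (alternate i j y k) (u (if even k then i else j))
      = mink y (u i) * sin ((real k + 1) * \<alpha>) + mink y (u j) * sin (real k * \<alpha>)"
    and "sin \<alpha> * mink (alternate i j y k) (u (if even k then j else i))
      = - (mink y (u i) * sin (real k * \<alpha>) + mink y (u j) * sin ((real k - 1) * \<alpha>))"
proof (induction k)
  case 0
  { case 1 show ?case by simp }
  { case 2 show ?case by simp }
next
  case (Suc k)
  define l r where "l = (if even k then i else j)" and "r = (if even k then j else i)"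
  define s t where "s = mink y (u i)" and "t = mink y (u j)"
  define x where "x = alternate i j y k"
  have IH: "sin \<alpha> * mink x (u l) = s * sin ((real k + 1) * \<alpha>) + t * sin (real k * \<alpha>)"
    "sin \<alpha> * mink x (u r) = - (s * sin (real k * \<alpha>) + t * sin ((real k - 1) * \<alpha>))"
    using Suc unfolding l_def r_def s_def t_def x_def by auto
  have lr: "mink (u l) (u r) = - cos \<alpha>"
    using assms by (auto simp: l_def r_def mink_commute[of "u j"])
  have step: "alternate i j y (Suc k) = R l x" by (simp add: l_def x_def)
  have parity: "(if even (Suc k) then i else j) = r" "(if even (Suc k) then j else i) = l"
    by (simp_all add: l_def r_def)
  have sin_rec: "sin ((c + 1) * \<alpha>) = 2 * cos \<alpha> * sin (c * \<alpha>) - sin ((c - 1) * \<alpha>)" for c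
    by (simp add: distrib_right left_diff_distrib sin_add sin_diff)
  { case 1
    have "sin \<alpha> * mink (R l x) (u r) = sin \<alpha> * mink x (u r) + 2 * cos \<alpha> * (sin \<alpha> * mink x (u l))"
      by (simp add: refl_mat_mult mink_simps lr algebra_simps)
    also have "\<dots> = s * (2 * cos \<alpha> * sin ((real k + 1) * \<alpha>) - sin (((real k + 1) - 1) * \<alpha>))
        + t * (2 * cos \<alpha> * sin (real k * \<alpha>) - sin ((real k - 1) * \<alpha>))"
      unfolding IH by (simp add: algebra_simps)
    also have "\<dots> = s * sin ((real k + 1 + 1) * \<alpha>) + t * sin ((real k + 1) * \<alpha>)"
      by (simp only: sin_rec[symmetric])
    finally show ?case unfolding step parity by (simp add: s_def t_def add.commute add.left_commute) }
  { case 2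
    have "sin \<alpha> * mink (R l x) (u l) = - (sin \<alpha> * mink x (u l))"
      by (simp add: refl_mat_mult mink_simps algebra_simps)
    then show ?case unfolding step parity IH by (simp add: s_def t_def add.commute) }
qed

lemma alternate_span: "\<exists>c d. alternate i j y k = y + c *\<^sub>R u i + d *\<^sub>R u j"
proof (induction k)
  case 0
  show ?case by (intro exI[of _ 0]) simp
next
  case (Suc k)
  then obtain c d where cd: "alternate i j y k = y + c *\<^sub>R u i + d *\<^sub>R u j" by blast
  define e where "e = - 2 * mink (alternate i j y k) (u (if even k then i else j))"
  have "alternate i j y (Suc k) = alternate i j y k + e *\<^sub>R u (if even k then i else j)"
    by (simp add: refl_mat_mult e_def)
  also have "\<dots> = y + (if even k then c + e else c) *\<^sub>R u i + (if even k then d else d + e) *\<^sub>R u j"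
    unfolding cd by (simp add: scaleR_add_left)
  finally show ?case by blast
qed

text \<open>At \<open>k = q\<close> the angles are pi and pi plus or minus \<alpha>: this is the
  longest element of the dihedral group, which sends the sector at the vertex to the opposite
  one.\<close>

lemma mink_alternate_end:
  assumes ij: "mink (u i) (u j) = - cos \<alpha>"
  shows "mink (alternate i j y q) (u (if even q then i else j)) = - mink y (u i)"
    and "mink (alternate i j y q) (u (if even q then j else i)) = - mink y (u j)"
proof -
  have "(real q + 1) * \<alpha> = pi + \<alpha>" "(real q - 1) * \<alpha> = pi - \<alpha>"
    using q_alpha by (simp_all add: algebra_simps)
  then have "sin ((real q + 1) * \<alpha>) = - sin \<alpha>" "sin (real q * \<alpha>) = 0" "sin ((real q - 1) * \<alpha>) = sin \<alpha>"
    by (simp_all add: q_alpha)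
  note sins = this
  have cancel: "x = - s" if "sin \<alpha> * x = - (s * sin \<alpha>)" for x s
  proof -
    have "sin \<alpha> * x = sin \<alpha> * (- s)" using that by simp
    then show ?thesis using sin_alpha by (simp only: mult_cancel_left) auto
  qed
  show "mink (alternate i j y q) (u (if even q then i else j)) = - mink y (u i)"
    by (rule cancel, subst mink_alternate(1)[OF ij]) (simp add: sins)
  show "mink (alternate i j y q) (u (if even q then j else i)) = - mink y (u j)"
    by (rule cancel, subst mink_alternate(2)[OF ij]) (simp add: sins)
qed

text \<open>The braid relation, seen on points: the two results differ by a vector in the span of
  both normals that is also orthogonal to both, and the Gram determinant 1 - cos^2(\<alpha>) is not
  0.\<close>

lemma alternate_commute:
  assumes ij: "mink (u i) (u j) = - cos \<alpha>"
  shows "alternate i j y q = alternate j i y q"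
proof -
  obtain c d where 1: "alternate i j y q = y + c *\<^sub>R u i + d *\<^sub>R u j" using alternate_span by blast
  obtain c' d' where 2: "alternate j i y q = y + c' *\<^sub>R u j + d' *\<^sub>R u i" using alternate_span by blast
  define x z where "x = c - d'" and "z = d - c'"
  have ji: "mink (u j) (u i) = - cos \<alpha>" using ij by (simp add: mink_commute)
  have diff: "alternate i j y q - alternate j i y q = x *\<^sub>R u i + z *\<^sub>R u j"
    unfolding 1 2 x_def z_def by (simp add: algebra_simps)
  have "mink (alternate i j y q - alternate j i y q) (u i) = 0"
    "mink (alternate i j y q - alternate j i y q) (u j) = 0"
    using mink_alternate_end[OF ij, of y] mink_alternate_end[OF ji, of y]
    by (auto simp: mink_simps split: if_splits)
  then have xz: "x = z * cos \<alpha>" "z = x * cos \<alpha>"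
    unfolding diff by (simp_all add: mink_simps ij ji)
  then have "x * (1 - cos \<alpha> * cos \<alpha>) = 0" by (simp add: algebra_simps)
  moreover have "1 - cos \<alpha> * cos \<alpha> \<noteq> 0"
    using mult_pos_pos[OF sin_alpha sin_alpha] sin_squared_eq[of \<alpha>] by (simp add: power2_eq_square)
  ultimately have "x = 0" by simp
  moreover from this have "z = 0" using xz(2) by simp
  ultimately show ?thesis using diff by simp
qed

text \<open>All \<open>q\<close> alternating reflections are legal moves: before step
  \<open>q\<close> the angles stay in [0, pi], so both terms are nonnegative and one is
  positive.\<close>

lemma outside_alternate:
  assumes ij: "mink (u i) (u j) = - cos \<alpha>" and out: "outside i y" "outside j y" and k: "k < q"
  shows "outside (if even k then i else j) (alternate i j y k)"
proof -
  have "(real k + 1) * \<alpha> \<le> real q * \<alpha>"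
    using k alpha_bounds by (intro mult_right_mono) auto
  then have 1: "sin ((real k + 1) * \<alpha>) \<ge> 0"
    using alpha_bounds by (intro sin_ge_zero) (auto simp: q_alpha)
  have "real k * \<alpha> < real q * \<alpha>"
    using k alpha_bounds by (intro mult_strict_right_mono) auto
  then have 2: "sin (real k * \<alpha>) > 0" if "k > 0"
    using that alpha_bounds by (intro sin_gt_zero) (auto simp: q_alpha)
  have "0 < mink y (u i) * sin ((real k + 1) * \<alpha>) + mink y (u j) * sin (real k * \<alpha>)"
  proof (cases "k = 0")
    case True
    then show ?thesis using out sin_alpha by (simp add: outside_def)
  next
    case False
    then show ?thesis using out 1 2 by (intro add_nonneg_pos mult_pos_pos mult_nonneg_nonneg)
      (auto simp: outside_def)
  qed
  then have "0 < sin \<alpha> * mink (alternate i j y k) (u (if even k then i else j))"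
    unfolding mink_alternate(1)[OF ij] .
  then show ?thesis using sin_alpha unfolding outside_def by (simp only: zero_less_mult_iff) auto
qed

lemma moves_alternate:
  assumes "mink (u i) (u j) = - cos \<alpha>" "outside i y" "outside j y" "i < n" "j < n" "k + d \<le> q"
  shows "(move ^^ d) (alternate i j y k) (alternate i j y (k + d))"
  using assms(6)
proof (induction d)
  case (Suc d)
  have "move (alternate i j y (k + d)) (alternate i j y (Suc (k + d)))"
    unfolding move_def using outside_alternate[OF assms(1-3), of "k + d"] assms(4,5) Suc.prems
    by (intro exI[of _ "if even (k + d) then i else j"]) auto
  then show ?case using Suc by (auto intro: relpowp_Suc_I)
qed simp

text \<open>Termination of the reflection game is not known beforehand, so Newman's lemma does not apply; the
  equal lengths of the two sides of each local diamond replace it.\<close>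

lemma moves_unique_end:
  assumes "(move ^^ N) y z" "inside z" "y \<in> hyp_plane" "move y y'"
  shows "\<exists>M. N = Suc M \<and> (move ^^ M) y' z"
  using assms
proof (induction N arbitrary: y y' rule: less_induct)
  case (less N)
  \<comment> \<open>By the induction hypothesis at every step, any partial play from a point with a
    shorter game loses exactly its own length.\<close>
  have iter: "\<exists>M'. M = d + M' \<and> (move ^^ M') w z"
    if "M < N" "(move ^^ M) x z" "(move ^^ d) x w" "x \<in> hyp_plane" for M d x w
    using that
  proof (induction d arbitrary: M x)
    case (Suc d)
    obtain x' where x': "move x x'" "(move ^^ d) x' w" using Suc.prems(3) by (rule relpowp_Suc_E2)
    obtain M1 where M1: "M = Suc M1" "(move ^^ M1) x' z"
      using less.IH[OF Suc.prems(1,2) less.prems(2) Suc.prems(4) x'(1)] by blast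
    obtain M' where "M1 = d + M'" "(move ^^ M') w z"
      using Suc.IH[of M1 x'] M1 x' Suc.prems move_hyp_plane by auto
    then show ?case using M1 by auto
  qed auto
  show ?case
  proof (cases N)
    case 0
    then show ?thesis using less.prems not_move_inside by auto
  next
    case (Suc M)
    obtain y1 where y1: "move y y1" "(move ^^ M) y1 z"
      using less.prems(1) unfolding Suc by (rule relpowp_Suc_E2)
    obtain i where i: "i < n" "outside i y" "y1 = R i y" using y1 by (auto simp: move_def)
    obtain j where j: "j < n" "outside j y" "y' = R j y" using less.prems by (auto simp: move_def)
    show ?thesis
    proof (cases "i = j")
      case True
      then show ?thesis using i j y1 Suc by auto
    next
      case False
      have ij: "mink (u i) (u j) = - cos \<alpha>"
        using outside_both[OF i(1) j(1) False less.prems(3) i(2) j(2)] .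
      then have ji: "mink (u j) (u i) = - cos \<alpha>" by (simp add: mink_commute)
      \<comment> \<open>\<open>w\<close> closes the diamond: both first moves reach it in
        \<open>q - 1\<close> further moves, so the remaining play from \<open>w\<close> to
        \<open>z\<close> can be entered through \<open>y'\<close> without changing the
        length.\<close>
      define w where "w = alternate i j y q"
      have w': "w = alternate j i y q" unfolding w_def by (rule alternate_commute[OF ij])
      have "(move ^^ (q - 1)) y1 w"
        using moves_alternate[OF ij i(2) j(2) i(1) j(1), of 1 "q - 1"] q_ge_2
        by (simp add: w_def i(3))
      then obtain M' where M': "M = (q - 1) + M'" "(move ^^ M') w z"
        using iter[of M y1 "q - 1" w] y1 Suc less.prems(3) move_hyp_plane by blast
      have "(move ^^ (q - 1)) y' w"
        using moves_alternate[OF ji j(2) i(2) j(1) i(1), of 1 "q - 1"] q_ge_2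
        by (simp add: w' j(3))
      then have "(move ^^ M) y' z" unfolding M' using M'(2) by (rule relpowp_trans)
      then show ?thesis using Suc by blast
    qed
  qed
qed

section \<open>Group structure and uniqueness of orbit representatives\<close>

lemma Gamma_induct [consumes 1, case_names one refl]:
  assumes "g \<in> Gamma n m" "P (mat 1)"
    "\<And>i g. i < n \<Longrightarrow> g \<in> Gamma n m \<Longrightarrow> P g \<Longrightarrow> P (refl_mat n m i ** g)"
  shows "P g"
proof -
  have "P (word_prod n m ws)" if "set ws \<subseteq> {..<n}" for ws
    using that by (induction ws) (auto intro!: assms(2) assms(3) simp: Gamma_def)
  then show ?thesis using assms(1) by (auto simp: Gamma_def)
qed

lemma one_in_Gamma: "mat 1 \<in> Gamma n m"
  unfolding Gamma_def by (intro CollectI exI[of _ "[]"]) simp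

lemma refl_mult_in_Gamma: "i < n \<Longrightarrow> g \<in> Gamma n m \<Longrightarrow> refl_mat n m i ** g \<in> Gamma n m"
proof -
  assume i: "i < n" and "g \<in> Gamma n m"
  then obtain ws where ws: "set ws \<subseteq> {..<n}" "g = word_prod n m ws" by (auto simp: Gamma_def)
  have "refl_mat n m i ** g = word_prod n m (i # ws)" "set (i # ws) \<subseteq> {..<n}" using i ws by auto
  then show "refl_mat n m i ** g \<in> Gamma n m" unfolding Gamma_def by blast
qed

lemma mult_in_Gamma: "g \<in> Gamma n m \<Longrightarrow> h \<in> Gamma n m \<Longrightarrow> g ** h \<in> Gamma n m"
  by (induction g rule: Gamma_induct)
    (auto simp: refl_mult_in_Gamma matrix_mul_assoc[symmetric])

lemma inverse_in_Gamma:
  assumes "g \<in> Gamma n m"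
  shows "\<exists>h\<in>Gamma n m. h ** g = mat 1 \<and> g ** h = mat 1"
  using assms
proof (induction g rule: Gamma_induct)
  case one
  show ?case by (intro bexI[of _ "mat 1"]) (simp_all add: one_in_Gamma)
next
  case (refl i g)
  then obtain h where h: "h \<in> Gamma n m" "h ** g = mat 1" "g ** h = mat 1" by blast
  have "refl_mat n m i \<in> Gamma n m" using refl_mult_in_Gamma[OF refl(1) one_in_Gamma] by simp
  moreover have "(h ** refl_mat n m i) ** (refl_mat n m i ** g) = mat 1"
    using h by (simp add: matrix_mul_assoc[symmetric])
  moreover have "(refl_mat n m i ** g) ** (h ** refl_mat n m i) = refl_mat n m i ** ((g ** h) ** refl_mat n m i)"
    by (simp only: matrix_mul_assoc)
  then have "(refl_mat n m i ** g) ** (h ** refl_mat n m i) = mat 1"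
    using h by simp
  ultimately show ?case using h mult_in_Gamma by blast
qed

lemma Gamma_in_G: "g \<in> Gamma n m \<Longrightarrow> g \<in> G"
  using Gamma_subset_G by blast

text \<open>Induction over the word shows that \<open>g *v p\<close> can be played back to
  \<open>p\<close>: each further letter is a move, undoes a move, or fixes the point. If
  \<open>g *v p\<close> is itself inside, no move is available and the play is empty.\<close>

lemma orbit_meets_polygon_once:
  assumes g: "g \<in> Gamma n m" and p: "p \<in> hyp_plane" "inside p" and gp: "inside (g *v p)"
  shows "g *v p = p"
proof -
  have "\<exists>N. (move ^^ N) (g *v p) p"
    using g
  proof (induction g rule: Gamma_induct)
    case one
    show ?case by (intro exI[of _ 0]) simp
  next
    case (refl i g)
    then obtain N where N: "(move ^^ N) (g *v p) p" by blast
    have gp: "g *v p \<in> hyp_plane" using refl p by (intro hyp_plane_G Gamma_in_G)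
    let ?y = "R i (g *v p)"
    have eq: "(refl_mat n m i ** g) *v p = ?y" by (simp add: matrix_vector_mul_assoc[symmetric])
    consider "mink (g *v p) (u i) > 0" | "mink (g *v p) (u i) < 0" | "mink (g *v p) (u i) = 0"
      by linarith
    then show ?case
    proof cases
      case 1
      then have "move (g *v p) ?y" using refl by (auto simp: move_def outside_def)
      from moves_unique_end[OF N p(2) gp this] show ?thesis unfolding eq by blast
    next
      case 2
      have "mink ?y (u i) = - mink (g *v p) (u i)" by (simp add: refl_mat_mult[of n m i "g *v p"] mink_simps)
      then have "move ?y (R i ?y)" using refl 2 by (auto simp: move_def outside_def)
      then have "move ?y (g *v p)" by simp
      from relpowp_Suc_I2[OF this N] show ?thesis unfolding eq by (rule exI)
    next
      case 3
      then have "?y = g *v p" by (simp add: refl_mat_mult)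
      then show ?thesis unfolding eq using N by (intro exI[of _ N]) simp
    qed
  qed
  then obtain N where N: "(move ^^ N) (g *v p) p" by blast
  show ?thesis
  proof (cases N)
    case 0
    then show ?thesis using N by simp
  next
    case (Suc M)
    then obtain y where "move (g *v p) y" using relpowp_Suc_D2[of M move "g *v p" p] N by blast
    then show ?thesis using not_move_inside gp by blast
  qed
qed

section \<open>Discreteness\<close>

text \<open>This is the inscribed disc: by Cauchy-Schwarz the side condition follows from a^2 (z^2 -
  1) \<le> b^2 z^2 at height z, that is, from z \<le> a.\<close>

lemma inside_ball:
  assumes p: "p \<in> hyp_plane" and le: "p$3 \<le> a"
  shows "inside p"
  unfolding inside_def outside_def
proof (intro allI impI)
  fix i
  let ?t = "2 * pi * real i / real n"
  have p1: "p$3 \<ge> 1" by (rule hyp_plane_ge_1[OF p])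
  have "(p$1 * cos ?t + p$2 * sin ?t)\<^sup>2 \<le> ((p$1)\<^sup>2 + (p$2)\<^sup>2) * ((cos ?t)\<^sup>2 + (sin ?t)\<^sup>2)"
    by (rule cauchy_schwarz_2)
  also have "\<dots> = (p$3)\<^sup>2 - 1" using hyp_plane_sq[OF p] by simp
  finally have "a\<^sup>2 * (p$1 * cos ?t + p$2 * sin ?t)\<^sup>2 \<le> a\<^sup>2 * ((p$3)\<^sup>2 - 1)"
    by (rule mult_left_mono) simp
  also have "\<dots> = b\<^sup>2 * (p$3)\<^sup>2 + ((p$3)\<^sup>2 - a\<^sup>2)" using a_sq by (simp add: algebra_simps)
  also have "\<dots> \<le> b\<^sup>2 * (p$3)\<^sup>2" using le p1 by (simp add: power_mono)
  finally have "(a * (p$1 * cos ?t + p$2 * sin ?t))\<^sup>2 \<le> (b * p$3)\<^sup>2" by (simp only: power_mult_distrib)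
  then have "a * (p$1 * cos ?t + p$2 * sin ?t) \<le> b * p$3"
    by (rule power2_le_imp_le) (use b_pos p1 in simp)
  then show "\<not> mink p (u i) > 0" unfolding mink_u by linarith
qed

lemma D_le_a_imp_one:
  assumes g: "g \<in> Gamma n m" and D: "D g \<le> a"
  shows "g = mat 1"
proof -
  note gG = Gamma_in_G[OF g]
  have fix_o: "g *v origin = origin"
    using D g gG a_gt_1
    by (intro orbit_meets_polygon_once inside_ball hyp_plane_G) (auto simp: D_def)
  have fix_p: "g *v p = p" if p: "p \<in> hyp_plane" "p$3 \<le> a" for p
  proof -
    have "(g *v p) $ 3 = p $ 3"
      using mink_G[OF gG, of p origin] fix_o by (simp add: mink_origin)
    then show ?thesis using p g gG
      by (intro orbit_meets_polygon_once inside_ball hyp_plane_G) auto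
  qed
  \<comment> \<open>Two points on the inscribed circle which together with \<open>origin\<close>
    form a basis, so fixing the three determines the matrix.\<close>
  define p1 p2 :: "real^3" where "p1 = vector [b, 0, a]" and "p2 = vector [0, b, a]"
  have "p1 \<in> hyp_plane" "p2 \<in> hyp_plane"
    using a_sq a_gt_1 by (auto simp: p1_def p2_def hyp_plane_def mink_def power2_eq_square)
  then have p: "g *v p1 = p1" "g *v p2 = p2" by (auto intro!: fix_p simp: p1_def p2_def)
  show ?thesis
  proof (subst matrix_eq, rule allI)
    fix x :: "real^3"
    define c d e where "c = x$1 / b" and "d = x$2 / b" and "e = x$3 - a * (x$1 + x$2) / b"
    have x: "x = c *\<^sub>R p1 + d *\<^sub>R p2 + e *\<^sub>R origin"
      using b_pos by (simp add: vec_eq_iff forall_3 p1_def p2_def c_def d_def e_def field_simps)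
    show "g *v x = mat 1 *v x"
      unfolding x by (simp add: matrix_vector_right_distrib matrix_vector_mult_scaleR p fix_o)
  qed
qed

text \<open>The Euclidean square dominates the Minkowski one, which moves the separation into a
  setting where bounded, uniformly discrete sets are finite.\<close>

lemma orbit_separated:
  assumes g: "g \<in> Gamma n m" and h: "h \<in> Gamma n m" and ne: "g \<noteq> h"
  shows "2 * (a - 1) \<le> (dist (g *v origin) (h *v origin))\<^sup>2"
proof -
  define x y where "x = g *v origin" and "y = h *v origin"
  obtain g' where g': "g' \<in> Gamma n m" "g' ** g = mat 1" "g ** g' = mat 1"
    using inverse_in_Gamma[OF g] by blast
  have "g' ** h \<noteq> mat 1"
  proof
    assume "g' ** h = mat 1"
    then have "g ** (g' ** h) = g" by simp
    then show False using g' ne by (simp add: matrix_mul_assoc)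
  qed
  then have "D (g' ** h) > a" using D_le_a_imp_one[of "g' ** h"] mult_in_Gamma g' h by force
  moreover have "mink (g *v origin) (h *v origin) = mink (g' *v (g *v origin)) (g' *v (h *v origin))"
    using g' by (simp add: mink_G Gamma_in_G)
  then have "- mink (g *v origin) (h *v origin) = D (g' ** h)"
    using g' by (simp add: matrix_vector_mul_assoc mink_origin D_def)
  ultimately have xy: "- mink x y > a" by (simp add: x_def y_def)
  have "mink x x = -1" "mink y y = -1"
    using g h by (auto simp: x_def y_def intro!: hyp_plane_mink_self hyp_plane_G Gamma_in_G)
  then have "2 * (a - 1) \<le> mink (x - y) (x - y)"
    using xy by (simp add: mink_simps mink_commute[of y x])
  also have "\<dots> \<le> (dist x y)\<^sup>2"
    by (simp add: dist_norm power2_norm_eq_inner inner_vec_def sum_3 mink_def)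
  finally show ?thesis by (simp add: x_def y_def)
qed

definition orbit_ball :: "real \<Rightarrow> (real^3^3) set" where
  "orbit_ball T = {g \<in> Gamma n m. D g \<le> T}"

lemma finite_orbit_ball [simp]: "finite (orbit_ball T)"
proof -
  define X where "X = (\<lambda>g. g *v origin) ` orbit_ball T"
  define e where "e = sqrt (2 * (a - 1))"
  have e: "e > 0" using a_gt_1 by (simp add: e_def)
  have sep: "e \<le> dist (g *v origin) (h *v origin)"
    if "g \<in> Gamma n m" "h \<in> Gamma n m" "g \<noteq> h" for g h
    using orbit_separated[OF that] a_gt_1 unfolding e_def by (intro real_le_lsqrt) auto
  have inj: "inj_on (\<lambda>g. g *v origin) (orbit_ball T)"
  proof (rule inj_onI, rule ccontr)
    fix g h assume "g \<in> orbit_ball T" "h \<in> orbit_ball T" "g *v origin = h *v origin" "g \<noteq> h"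
    then show False using sep[of g h] e by (auto simp: orbit_ball_def)
  qed
  have "bounded X"
  proof (rule boundedI)
    fix x assume "x \<in> X"
    then obtain g where g: "g \<in> Gamma n m" "D g \<le> T" "x = g *v origin"
      by (auto simp: X_def orbit_ball_def)
    then have x: "x \<in> hyp_plane" "x$3 \<le> T" by (auto intro: hyp_plane_G Gamma_in_G simp: D_def)
    have "x$1 * x$1 + x$2 * x$2 = x$3 * x$3 - 1"
      using hyp_plane_sq[OF x(1)] by (simp add: power2_eq_square)
    moreover have "(norm x)\<^sup>2 = x$1 * x$1 + x$2 * x$2 + x$3 * x$3"
      by (simp add: power2_norm_eq_inner inner_vec_def sum_3)
    ultimately have "(norm x)\<^sup>2 = 2 * (x$3)\<^sup>2 - 1" by (simp add: power2_eq_square)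
    also have "\<dots> \<le> 4 * T\<^sup>2"
    proof -
      have "(x$3)\<^sup>2 \<le> T\<^sup>2" using x(2) hyp_plane_ge_1[OF x(1)] by (intro power_mono) auto
      then show ?thesis using zero_le_power2[of T] by linarith
    qed
    also have "\<dots> = (2 * T)\<^sup>2" by (simp add: power_mult_distrib)
    finally show "norm x \<le> 2 * T"
      by (rule power2_le_imp_le) (use x(2) hyp_plane_ge_1[OF x(1)] in simp)
  qed
  moreover have "uniform_discrete X"
    unfolding uniform_discrete_def
  proof (intro exI[of _ e] conjI ballI impI e)
    fix x y assume "x \<in> X" "y \<in> X" "dist x y < e"
    then show "x = y" using sep by (fastforce simp: X_def orbit_ball_def)
  qed
  ultimately have "finite X"
    using discrete_compact_finite_iff[of X] uniform_discrete_imp_closed uniform_discrete_imp_discrete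
      compact_eq_bounded_closed by blast
  then show ?thesis unfolding X_def using inj by (rule finite_imageD)
qed

end

text \<open>The cubic bound gives sin(21/40) > 1/2 = sin(pi/6). The square 3969/400 of this bound
  drives the numerical comparisons at the end.\<close>

lemma pi_less_63_20: "pi < 63 / 20"
proof (rule ccontr)
  assume "\<not> pi < 63 / 20"
  then have pi: "21 / 40 \<le> pi / 6" by simp
  have "sin (21 / 40) \<le> sin (pi / 6)"
    using pi by (intro sin_monotone_2pi_le) (auto intro: order_trans[of _ 0])
  then have "sin (21 / 40) \<le> (1 / 2 :: real)" by (simp add: sin_30)
  moreover have "(21 / 40) - (21 / 40) ^ 3 / 6 \<le> sin (21 / 40 :: real)" by (rule sin_ge_cubic) simp
  ultimately show False by (simp add: power3_eq_cube)
qed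

context hyperbolic_polygon
begin

section \<open>Orbit growth\<close>

lemma polar_coordinates:
  fixes y :: "real^3"
  assumes "y \<in> hyp_plane" "y$3 > 1"
  obtains \<theta> where "0 \<le> \<theta>" "\<theta> < 2 * pi"
    "y$1 = sqrt ((y$3)\<^sup>2 - 1) * cos \<theta>" "y$2 = sqrt ((y$3)\<^sup>2 - 1) * sin \<theta>"
proof -
  define \<rho> where "\<rho> = sqrt ((y$3)\<^sup>2 - 1)"
  have "1 < (y$3)\<^sup>2" using assms by (simp add: one_less_power)
  then have \<rho>: "\<rho> > 0" "\<rho>\<^sup>2 = (y$3)\<^sup>2 - 1" by (simp_all add: \<rho>_def)
  have "(y$1 / \<rho>)\<^sup>2 + (y$2 / \<rho>)\<^sup>2 = ((y$1)\<^sup>2 + (y$2)\<^sup>2) / \<rho>\<^sup>2"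
    by (simp add: power_divide add_divide_distrib)
  also have "\<dots> = 1" unfolding hyp_plane_sq[OF assms(1)] \<rho>(2)[symmetric] using \<rho>(1) by simp
  finally obtain t where "0 \<le> t" "t < 2 * pi" "y$1 / \<rho> = cos t" "y$2 / \<rho> = sin t"
    by (rule sincos_total_2pi)
  then show ?thesis using that[of t] \<rho>(1) unfolding \<rho>_def[symmetric] by (simp add: field_simps)
qed

lemma closest_direction:
  assumes "0 \<le> \<theta>" "\<theta> < 2 * pi"
  shows "\<exists>i<n. cos (pi / real n) \<le> cos (\<theta> - 2 * pi * real i / real n)"
proof -
  define x where "x = \<theta> * real n / (2 * pi)"
  \<comment> \<open>Rounding to the nearest side leaves an angular error of at most pi/n; the
    rounded index may be \<open>n\<close>, which stands for side 0.\<close>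
  define k where "k = nat \<lfloor>x + 1 / 2\<rfloor>"
  have x: "0 \<le> x" "x < real n" using assms n4 by (auto simp: x_def field_simps)
  have "real k = of_int \<lfloor>x + 1 / 2\<rfloor>" using x by (simp add: k_def)
  then have k: "\<bar>x - real k\<bar> \<le> 1 / 2" by linarith
  then have "real k < real n + 1" using x by linarith
  then have kn: "k \<le> n" by linarith
  have "\<theta> - 2 * pi * real k / real n = 2 * pi / real n * (x - real k)"
    using n4 by (simp add: x_def field_simps)
  then have "\<bar>\<theta> - 2 * pi * real k / real n\<bar> = 2 * pi / real n * \<bar>x - real k\<bar>"
    by (simp add: abs_mult)
  also have "\<dots> \<le> 2 * pi / real n * (1 / 2)" using k by (intro mult_left_mono) auto
  finally have abs: "\<bar>\<theta> - 2 * pi * real k / real n\<bar> \<le> pi / real n" by simp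
  have "cos (pi / real n) \<le> cos \<bar>\<theta> - 2 * pi * real k / real n\<bar>"
    using abs n4 by (intro cos_monotone_0_pi_le) (auto simp: field_simps)
  then have cosk: "cos (pi / real n) \<le> cos (\<theta> - 2 * pi * real k / real n)" by simp
  show ?thesis
  proof (cases "k = n")
    case True
    have "cos (\<theta> - 2 * pi * real k / real n) = cos (\<theta> - 2 * pi * real 0 / real n)"
      using n4 True by (simp add: cos_diff)
    then show ?thesis using cosk n4 by (intro exI[of _ 0]) auto
  qed (use kn cosk in \<open>auto intro!: exI[of _ k]\<close>)
qed

text \<open>The coefficient of a side normal in the direction of a vertex. That it exceeds
  \<open>b\<close> says that vertices are not at infinity: the difference of squares is
  sin^2(pi/m).\<close>

definition a' where "a' = a * cos (pi / real n)"

lemma b_less_a': "b < a'" "a' > 0"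
proof -
  have c: "cos (pi / real n) > 0" using n4 by (intro cos_gt_zero) (auto simp: field_simps)
  then show pos: "a' > 0" using a_gt_1 by (simp add: a'_def)
  have "sin (pi / real m) > 0" using m4 by (intro sin_gt_zero) (auto simp: field_simps)
  then have "(sin (pi / real m))\<^sup>2 > 0" by simp
  then have "(cos (pi / real m))\<^sup>2 < 1" using sin_cos_squared_add[of "pi / real m"] by linarith
  then have "(a * sin (pi / real n))\<^sup>2 < 1" unfolding a_sin .
  moreover have "a'\<^sup>2 = a\<^sup>2 - (a * sin (pi / real n))\<^sup>2"
    by (simp add: a'_def power_mult_distrib cos_squared_eq algebra_simps)
  ultimately have "b\<^sup>2 < a'\<^sup>2" using a_sq by simp
  then show "b < a'" by (rule power2_less_imp_less) (use pos in simp)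
qed

text \<open>The solution z of a'(z - 1) - b z = 1: above this height some side is violated by at
  least 1, which makes the descent in \<open>covering\<close> uniform.\<close>

definition d0 where "d0 = (1 + a') / (a' - b)"

lemma d0_gt_1: "d0 > 1"
  using b_less_a' b_pos by (simp add: d0_def field_simps)

lemma far_outside:
  assumes y: "y \<in> hyp_plane" and far: "y$3 > d0"
  shows "\<exists>i<n. mink y (u i) \<ge> 1"
proof -
  have y1: "y$3 > 1" using far d0_gt_1 by simp
  define \<rho> where "\<rho> = sqrt ((y$3)\<^sup>2 - 1)"
  obtain \<theta> where \<theta>: "0 \<le> \<theta>" "\<theta> < 2 * pi" "y$1 = \<rho> * cos \<theta>" "y$2 = \<rho> * sin \<theta>"
    using polar_coordinates[OF y y1] unfolding \<rho>_def by blast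
  obtain i where i: "i < n" "cos (pi / real n) \<le> cos (\<theta> - 2 * pi * real i / real n)"
    using closest_direction \<theta> by blast
  have "(y$3 - 1)\<^sup>2 \<le> (y$3)\<^sup>2 - 1" using y1 by (simp add: power2_diff)
  then have \<rho>: "\<rho> \<ge> y$3 - 1" unfolding \<rho>_def by (rule real_le_rsqrt)
  have "mink y (u i) = a * \<rho> * cos (\<theta> - 2 * pi * real i / real n) - b * y$3"
    by (simp add: mink_u \<theta> cos_diff algebra_simps)
  moreover have "a * \<rho> * cos (\<theta> - 2 * pi * real i / real n) \<ge> a * \<rho> * cos (pi / real n)"
    using i a_gt_1 \<rho> y1 by (intro mult_left_mono) auto
  moreover have "a * \<rho> * cos (pi / real n) = a' * \<rho>" by (simp add: a'_def)
  moreover have "a' * \<rho> \<ge> a' * (y$3 - 1)" using \<rho> b_less_a' by (intro mult_left_mono) auto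
  moreover have "(a' - b) * y$3 \<ge> 1 + a'"
    using far b_less_a' by (simp add: d0_def field_simps)
  moreover have "(a' - b) * y$3 = a' * (y$3 - 1) + a' - b * y$3" by (simp add: algebra_simps)
  ultimately have "mink y (u i) \<ge> 1" by linarith
  then show ?thesis using i by blast
qed

text \<open>Greedy descent: each reflection lowers the height by at least \<open>2 * b\<close>.
  Ending in a disc of height \<open>d0\<close> rather than in the polygon is enough for
  counting.\<close>

lemma covering:
  assumes y: "y \<in> hyp_plane"
  shows "\<exists>g\<in>Gamma n m. \<exists>w\<in>hyp_plane. w$3 \<le> d0 \<and> y = g *v w"
proof -
  have "\<exists>g\<in>Gamma n m. \<exists>w\<in>hyp_plane. w$3 \<le> d0 \<and> y = g *v w"
    if "y \<in> hyp_plane" "y$3 \<le> d0 + 2 * b * real k" for k y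
    using that
  proof (induction k arbitrary: y)
    case 0
    then show ?case by (intro bexI[of _ "mat 1"] bexI[of _ y]) (auto simp: one_in_Gamma)
  next
    case (Suc k)
    show ?case
    proof (cases "y$3 \<le> d0")
      case True
      then show ?thesis using Suc.prems
        by (intro bexI[of _ "mat 1"] bexI[of _ y]) (auto simp: one_in_Gamma)
    next
      case False
      then obtain i where i: "i < n" "mink y (u i) \<ge> 1" using far_outside Suc.prems by force
      have "R i y $ 3 = y$3 - 2 * b * mink y (u i)" by (simp add: refl_mat_mult u_components)
      also have "\<dots> \<le> y$3 - 2 * b * 1" using i b_pos by (intro diff_left_mono mult_left_mono) auto
      also have "\<dots> \<le> d0 + 2 * b * real k" using Suc.prems by (simp add: algebra_simps)
      finally obtain g w where gw: "g \<in> Gamma n m" "w \<in> hyp_plane" "w$3 \<le> d0" "R i y = g *v w"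
        using Suc.IH[of "R i y"] hyp_plane_refl Suc.prems by blast
      have "y = R i (R i y)" by simp
      also have "\<dots> = (refl_mat n m i ** g) *v w"
        unfolding gw(4) by (simp add: matrix_vector_mul_assoc)
      finally show ?thesis using gw refl_mult_in_Gamma[OF i(1) gw(1)] by blast
    qed
  qed
  moreover obtain k :: nat where "(y$3 - d0) / (2 * b) \<le> real k" using real_arch_simple by blast
  then have "y$3 \<le> d0 + 2 * b * real k" using b_pos by (simp add: field_simps)
  ultimately show ?thesis using y by blast
qed

lemma mink_near_orbit:
  assumes "g \<in> G" "w \<in> hyp_plane" "w$3 \<le> d0" "v \<in> hyp_plane"
  shows "- mink (g *v origin) v \<le> 2 * d0 * (- mink (g *v w) v)"
proof -
  have "fcone (g *v ((2 * w$3) *\<^sub>R w - origin))"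
    by (rule fcone_G[OF assms(1) fcone_lower[OF assms(2)]])
  then have "mink (g *v ((2 * w$3) *\<^sub>R w - origin)) v \<le> 0"
    by (rule fcone_mink_le_0[OF _ hyp_plane_fcone[OF assms(4)]])
  then have "- mink (g *v origin) v \<le> 2 * w$3 * (- mink (g *v w) v)"
    by (simp add: matrix_vector_mult_diff_distrib matrix_vector_mult_scaleR mink_simps)
  also have "\<dots> \<le> 2 * d0 * (- mink (g *v w) v)"
    using mink_hyp_plane_le[OF hyp_plane_G[OF assms(1,2)] assms(4)] assms(3)
    by (intro mult_right_mono) auto
  finally show ?thesis .
qed

text \<open>\<open>p\<close> is the point at height \<open>T1\<close> on the geodesic from
  \<open>origin\<close> to \<open>y\<close>. The hyperbolic cosine of the remaining distance is
  \<open>T1 * z - r1 * r\<close>, bounded by multiplying with the conjugate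
  \<open>Y\<close>.\<close>

lemma intermediate_point:
  assumes y: "y \<in> hyp_plane" and T: "1 \<le> T1" "1 \<le> T2" "y$3 \<le> T1 * T2"
  shows "\<exists>p\<in>hyp_plane. p$3 \<le> T1 \<and> - mink p y \<le> 2 * T2"
proof (cases "y$3 \<le> T1")
  case True
  then show ?thesis using hyp_plane_mink_self[OF y] y T by (intro bexI[of _ y]) auto
next
  case False
  define z where "z = y$3"
  define r1 r where "r1 = sqrt (T1\<^sup>2 - 1)" and "r = sqrt (z\<^sup>2 - 1)"
  have z: "T1 < z" "1 < z" using False T by (auto simp: z_def)
  have "1 \<le> T1\<^sup>2" "1 < z\<^sup>2" using T z by (auto simp: one_less_power)
  then have r: "r1 \<ge> 0" "r > 0" "r1 * r1 = T1\<^sup>2 - 1" "r * r = z\<^sup>2 - 1"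
    by (simp_all add: r1_def r_def)
  have ysq: "y$1 * y$1 + y$2 * y$2 = r * r"
    using hyp_plane_sq[OF y] r(4) by (simp add: z_def power2_eq_square)
  define p :: "real^3" where "p = vector [r1 / r * y$1, r1 / r * y$2, T1]"
  have "mink p p = (r1 / r) * (r1 / r) * (y$1 * y$1 + y$2 * y$2) - T1\<^sup>2"
    by (simp only: p_def mink_def vector_3 power2_eq_square) (simp add: algebra_simps)
  also have "\<dots> = r1 * r1 - T1\<^sup>2" unfolding ysq using r(2) by simp
  finally have p: "p \<in> hyp_plane" using T r(3) by (simp add: hyp_plane_def p_def)
  have "- mink p y = T1 * z - r1 / r * (y$1 * y$1 + y$2 * y$2)"
    by (simp only: p_def mink_def vector_3 z_def) (simp add: algebra_simps)
  also have "\<dots> = T1 * z - r1 * r" unfolding ysq using r(2) by simp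
  finally have eq: "- mink p y = T1 * z - r1 * r" .
  define Y where "Y = T1 * z + r1 * r"
  have Y: "T1 * z \<le> Y" "0 < T1 * z" using r z T by (auto simp: Y_def)
  have "(T1 * z - r1 * r) * Y = T1\<^sup>2 * z\<^sup>2 - (r1 * r1) * (r * r)"
    by (simp add: Y_def power2_eq_square algebra_simps)
  also have "\<dots> = T1\<^sup>2 + z\<^sup>2 - 1" unfolding r by (simp add: algebra_simps)
  also have "T1\<^sup>2 \<le> z\<^sup>2" using z T by (intro power_mono) auto
  also have "z\<^sup>2 + z\<^sup>2 - 1 \<le> 2 * (z * z)" by (simp add: power2_eq_square)
  also have "z * z \<le> (T1 * T2) * z" using T(3) z by (intro mult_right_mono) (auto simp: z_def)
  also have "2 * ((T1 * T2) * z) = (2 * T2) * (T1 * z)" by simp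
  also have "\<dots> \<le> (2 * T2) * Y" using Y T by (intro mult_left_mono) auto
  finally have "T1 * z - r1 * r \<le> 2 * T2" using Y by (simp add: mult_le_cancel_right)
  then show ?thesis using p eq by (intro bexI[of _ p]) (auto simp: p_def)
qed

text \<open>A factor \<open>2 * d0\<close> for replacing a point by a nearby orbit point, and 2 from
  \<open>intermediate_point\<close>.\<close>

definition \<kappa> where "\<kappa> = 4 * d0"

lemma kappa_gt_1: "\<kappa> > 1" using d0_gt_1 by (simp add: \<kappa>_def)

text \<open>Cut the geodesic from \<open>origin\<close> to its image under \<open>g\<close>, and let
  \<open>h\<close> carry \<open>origin\<close> close to the cut.\<close>

lemma orbit_ball_factor:
  assumes T: "1 \<le> T1" "1 \<le> T2" and g: "g \<in> orbit_ball (T1 * T2)"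
  shows "\<exists>h\<in>orbit_ball (\<kappa> * T1). \<exists>k\<in>orbit_ball (\<kappa> * T2). g = h ** k"
proof -
  have gG: "g \<in> Gamma n m" "g *v origin \<in> hyp_plane" "(g *v origin) $ 3 \<le> T1 * T2"
    using g by (auto simp: orbit_ball_def D_def intro: hyp_plane_G Gamma_in_G)
  obtain p where p: "p \<in> hyp_plane" "p$3 \<le> T1" "- mink p (g *v origin) \<le> 2 * T2"
    using intermediate_point[OF gG(2) T gG(3)] by blast
  obtain h w where hw: "h \<in> Gamma n m" "w \<in> hyp_plane" "w$3 \<le> d0" "p = h *v w"
    using covering[OF p(1)] by blast
  obtain h' where h': "h' \<in> Gamma n m" "h' ** h = mat 1" "h ** h' = mat 1"
    using inverse_in_Gamma[OF hw(1)] by blast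
  note near = mink_near_orbit[OF Gamma_in_G[OF hw(1)] hw(2,3)]
  have "D h \<le> 2 * d0 * p$3"
    using near[of origin] by (simp add: mink_origin D_def hw(4))
  also have "\<dots> \<le> \<kappa> * T1"
  proof -
    have "d0 * p$3 \<le> d0 * T1" "0 \<le> d0 * T1" using p d0_gt_1 T by (auto intro: mult_left_mono)
    then show ?thesis by (simp add: \<kappa>_def algebra_simps)
  qed
  finally have h: "h \<in> orbit_ball (\<kappa> * T1)" using hw by (simp add: orbit_ball_def)
  have "D (h' ** g) = - mink (h' *v (h *v origin)) (h' *v (g *v origin))"
    using h' by (simp add: matrix_vector_mul_assoc D_def mink_origin)
  also have "\<dots> = - mink (h *v origin) (g *v origin)" using h' by (simp add: mink_G Gamma_in_G)
  also have "\<dots> \<le> 2 * d0 * (- mink p (g *v origin))" using near[OF gG(2)] hw(4) by simp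
  also have "\<dots> \<le> 2 * d0 * (2 * T2)" using p d0_gt_1 by (intro mult_left_mono) auto
  finally have "h' ** g \<in> orbit_ball (\<kappa> * T2)"
    using h' gG mult_in_Gamma by (simp add: orbit_ball_def \<kappa>_def)
  moreover have "h ** (h' ** g) = (h ** h') ** g" by (simp only: matrix_mul_assoc)
  then have "g = h ** (h' ** g)" using h' by simp
  ultimately show ?thesis using h by blast
qed

lemma card_orbit_ball_mult_le:
  assumes "1 \<le> T1" "1 \<le> T2"
  shows "card (orbit_ball (T1 * T2)) \<le> card (orbit_ball (\<kappa> * T1)) * card (orbit_ball (\<kappa> * T2))"
proof -
  have "orbit_ball (T1 * T2) \<subseteq> (\<lambda>(h, k). h ** k) ` (orbit_ball (\<kappa> * T1) \<times> orbit_ball (\<kappa> * T2))"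
    using orbit_ball_factor[OF assms] by fast
  then have "card (orbit_ball (T1 * T2)) \<le> card (orbit_ball (\<kappa> * T1) \<times> orbit_ball (\<kappa> * T2))"
    by (intro surj_card_le) auto
  then show ?thesis by (simp add: card_cartesian_product)
qed

lemma card_orbit_ball_pos:
  assumes "T \<ge> 1"
  shows "card (orbit_ball T) \<ge> 1"
proof -
  have "mat 1 \<in> orbit_ball T" using assms by (simp add: orbit_ball_def one_in_Gamma D_def)
  then show ?thesis by (metis One_nat_def Suc_leI card_gt_0_iff empty_iff finite_orbit_ball)
qed

text \<open>Points equidistributed on a hyperbolic circle of height \<open>T\<close> are so far apart, as long as there
  are at most \<open>T / (2 * d0)\<close> of them, that no orbit point is close to two of them.\<close>

lemma card_orbit_ball_ge:
  assumes T: "T \<ge> 4 * d0"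
  shows "card (orbit_ball (2 * d0 * T)) \<ge> nat \<lfloor>T / (2 * d0)\<rfloor>"
proof -
  define N where "N = nat \<lfloor>T / (2 * d0)\<rfloor>"
  define r where "r = sqrt (T\<^sup>2 - 1)"
  have T4: "T > 4" using T d0_gt_1 by simp
  have Tpos: "T / (2 * d0) \<ge> 2" using T d0_gt_1 by (simp add: field_simps)
  then have N2: "N \<ge> 2" unfolding N_def by linarith
  have NT: "real N * (2 * d0) \<le> T"
  proof -
    have "real N \<le> T / (2 * d0)" using Tpos unfolding N_def by linarith
    then show ?thesis using d0_gt_1 by (simp add: field_simps)
  qed
  have "T\<^sup>2 \<ge> 4\<^sup>2" using T4 by (intro power_mono) auto
  then have r: "r * r = T\<^sup>2 - 1" "r * r \<ge> T\<^sup>2 / 2" by (simp_all add: r_def)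
  define y :: "nat \<Rightarrow> real^3" where
    "y j = vector [r * cos (2 * pi * real j / real N), r * sin (2 * pi * real j / real N), T]" for j
  have y: "y j \<in> hyp_plane" for j
  proof -
    define t where "t = 2 * pi * real j / real N"
    have "mink (y j) (y j) = r * r * ((sin t)\<^sup>2 + (cos t)\<^sup>2) - T\<^sup>2"
      unfolding y_def t_def[symmetric] mink_def vector_3 power2_eq_square by algebra
    then show ?thesis using r T4 by (simp add: hyp_plane_def) (simp add: y_def)
  qed
  \<comment> \<open>\<open>2 * d0\<^sup>2\<close> bounds the product of two points in one translate
    of the disc, so the chosen group elements are distinct.\<close>
  have far: "- mink (y j) (y k) > 2 * d0\<^sup>2" if "j < k" "k < N" for j k
  proof -
    define s t where "s = 2 * pi * real k / real N" and "t = 2 * pi * real j / real N"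
    define d where "d = k - j"
    have d: "1 \<le> d" "d + 1 \<le> N" "real k - real j = real d" using that by (auto simp: d_def of_nat_diff)
    have "- mink (y j) (y k) = T\<^sup>2 - r * r * (cos s * cos t + sin s * sin t)"
      unfolding y_def t_def[symmetric] s_def[symmetric] mink_def vector_3 power2_eq_square by algebra
    also have "cos s * cos t + sin s * sin t = cos (s - t)" by (simp add: cos_diff)
    also have "s - t = 2 * (pi * real d / real N)"
      unfolding d(3)[symmetric] by (simp add: s_def t_def diff_divide_distrib algebra_simps)
    also have "cos (2 * (pi * real d / real N)) = 1 - 2 * (sin (pi * real d / real N))\<^sup>2"
      by (rule cos_double_sin)
    also have "T\<^sup>2 - r * r * (1 - 2 * (sin (pi * real d / real N))\<^sup>2)
        = 1 + 2 * (r * r) * (sin (pi * real d / real N))\<^sup>2"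
      unfolding r(1) by (simp add: algebra_simps)
    finally have eq: "- mink (y j) (y k) = 1 + 2 * (r * r) * (sin (pi * real d / real N))\<^sup>2" .
    define x where "x = pi / real N"
    have "pi / real N \<le> pi / 2" using N2 by (intro divide_left_mono) auto
    moreover have "1 / real N \<le> pi / 2 / real N"
      using pi_ge_two by (intro divide_right_mono) auto
    ultimately have x: "0 < x" "x \<le> 2" "1 / real N \<le> x / 2"
      using N2 pi_less_4 unfolding x_def by (simp, linarith, simp)
    \<comment> \<open>This turns the cubic bound into sin x \<ge> x/2, and x/2 is at least
      1/N.\<close>
    have "x ^ 3 \<le> 3 * x"
    proof -
      have "x \<le> 8 / 5"
        using \<open>pi / real N \<le> pi / 2\<close> pi_less_63_20 unfolding x_def by linarith
      then have "x * x \<le> 8 / 5 * (8 / 5)" using x by (intro mult_mono) auto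
      then have "x * x * x \<le> 3 * x" using x by (intro mult_right_mono) auto
      then show ?thesis by (simp add: power3_eq_cube)
    qed
    then have "1 / real N \<le> sin x" using sin_ge_cubic[of x] x by linarith
    also have "sin x \<le> sin (pi * real d / real N)"
      using sin_pi_fraction_mono[of 1 d N] d by (simp add: x_def)
    finally have "(1 / real N)\<^sup>2 \<le> (sin (pi * real d / real N))\<^sup>2"
      by (rule power_mono) simp
    then have "2 * (T\<^sup>2 / 2) * (1 / real N)\<^sup>2 \<le> 2 * (r * r) * (sin (pi * real d / real N))\<^sup>2"
      using r(2) by (intro mult_mono) auto
    moreover have "2 * (T\<^sup>2 / 2) * (1 / real N)\<^sup>2 = (T / real N)\<^sup>2" by (simp add: power_divide)
    moreover have "(2 * d0)\<^sup>2 \<le> (T / real N)\<^sup>2"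
      using NT N2 d0_gt_1 by (intro power_mono) (auto simp: field_simps)
    ultimately show ?thesis using eq by (simp add: power_mult_distrib) (smt (verit) zero_le_power2)
  qed
  have "\<exists>g. g \<in> Gamma n m \<and> (\<exists>w\<in>hyp_plane. w$3 \<le> d0 \<and> y j = g *v w)" for j
    using covering[OF y[of j]] by blast
  then obtain g where "\<forall>j. g j \<in> Gamma n m \<and> (\<exists>w\<in>hyp_plane. w$3 \<le> d0 \<and> y j = g j *v w)"
    by metis
  then obtain w where gw: "g j \<in> Gamma n m" "w j \<in> hyp_plane" "w j $ 3 \<le> d0" "y j = g j *v w j" for j
    by metis
  have inj: "inj_on g {..<N}"
  proof (rule linorder_inj_onI)
    fix j k assume jk: "j < k" "j \<in> {..<N}" "k \<in> {..<N}"
    show "g j \<noteq> g k"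
    proof
      assume eq: "g j = g k"
      have "- mink (y j) (y k) = - mink (w j) (w k)"
        using gw(4)[of j] gw(4)[of k] gw(1)[of j] by (simp add: eq mink_G Gamma_in_G)
      also have "\<dots> \<le> 2 * w j $ 3 * w k $ 3" using gw by (intro mink_hyp_plane_ge)
      also have "\<dots> \<le> 2 * d0 * d0"
        using gw(3) d0_gt_1 hyp_plane_ge_1[OF gw(2)] by (intro mult_mono) (auto intro: order_trans[of 0 1])
      finally show False using far[of j k] jk by (simp add: power2_eq_square)
    qed
  qed auto
  have "g j \<in> orbit_ball (2 * d0 * T)" for j
  proof -
    have "D (g j) \<le> 2 * d0 * y j $ 3"
      using mink_near_orbit[OF Gamma_in_G[OF gw(1)] gw(2,3) origin_in_hyp_plane, of j] gw(4)[of j]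
      by (simp add: mink_origin D_def)
    then show ?thesis using gw(1) by (simp add: orbit_ball_def y_def)
  qed
  then have "card (g ` {..<N}) \<le> card (orbit_ball (2 * d0 * T))" by (intro card_mono) auto
  then show ?thesis using card_image[OF inj] by (simp add: N_def)
qed

text \<open>The factor \<open>\<kappa>\<^sup>2\<close> absorbs the enlargement of both balls in
  \<open>card_orbit_ball_mult_le\<close>, making the sequence exactly subadditive.\<close>

definition log_growth :: "nat \<Rightarrow> real" where
  "log_growth k = ln (real (card (orbit_ball (\<kappa>\<^sup>2 * exp (real k)))))"

lemma kappa_exp_ge_1: "1 \<le> \<kappa> * exp (real k)" "1 \<le> \<kappa>\<^sup>2 * exp (real k)"
proof -
  have "1 * 1 \<le> \<kappa> * exp (real k)" using kappa_gt_1 by (intro mult_mono) auto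
  then show *: "1 \<le> \<kappa> * exp (real k)" by simp
  have "1 * 1 \<le> \<kappa> * (\<kappa> * exp (real k))" using kappa_gt_1 * by (intro mult_mono) auto
  then show "1 \<le> \<kappa>\<^sup>2 * exp (real k)" by (simp add: power2_eq_square mult_ac)
qed

lemma log_growth_nonneg: "log_growth k \<ge> 0"
  unfolding log_growth_def using card_orbit_ball_pos[OF kappa_exp_ge_1(2)[of k]] by simp

lemma log_growth_subadditive: "log_growth (j + k) \<le> log_growth j + log_growth k"
proof -
  let ?N = "\<lambda>k. card (orbit_ball (\<kappa>\<^sup>2 * exp (real k)))"
  have pos: "?N k > 0" for k
    using card_orbit_ball_pos[OF kappa_exp_ge_1(2)[of k]] by linarith
  have "?N (j + k) = card (orbit_ball ((\<kappa> * exp (real j)) * (\<kappa> * exp (real k))))"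
    by (simp add: power2_eq_square exp_add mult_ac)
  also have "\<dots> \<le> card (orbit_ball (\<kappa> * (\<kappa> * exp (real j)))) * card (orbit_ball (\<kappa> * (\<kappa> * exp (real k))))"
    by (intro card_orbit_ball_mult_le kappa_exp_ge_1)
  also have "\<dots> = ?N j * ?N k" by (simp add: power2_eq_square mult_ac)
  finally have "real (?N (j + k)) \<le> real (?N j * ?N k)" by (simp only: of_nat_le_iff)
  then have "ln (real (?N (j + k)))
      \<le> ln (real (?N j * ?N k))"
    using pos[of "j + k"] by (rule ln_mono[OF _ iffD2[OF of_nat_0_less_iff]])
  also have "\<dots> = ln (real (?N j)) + ln (real (?N k))"
    unfolding of_nat_mult using pos[of j] pos[of k] by (intro ln_mult_pos) (simp_all only: of_nat_0_less_iff)
  finally show ?thesis by (simp only: log_growth_def)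
qed

lemma log_growth_ge: "\<exists>c. \<forall>\<^sub>F k in sequentially. real k - c \<le> log_growth k"
proof -
  define c where "c = ln (4 * d0)"
  have "\<forall>\<^sub>F k in sequentially. exp (real k) \<ge> 4 * d0" by real_asymp
  then have "\<forall>\<^sub>F k in sequentially. real k - c \<le> log_growth k"
  proof eventually_elim
    case (elim k)
    let ?T = "exp (real k)"
    have kap: "2 * d0 * ?T \<le> \<kappa>\<^sup>2 * ?T"
    proof -
      have "1 * (2 * d0) \<le> \<kappa> * \<kappa>" using kappa_gt_1 d0_gt_1 by (intro mult_mono) (auto simp: \<kappa>_def)
      then show ?thesis by (intro mult_right_mono) (auto simp: power2_eq_square)
    qed
    have "?T / (2 * d0) \<ge> 2" using elim d0_gt_1 by (simp add: field_simps)
    then have "?T / (4 * d0) \<le> real (nat \<lfloor>?T / (2 * d0)\<rfloor>)" by simp linarith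
    also have "\<dots> \<le> real (card (orbit_ball (2 * d0 * ?T)))"
      using card_orbit_ball_ge[OF elim] by (simp only: of_nat_le_iff)
    also have "\<dots> \<le> real (card (orbit_ball (\<kappa>\<^sup>2 * ?T)))"
      by (intro of_nat_mono card_mono finite_orbit_ball)
        (auto simp: orbit_ball_def intro: order_trans[OF _ kap])
    finally have le: "?T / (4 * d0) \<le> real (card (orbit_ball (\<kappa>\<^sup>2 * ?T)))" .
    have "real k - c = ln (?T / (4 * d0))" using d0_gt_1 by (simp add: c_def ln_div)
    also have "\<dots> \<le> log_growth k"
      unfolding log_growth_def using le d0_gt_1 by (intro ln_mono) auto
    finally show ?case .
  qed
  then show ?thesis by blast
qed

lemma ball_card_sandwich:
  assumes x0: "x0 \<in> hyp_plane"
  shows "\<exists>c. \<forall>k\<ge>c. log_growth (k - c) \<le> ln (real (ball_card n m x0 k))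
    \<and> ln (real (ball_card n m x0 k)) \<le> log_growth (k + c)"
proof -
  define K where "K = ln (8 * (x0$3)\<^sup>2)"
  define L where "L = ln (\<kappa>\<^sup>2)"
  have L: "L \<ge> 0" using kappa_gt_1 by (simp add: L_def one_le_power)
  obtain c :: nat where c: "K + L \<le> real c" using real_arch_simple by blast
  have dist: "\<bar>gdist n m x0 g - ln (D g)\<bar> \<le> K" if "g \<in> Gamma n m" for g
    unfolding K_def by (rule gdist_D[OF Gamma_in_G[OF that] x0])
  have D_iff: "D g \<le> \<kappa>\<^sup>2 * exp t \<longleftrightarrow> ln (D g) \<le> L + t" if "g \<in> Gamma n m" for g t
  proof -
    have "D g > 0" using D_ge_1[OF Gamma_in_G[OF that]] by linarith
    moreover have "\<kappa>\<^sup>2 > 0" using kappa_gt_1 by simp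
    moreover have "L + t = ln (\<kappa>\<^sup>2 * exp t)" using kappa_gt_1 by (simp add: L_def ln_mult)
    ultimately show ?thesis by simp
  qed
  have K: "K \<ge> 0"
    using dist[OF one_in_Gamma] by linarith
  show ?thesis
  proof (intro exI[of _ c] allI impI conjI)
    fix k assume k: "k \<ge> c"
    define B where "B = {g \<in> Gamma n m. gdist n m x0 g \<le> real k}"
    have up: "B \<subseteq> orbit_ball (\<kappa>\<^sup>2 * exp (real (k + c)))"
    proof
      fix g assume g: "g \<in> B"
      then have "ln (D g) \<le> L + real (k + c)" using dist[of g] c L by (auto simp: B_def)
      then show "g \<in> orbit_ball (\<kappa>\<^sup>2 * exp (real (k + c)))"
        using D_iff[of g] g by (auto simp: B_def orbit_ball_def)
    qed
    have low: "orbit_ball (\<kappa>\<^sup>2 * exp (real (k - c))) \<subseteq> B"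
    proof
      fix g assume g: "g \<in> orbit_ball (\<kappa>\<^sup>2 * exp (real (k - c)))"
      then have "ln (D g) \<le> L + (real k - real c)"
        using D_iff[of g "real (k - c)"] k by (auto simp: orbit_ball_def of_nat_diff)
      then show "g \<in> B" using dist[of g] g c by (auto simp: B_def orbit_ball_def)
    qed
    have finB: "finite B" using up finite_subset finite_orbit_ball by blast
    have 1: "card (orbit_ball (\<kappa>\<^sup>2 * exp (real (k - c)))) \<le> card B" by (rule card_mono[OF finB low])
    have 2: "card B \<le> card (orbit_ball (\<kappa>\<^sup>2 * exp (real (k + c))))" by (rule card_mono[OF _ up]) simp
    have 3: "0 < card (orbit_ball (\<kappa>\<^sup>2 * exp (real (k - c))))"
      using card_orbit_ball_pos[OF kappa_exp_ge_1(2)[of "k - c"]] by linarith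
    show "log_growth (k - c) \<le> ln (real (ball_card n m x0 k))"
      unfolding log_growth_def ball_card_def B_def[symmetric] using 1 3 by (intro ln_mono) auto
    show "ln (real (ball_card n m x0 k)) \<le> log_growth (k + c)"
      unfolding log_growth_def ball_card_def B_def[symmetric] using 1 2 3 by (intro ln_mono) linarith+
  qed
qed

lemma volume_limit:
  assumes x0: "x0 \<in> hyp_plane"
  shows "\<exists>v. (\<lambda>k. ln (real (ball_card n m x0 k)) / real k) \<longlonglongrightarrow> v \<and> v \<ge> 1"
proof -
  obtain v where v: "(\<lambda>k. log_growth k / real k) \<longlonglongrightarrow> v"
    using subadditive_convergent[of log_growth] log_growth_subadditive log_growth_nonneg by blast
  obtain c0 where c0: "\<forall>\<^sub>F k in sequentially. real k - c0 \<le> log_growth k"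
    using log_growth_ge by blast
  have "v \<ge> 1"
  proof (rule tendsto_le[OF trivial_limit_sequentially v])
    show "(\<lambda>k. (real k - c0) / real k) \<longlonglongrightarrow> 1" by real_asymp
    show "\<forall>\<^sub>F k in sequentially. (real k - c0) / real k \<le> log_growth k / real k"
      using c0 by eventually_elim (rule divide_right_mono, auto)
  qed
  obtain c where c: "\<And>k. k \<ge> c \<Longrightarrow> log_growth (k - c) \<le> ln (real (ball_card n m x0 k))
    \<and> ln (real (ball_card n m x0 k)) \<le> log_growth (k + c)"
    using ball_card_sandwich[OF x0] by blast
  \<comment> \<open>Shifting the index by \<open>c\<close> removes the truncated subtraction in the
    lower bound.\<close>
  have "(\<lambda>k. ln (real (ball_card n m x0 (k + c))) / real (k + c)) \<longlonglongrightarrow> v"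
  proof (rule tendsto_sandwich)
    have lim: "(\<lambda>k. log_growth k / real k * (real k / real (k + c))) \<longlonglongrightarrow> v * 1"
      by (intro tendsto_mult v) real_asymp
    have ev: "\<forall>\<^sub>F k in sequentially.
        log_growth k / real k * (real k / real (k + c)) = log_growth k / real (k + c)"
      using eventually_gt_at_top[of 0] by eventually_elim simp
    from Lim_transform_eventually[OF lim ev] show "(\<lambda>k. log_growth k / real (k + c)) \<longlonglongrightarrow> v"
      by simp
    have lim: "(\<lambda>k. log_growth (k + 2 * c) / real (k + 2 * c) * (real (k + 2 * c) / real (k + c))) \<longlonglongrightarrow> v * 1"
      by (intro tendsto_mult LIMSEQ_ignore_initial_segment[OF v]) real_asymp
    have ev: "\<forall>\<^sub>F k in sequentially.
        log_growth (k + 2 * c) / real (k + 2 * c) * (real (k + 2 * c) / real (k + c))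
        = log_growth (k + 2 * c) / real (k + c)"
      using eventually_gt_at_top[of 0] by eventually_elim simp
    from Lim_transform_eventually[OF lim ev] show "(\<lambda>k. log_growth (k + 2 * c) / real (k + c)) \<longlonglongrightarrow> v"
      by simp
    show "\<forall>\<^sub>F k in sequentially.
        log_growth k / real (k + c) \<le> ln (real (ball_card n m x0 (k + c))) / real (k + c)"
    proof (intro always_eventually allI divide_right_mono)
      show "log_growth k \<le> ln (real (ball_card n m x0 (k + c)))" for k using c[of "k + c"] by simp
    qed simp
    show "\<forall>\<^sub>F k in sequentially.
        ln (real (ball_card n m x0 (k + c))) / real (k + c) \<le> log_growth (k + 2 * c) / real (k + c)"
      using c[of "_ + c"] by (intro always_eventually allI divide_right_mono) (auto simp: mult_2 add.assoc)
  qed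
  then have "(\<lambda>k. ln (real (ball_card n m x0 k)) / real k) \<longlonglongrightarrow> v" by (rule LIMSEQ_offset)
  then show ?thesis using \<open>v \<ge> 1\<close> by blast
qed

end

section \<open>A product over the vertices of a regular polygon\<close>

lemma prod_roots_of_unity:
  assumes n: "n > 0"
  shows "(\<Prod>k<n. x - cis (2 * pi * real k / real n)) = x ^ n - 1"
proof -
  define w where "w = (\<lambda>k. cis (2 * pi * real k / real n))"
  define P where "P = (\<Prod>k<n. [:- w k, 1:])"
  define Q where "Q = monom 1 n + [:- 1 :: complex:]"
  have bij: "bij_betw w {..<n} {z. z ^ n = 1}" unfolding w_def by (rule Complex.bij_betw_roots_unity[OF n])
  have deg: "degree P = n" unfolding P_def by (simp add: degree_prod_eq_sum_degree)
  moreover have "lead_coeff P = 1" unfolding P_def lead_coeff_prod by simp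
  then have "coeff P n = 1" unfolding deg .
  moreover have "degree Q = n"
    using n unfolding Q_def by (subst degree_add_eq_left) (simp_all add: degree_monom_eq)
  moreover have "coeff Q n = 1" using n by (simp add: Q_def coeff_eq_0)
  moreover have "poly P z = poly Q z" if "z \<in> {z. z ^ n = 1}" for z
  proof -
    have "z \<in> w ` {..<n}" using that bij by (simp add: bij_betw_def)
    then obtain k where "k < n" "z = w k" by blast
    then show ?thesis using that by (auto simp: P_def Q_def poly_prod poly_monom)
  qed
  ultimately have "P = Q"
    using card_roots_unity_eq[OF n]
    by (intro poly_eqI_degree_lead_coeff[of _ n _ "{z. z ^ n = 1}"]) auto
  then have "poly P x = poly Q x" by simp
  then show ?thesis by (simp add: P_def Q_def w_def poly_prod poly_monom)
qed

text \<open>Factor k is the squared modulus of a e^(i\<theta>) - b w_k with w_k running through the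
  n-th roots of unity, so the product is the squared modulus of (a e^(i\<theta>))^n - b^n. The worst
  case is alignment.\<close>

lemma prod_regular_polygon_ge:
  fixes a b \<theta> :: real
  assumes n: "n > 0" and b: "0 < b" "b \<le> a"
  shows "(a ^ n - b ^ n)\<^sup>2 \<le> (\<Prod>k<n. a\<^sup>2 + b\<^sup>2 - 2 * a * b * cos (\<theta> - 2 * pi * real k / real n))"
proof -
  define w where "w = (\<lambda>k. cis (2 * pi * real k / real n))"
  define x where "x = complex_of_real (a / b) * cis \<theta>"
  have factor: "a\<^sup>2 + b\<^sup>2 - 2 * a * b * cos (\<theta> - 2 * pi * real k / real n) = (b * norm (x - w k))\<^sup>2" for k
  proof -
    let ?t = "2 * pi * real k / real n"
    have expand: "(c * p - r)\<^sup>2 + (c * q - s)\<^sup>2 = c\<^sup>2 * (q\<^sup>2 + p\<^sup>2) + (s\<^sup>2 + r\<^sup>2) - 2 * c * (p * r + q * s)"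
      for c p q r s :: real by algebra
    have "(norm (x - w k))\<^sup>2 = (a / b * cos \<theta> - cos ?t)\<^sup>2 + (a / b * sin \<theta> - sin ?t)\<^sup>2"
      by (simp add: cmod_power2 x_def w_def)
    also have "\<dots> = (a / b)\<^sup>2 * ((sin \<theta>)\<^sup>2 + (cos \<theta>)\<^sup>2) + ((sin ?t)\<^sup>2 + (cos ?t)\<^sup>2)
        - 2 * (a / b) * (cos \<theta> * cos ?t + sin \<theta> * sin ?t)"
      by (rule expand)
    also have "\<dots> = (a / b)\<^sup>2 + 1 - 2 * (a / b) * cos (\<theta> - ?t)"
      by (simp only: cos_diff sin_cos_squared_add mult_1_right)
    finally have "(b * norm (x - w k))\<^sup>2 = b\<^sup>2 * ((a / b)\<^sup>2 + 1 - 2 * (a / b) * cos (\<theta> - ?t))"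
      by (simp add: power_mult_distrib)
    also have "\<dots> = a\<^sup>2 + b\<^sup>2 - 2 * a * b * cos (\<theta> - ?t)"
      using b by (simp add: power2_eq_square field_simps)
    finally show ?thesis by simp
  qed
  have "(\<Prod>k<n. b * norm (x - w k)) = b ^ n * norm (\<Prod>k<n. x - w k)"
    by (simp add: prod.distrib prod_norm)
  also have "(\<Prod>k<n. x - w k) = x ^ n - 1"
    unfolding w_def by (rule prod_roots_of_unity[OF n])
  finally have prod: "(\<Prod>k<n. b * norm (x - w k)) = b ^ n * norm (x ^ n - 1)" .
  have "norm (x ^ n) - norm (1 :: complex) \<le> norm (x ^ n - 1)" by (rule norm_triangle_ineq2)
  moreover have "norm x = a / b" using b by (simp add: x_def norm_mult norm_divide)
  ultimately have "(a / b) ^ n - 1 \<le> norm (x ^ n - 1)" by (simp only: norm_power norm_one)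
  then have "b ^ n * ((a / b) ^ n - 1) \<le> b ^ n * norm (x ^ n - 1)"
    using b by (intro mult_left_mono) auto
  moreover have "b ^ n * ((a / b) ^ n - 1) = a ^ n - b ^ n"
    using b by (simp add: power_divide right_diff_distrib)
  ultimately have "(a ^ n - b ^ n)\<^sup>2 \<le> (\<Prod>k<n. b * norm (x - w k))\<^sup>2"
    unfolding prod using b by (intro power_mono) (auto simp: power_mono)
  then show ?thesis by (simp only: factor prod_power_distrib)
qed

section \<open>Drift\<close>

context hyperbolic_polygon
begin

definition mean_log_D :: "nat \<Rightarrow> real" where
  "mean_log_D k = (\<Sum>ws\<in>words n k. ln (D (word_prod n m ws))) / real n ^ k"

lemma n_pos: "n > 0" using n4 by simp

lemma mean_log_D_nonneg: "mean_log_D k \<ge> 0"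
  unfolding mean_log_D_def by (intro divide_nonneg_nonneg sum_nonneg) (auto simp: D_ge_1)

lemma mean_log_D_add: "mean_log_D (j + k) \<le> mean_log_D j + mean_log_D k + ln 2"
proof -
  let ?d = "\<lambda>ws. ln (D (word_prod n m ws))"
  have "mean_log_D (j + k) = (\<Sum>u\<in>words n j. \<Sum>w\<in>words n k. ?d (u @ w)) / real n ^ (j + k)"
    by (simp add: mean_log_D_def sum_words_add)
  also have "\<dots> \<le> (\<Sum>u\<in>words n j. \<Sum>w\<in>words n k. ?d u + (?d w + ln 2)) / real n ^ (j + k)"
  proof (intro divide_right_mono sum_mono)
    fix u w
    note pos = D_ge_1[OF word_prod_in_G, of u] D_ge_1[OF word_prod_in_G, of w]
      D_ge_1[OF word_prod_in_G, of "u @ w"]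
    have "D (word_prod n m (u @ w)) \<le> 2 * D (word_prod n m u) * D (word_prod n m w)"
      by (simp add: word_prod_append D_mult_le)
    then have "?d (u @ w) \<le> ln (2 * D (word_prod n m u) * D (word_prod n m w))"
      using pos by (intro ln_mono) auto
    also have "\<dots> = ?d u + (?d w + ln 2)" using pos by (simp add: ln_mult)
    finally show "?d (u @ w) \<le> ?d u + (?d w + ln 2)" .
  qed simp
  also have "\<dots> = mean_log_D j + (\<Sum>w\<in>words n k. ?d w + ln 2) / real n ^ k"
    by (simp only: average_words_add[OF n_pos] mean_log_D_def)
  also have "(\<Sum>w\<in>words n k. ?d w + ln 2) / real n ^ k = mean_log_D k + ln 2"
    using n_pos by (simp add: mean_log_D_def sum.distrib card_words add_divide_distrib)
  finally show ?thesis by simp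
qed

lemma mean_log_D_limit: "\<exists>l. (\<lambda>k. mean_log_D k / real k) \<longlonglongrightarrow> l"
proof -
  \<comment> \<open>Adding the defect \<open>ln 2\<close> to the sequence makes it
    subadditive.\<close>
  have "\<exists>l. (\<lambda>k. (mean_log_D k + ln 2) / real k) \<longlonglongrightarrow> l"
  proof (rule subadditive_convergent)
    show "mean_log_D (j + k) + ln 2 \<le> mean_log_D j + ln 2 + (mean_log_D k + ln 2)" for j k
      using mean_log_D_add[of j k] by linarith
    show "0 \<le> mean_log_D k + ln 2" for k
      using mean_log_D_nonneg[of k] by simp
  qed
  then obtain l where l: "(\<lambda>k. (mean_log_D k + ln 2) / real k) \<longlonglongrightarrow> l" ..
  have "(\<lambda>k. ln 2 / real k) \<longlonglongrightarrow> 0" by real_asymp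
  from tendsto_diff[OF l this] show ?thesis by (auto simp: add_divide_distrib)
qed

lemma drift_k_mean_log_D:
  assumes x0: "x0 \<in> hyp_plane"
  shows "\<bar>drift_k n m x0 k - mean_log_D k\<bar> \<le> ln (8 * (x0$3)\<^sup>2)"
proof -
  let ?K = "ln (8 * (x0$3)\<^sup>2)" and ?p = "word_prod n m"
  have "drift_k n m x0 k - mean_log_D k
      = (\<Sum>ws\<in>words n k. gdist n m x0 (?p ws) - ln (D (?p ws))) / real n ^ k"
    by (simp add: drift_k_def mean_log_D_def sum_subtractf sum_divide_distrib diff_divide_distrib)
  also have "\<bar>\<dots>\<bar> \<le> (\<Sum>ws\<in>words n k. \<bar>gdist n m x0 (?p ws) - ln (D (?p ws))\<bar>) / real n ^ k"
    by (simp add: divide_right_mono sum_abs)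
  also have "\<dots> \<le> (\<Sum>ws\<in>words n k. ?K) / real n ^ k"
    by (intro divide_right_mono sum_mono gdist_D x0 word_prod_in_G) simp
  also have "\<dots> = ?K" using n_pos by (simp add: card_words)
  finally show ?thesis .
qed

lemma drift_limit:
  assumes x0: "x0 \<in> hyp_plane" and l: "(\<lambda>k. mean_log_D k / real k) \<longlonglongrightarrow> l"
  shows "(\<lambda>k. drift_k n m x0 k / real k) \<longlonglongrightarrow> l"
proof -
  define K where "K = ln (8 * (x0$3)\<^sup>2)"
  have "(\<lambda>k. drift_k n m x0 k / real k - mean_log_D k / real k) \<longlonglongrightarrow> 0"
  proof (rule Lim_null_comparison)
    show "(\<lambda>k. K / real k) \<longlonglongrightarrow> 0" by real_asymp
    show "\<forall>\<^sub>F k in sequentially. norm (drift_k n m x0 k / real k - mean_log_D k / real k) \<le> K / real k"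
    proof (intro always_eventually allI)
      fix k
      have "norm (drift_k n m x0 k / real k - mean_log_D k / real k)
          = \<bar>drift_k n m x0 k - mean_log_D k\<bar> / real k"
        by (simp add: diff_divide_distrib[symmetric])
      also have "\<dots> \<le> K / real k"
        using drift_k_mean_log_D[OF x0, of k] by (intro divide_right_mono) (auto simp: K_def)
      finally show "norm (drift_k n m x0 k / real k - mean_log_D k / real k) \<le> K / real k" .
    qed
  qed
  from tendsto_add[OF this l] show ?thesis by simp
qed

definition light :: "real^3 \<Rightarrow> bool" where
  "light p \<longleftrightarrow> mink p p = 0 \<and> p$3 > 0"

lemma light_refl:
  assumes "light p"
  shows "light (R i p)"
proof -
  have "0 < (a - b)\<^sup>2 * p$3" using assms b_less_a by (simp add: light_def)
  also have "\<dots> \<le> R i p $ 3" using assms by (intro fcone_refl) (simp add: light_def fcone_def)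
  finally show ?thesis using assms by (simp add: light_def)
qed

lemma light_G: "g \<in> G \<Longrightarrow> light p \<Longrightarrow> light (g *v p)"
  by (induction g rule: G_induct) (auto simp: matrix_vector_mul_assoc[symmetric] light_refl)

text \<open>A Lyapunov criterion on the circle at infinity. The logarithmic change of height of a
  light-like vector is the Busemann cocycle, and \<open>V\<close> may correct it by a function
  bounded above. As \<open>c\<close> works at every \<open>p\<close>, the mean of \<open>V\<close>
  grows at least linearly with slope \<open>c\<close> from any start.\<close>

lemma drift_ge_gauge:
  fixes V :: "real^3 \<Rightarrow> real"
  assumes l: "(\<lambda>k. mean_log_D k / real k) \<longlonglongrightarrow> l"
    and V: "\<And>p. light p \<Longrightarrow> V p \<le> ln (p$3) + C"
    and step: "\<And>p. light p \<Longrightarrow> real n * (V p + c) \<le> (\<Sum>i<n. V (R i p))"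
  shows "c \<le> l"
proof -
  define p :: "real^3" where "p = vector [1, 0, 1]"
  have p: "light p" by (simp add: p_def light_def mink_def)
  have growth: "real n ^ k * (V p + real k * c) \<le> (\<Sum>ws\<in>words n k. V (word_prod n m ws *v p))" for k
  proof (induction k)
    case (Suc k)
    have "real n ^ Suc k * (V p + real (Suc k) * c)
        = real n * (real n ^ k * (V p + real k * c)) + real n ^ k * (real n * c)"
      by (simp add: algebra_simps)
    also have "\<dots> \<le> real n * (\<Sum>ws\<in>words n k. V (word_prod n m ws *v p)) + real n ^ k * (real n * c)"
      using Suc by (intro add_right_mono mult_left_mono) auto
    also have "\<dots> = (\<Sum>ws\<in>words n k. real n * (V (word_prod n m ws *v p) + c))"
      by (simp add: sum_distrib_left sum.distrib card_words algebra_simps)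
    also have "\<dots> \<le> (\<Sum>ws\<in>words n k. \<Sum>i<n. V (R i (word_prod n m ws *v p)))"
      by (intro sum_mono step light_G p word_prod_in_G)
    also have "\<dots> = (\<Sum>ws\<in>words n (Suc k). V (word_prod n m ws *v p))"
      by (simp add: sum_words_Suc matrix_vector_mul_assoc)
    finally show ?case .
  qed simp
  have height: "V (word_prod n m ws *v p) - (C + ln 2) \<le> ln (D (word_prod n m ws))" for ws
  proof -
    let ?g = "word_prod n m ws"
    have lp: "light (?g *v p)" by (intro light_G p word_prod_in_G)
    have "fcone (2 *\<^sub>R origin - p)" by (simp add: fcone_def mink_def p_def)
    then have "(?g *v p) $ 3 \<le> (?g *v (2 *\<^sub>R origin)) $ 3" by (intro third_mono_G) auto
    then have "(?g *v p) $ 3 \<le> 2 * D ?g" by (simp add: D_def matrix_vector_mult_scaleR)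
    then have "ln ((?g *v p) $ 3) \<le> ln (2 * D ?g)" using lp by (intro ln_mono) (auto simp: light_def)
    also have "\<dots> = ln 2 + ln (D ?g)" using D_ge_1[OF word_prod_in_G, of ws] by (simp add: ln_mult)
    finally show ?thesis using V[OF lp] by linarith
  qed
  have lower: "V p + real k * c - (C + ln 2) \<le> mean_log_D k" for k
  proof -
    have "real n ^ k * (V p + real k * c) - real n ^ k * (C + ln 2)
        \<le> (\<Sum>ws\<in>words n k. V (word_prod n m ws *v p) - (C + ln 2))"
      using growth[of k] by (simp add: sum_subtractf card_words)
    also have "\<dots> \<le> (\<Sum>ws\<in>words n k. ln (D (word_prod n m ws)))" by (intro sum_mono height)
    finally show ?thesis using n_pos by (simp add: mean_log_D_def field_simps)
  qed
  define E where "E = V p - (C + ln 2)"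
  have "(\<lambda>k. (E + real k * c) / real k) \<longlonglongrightarrow> c" by real_asymp
  moreover have "(E + real k * c) / real k \<le> mean_log_D k / real k" for k
    using lower[of k] by (intro divide_right_mono) (auto simp: E_def)
  ultimately show ?thesis by (intro LIMSEQ_le[OF _ l]) auto
qed

lemma power_b_less_a: "b ^ n < a ^ n"
  using b_less_a b_pos n_pos by (intro power_strict_mono) auto

lemma drift_ge:
  assumes l: "(\<lambda>k. mean_log_D k / real k) \<longlonglongrightarrow> l"
  shows "2 / real n * ln (a ^ n - b ^ n) \<le> l"
proof (rule drift_ge_gauge[where V = "\<lambda>p. ln (p$3)" and C = 0, OF l])
  fix p assume p: "light p"
  then have z: "p$3 > 0" by (simp add: light_def)
  have "p$1 * p$1 + p$2 * p$2 = p$3 * p$3" using p by (simp add: light_def mink_def)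
  then have "(p$1 / p$3)\<^sup>2 + (p$2 / p$3)\<^sup>2 = 1"
    using z by (simp add: power2_eq_square add_divide_distrib[symmetric])
  then obtain \<theta> where "p$1 / p$3 = cos \<theta>" "p$2 / p$3 = sin \<theta>" by (rule sincos_total_2pi)
  then have \<theta>: "p$1 = p$3 * cos \<theta>" "p$2 = p$3 * sin \<theta>" using z by (simp_all add: field_simps)
  define F where "F = (\<lambda>i. a\<^sup>2 + b\<^sup>2 - 2 * a * b * cos (\<theta> - 2 * pi * real i / real n))"
  have third: "R i p $ 3 = p$3 * F i" for i
    unfolding refl_third \<theta> F_def a_sq cos_diff by (simp add: algebra_simps)
  have F: "F i > 0" for i
    using light_refl[OF p, of i] z by (simp add: light_def third zero_less_mult_iff)
  have "ln ((a ^ n - b ^ n)\<^sup>2) \<le> ln (\<Prod>i<n. F i)"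
    unfolding F_def using power_b_less_a b_less_a b_pos n_pos
    by (intro ln_mono prod_regular_polygon_ge) auto
  also have "\<dots> = (\<Sum>i<n. ln (F i))" using F by (intro ln_prod) (auto simp: less_imp_neq[OF F, symmetric])
  finally have "2 * ln (a ^ n - b ^ n) \<le> (\<Sum>i<n. ln (F i))"
    using power_b_less_a by (simp add: ln_realpow)
  moreover have "(\<Sum>i<n. ln (R i p $ 3)) = real n * ln (p$3) + (\<Sum>i<n. ln (F i))"
    using z F by (simp add: third ln_mult_pos sum.distrib)
  ultimately show "real n * (ln (p$3) + 2 / real n * ln (a ^ n - b ^ n)) \<le> (\<Sum>i<n. ln (R i p $ 3))"
    using n_pos by (simp add: distrib_left)
qed simp

text \<open>For the square, the previous bound tends to the entropy bound as \<open>m\<close> grows. A small correction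
  of the gauge makes it strict: the directions in which the height grows least are not
  invariant under the reflections.\<close>

lemma drift_ge_square:
  assumes l: "(\<lambda>k. mean_log_D k / real k) \<longlonglongrightarrow> l" and n: "n = 4" and C: "29 / 10 \<le> a\<^sup>2 + b\<^sup>2"
  shows "ln (a\<^sup>2 + b\<^sup>2) / 2 + 1 / 6912 \<le> l"
proof -
  define C where "C = a\<^sup>2 + b\<^sup>2"
  define S where "S = 2 * a * b"
  \<comment> \<open>In direction \<theta> this is sin^2(2\<theta>)/4. Relative to the fourth power
    of the height, the product of the four reflected heights is
    \<open>C\<^sup>2 + (S\<^sup>2)\<^sup>2 * \<phi> p\<close>, smallest on the axes, where
    \<open>\<phi>\<close> vanishes; and \<open>C\<close> is \<open>a ^ 4 - b ^ 4\<close>.\<close>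
  define \<phi> where "\<phi> = (\<lambda>p :: real^3. (p$1)\<^sup>2 * (p$2)\<^sup>2 / (p$3) ^ 4)"
  have CS: "C\<^sup>2 = S\<^sup>2 + 1"
    using a_sq by (simp add: C_def S_def power_mult_distrib) (simp add: power2_eq_square algebra_simps)
  have S: "S > 0" using a_gt_1 b_pos by (simp add: S_def)
  have C29: "29 / 10 \<le> C" using C by (simp add: C_def)
  have "b\<^sup>2 \<le> 1"
  proof -
    have "(a * sin (pi / real n))\<^sup>2 \<le> 1" unfolding a_sin by (simp add: abs_square_le_1)
    then have "a\<^sup>2 \<le> 2" by (simp add: n sin_45 power_mult_distrib power_divide)
    then show ?thesis using a_sq by simp
  qed
  then have C3: "C \<le> 3" using a_sq by (simp add: C_def)
  have S3: "S\<^sup>2 \<ge> 3" using CS power_mono[OF C29, of 2] by (simp add: power2_eq_square)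
  have quad: "(S\<^sup>2)\<^sup>2 \<ge> 6 * C\<^sup>2"
  proof -
    have "C\<^sup>2 \<ge> 8" using power_mono[OF C29, of 2] by (simp add: power2_eq_square)
    then have "C\<^sup>2 * C\<^sup>2 \<ge> 8 * C\<^sup>2" by (intro mult_right_mono) auto
    moreover have "S\<^sup>2 = C\<^sup>2 - 1" using CS by simp
    then have "(S\<^sup>2)\<^sup>2 = C\<^sup>2 * C\<^sup>2 - 2 * C\<^sup>2 + 1" by (simp add: power2_diff power2_eq_square[of "C\<^sup>2"])
    ultimately show ?thesis by linarith
  qed
  have comp: "R 0 p $ 1 = S * p$3 - C * p$1" "R 0 p $ 2 = p$2" "R 0 p $ 3 = C * p$3 - S * p$1"
    "R 1 p $ 1 = p$1" "R 1 p $ 2 = S * p$3 - C * p$2" "R 1 p $ 3 = C * p$3 - S * p$2"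
    "R 2 p $ 1 = - S * p$3 - C * p$1" "R 2 p $ 2 = p$2" "R 2 p $ 3 = C * p$3 + S * p$1"
    "R 3 p $ 1 = p$1" "R 3 p $ 2 = - S * p$3 - C * p$2" "R 3 p $ 3 = C * p$3 + S * p$2" for p
  proof -
    have "2 * pi * real 1 / real n = pi / 2" "2 * pi * real 2 / real n = pi"
      "2 * pi * real 3 / real n = 3 / 2 * pi" by (simp_all add: n)
    note angles = this
    have u: "u 0 $ 1 = a" "u 0 $ 2 = 0" "u 1 $ 1 = 0" "u 1 $ 2 = a"
      "u 2 $ 1 = - a" "u 2 $ 2 = 0" "u 3 $ 1 = 0" "u 3 $ 2 = - a"
      unfolding u_components angles cos_3over2_pi sin_3over2_pi by simp_all
    have aa: "a * a = 1 + b * b" using a_sq by (simp add: power2_eq_square)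
    then have aat: "a * (a * t) = t + b * (b * t)" for t
      by (simp only: mult.assoc[symmetric]) (simp add: distrib_right)
    have CS': "C = 1 + 2 * (b * b)" "S = 2 * (a * b)"
      using aa by (simp_all add: C_def S_def power2_eq_square)
    show "R 0 p $ 1 = S * p$3 - C * p$1" "R 0 p $ 2 = p$2" "R 0 p $ 3 = C * p$3 - S * p$1"
    "R 1 p $ 1 = p$1" "R 1 p $ 2 = S * p$3 - C * p$2" "R 1 p $ 3 = C * p$3 - S * p$2"
    "R 2 p $ 1 = - S * p$3 - C * p$1" "R 2 p $ 2 = p$2" "R 2 p $ 3 = C * p$3 + S * p$1"
    "R 3 p $ 1 = p$1" "R 3 p $ 2 = - S * p$3 - C * p$2" "R 3 p $ 3 = C * p$3 + S * p$2"
      by (simp_all add: refl_mat_mult mink_def u u_components(3) CS' algebra_simps aa aat del: One_nat_def)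
  qed
  have four: "(\<Sum>i<n. f i) = f 0 + f 1 + f 2 + f 3" for f :: "nat \<Rightarrow> real"
    unfolding n by (simp add: numeral_eq_Suc)
  have \<phi>_nonneg: "\<phi> p \<ge> 0" for p by (simp add: \<phi>_def)
  have \<phi>_le: "\<phi> p \<le> 1 / 4" if "light p" for p
  proof -
    have z: "p$3 > 0" and eq: "(p$1)\<^sup>2 + (p$2)\<^sup>2 = (p$3)\<^sup>2"
      using that by (auto simp: light_def mink_def power2_eq_square)
    have "4 * ((p$1)\<^sup>2 * (p$2)\<^sup>2) = ((p$1)\<^sup>2 + (p$2)\<^sup>2)\<^sup>2 - ((p$1)\<^sup>2 - (p$2)\<^sup>2)\<^sup>2"
      by (simp add: power2_eq_square algebra_simps)
    also have "\<dots> \<le> ((p$3)\<^sup>2)\<^sup>2" unfolding eq by simp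
    finally show ?thesis using z by (simp add: \<phi>_def field_simps flip: power_mult)
  qed
  text \<open>Of the two sides parallel to the axis of the larger horizontal coordinate, reflection in the
    one farther from the point produces a direction away from both axes.\<close>
  have key: "1 / 864 \<le> x\<^sup>2 * y'\<^sup>2 / z' ^ 4"
    if z: "z > 0" and x: "x\<^sup>2 \<ge> z\<^sup>2 / 2" and y': "S * z \<le> \<bar>y'\<bar>" and z': "0 < z'" "z' \<le> 2 * C * z"
    for x y' z z' :: real
  proof -
    \<comment> \<open>With \<open>C \<le> 3\<close> the denominator is at most 6^4 = 1296 times z^4,
      the numerator at least 3/2 times z^4; hence 1/864.\<close>
    have "z' ^ 4 \<le> (2 * C * z) ^ 4" using z' by (intro power_mono) auto
    also have "\<dots> = 16 * C ^ 4 * z ^ 4" by (simp add: power_mult_distrib)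
    also have "\<dots> \<le> 16 * 3 ^ 4 * z ^ 4" using C3 C29 z by (intro mult_right_mono mult_left_mono power_mono) auto
    finally have 1: "z' ^ 4 \<le> 1296 * z ^ 4" by simp
    have "(S * z)\<^sup>2 \<le> \<bar>y'\<bar>\<^sup>2" using y' S z by (intro power_mono) auto
    then have "S\<^sup>2 * z\<^sup>2 \<le> y'\<^sup>2" by (simp add: power_mult_distrib)
    moreover have "3 * z\<^sup>2 \<le> S\<^sup>2 * z\<^sup>2" using S3 by (intro mult_right_mono) auto
    ultimately have "z\<^sup>2 / 2 * (3 * z\<^sup>2) \<le> x\<^sup>2 * y'\<^sup>2" using x by (intro mult_mono) auto
    then have "z ^ 4 * 3 / 2 \<le> x\<^sup>2 * y'\<^sup>2" by (simp add: power4_eq_xxxx power2_eq_square)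
    with 1 have "z' ^ 4 / 864 \<le> x\<^sup>2 * y'\<^sup>2" by linarith
    then show ?thesis using z' by (simp add: field_simps)
  qed
  have gain: "1 / 864 \<le> \<phi> (R 0 p) + \<phi> (R 1 p) + \<phi> (R 2 p) + \<phi> (R 3 p)" if p: "light p" for p
  proof -
    have z: "p$3 > 0" and eq: "(p$1)\<^sup>2 + (p$2)\<^sup>2 = (p$3)\<^sup>2"
      using p by (auto simp: light_def mink_def power2_eq_square)
    have "(p$1)\<^sup>2 \<le> (p$3)\<^sup>2" "(p$2)\<^sup>2 \<le> (p$3)\<^sup>2" using eq by (smt (verit) zero_le_power2)+
    then have bound: "\<bar>p$1\<bar> \<le> p$3" "\<bar>p$2\<bar> \<le> p$3"
      using z by (simp_all add: abs_le_square_iff[symmetric])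
    have "S\<^sup>2 \<le> C\<^sup>2" using CS by simp
    then have SC: "S \<le> C" by (rule power2_le_imp_le) (use C29 in simp)
    have pos: "R i p $ 3 > 0" for i using light_refl[OF p] by (simp add: light_def)
    have up: "C * p$3 + S * \<bar>t\<bar> \<le> 2 * C * p$3" if "\<bar>t\<bar> \<le> p$3" for t
    proof -
      have "S * \<bar>t\<bar> \<le> C * p$3" using SC that S z by (intro mult_mono) auto
      then show ?thesis by simp
    qed
    have low: "S * p$3 \<le> \<bar>S * p$3 + C * \<bar>t\<bar>\<bar>" for t
      using S z C29 by (simp add: abs_of_nonneg)
    consider "(p$1)\<^sup>2 \<ge> (p$3)\<^sup>2 / 2" "p$2 \<le> 0" | "(p$1)\<^sup>2 \<ge> (p$3)\<^sup>2 / 2" "p$2 \<ge> 0"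
      | "(p$2)\<^sup>2 \<ge> (p$3)\<^sup>2 / 2" "p$1 \<le> 0" | "(p$2)\<^sup>2 \<ge> (p$3)\<^sup>2 / 2" "p$1 \<ge> 0"
      using eq by linarith
    then have "\<exists>i\<in>{0, 1, 2, 3}. 1 / 864 \<le> \<phi> (R i p)"
    proof cases
      case 1
      then have "1 / 864 \<le> (p$1)\<^sup>2 * (R 1 p $ 2)\<^sup>2 / (R 1 p $ 3) ^ 4"
        using pos[of 1] up[OF bound(2)] low[of "p$2"] z
        by (intro key[of "p$3"]) (simp_all add: comp del: One_nat_def)
      then show ?thesis by (auto simp: \<phi>_def comp simp del: One_nat_def)
    next
      case 2
      then have "1 / 864 \<le> (p$1)\<^sup>2 * (R 3 p $ 2)\<^sup>2 / (R 3 p $ 3) ^ 4"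
        using pos[of 3] up[OF bound(2)] low[of "p$2"] z by (intro key[of "p$3"]) (simp_all add: comp)
      then show ?thesis by (auto simp: \<phi>_def comp)
    next
      case 3
      then have "1 / 864 \<le> (p$2)\<^sup>2 * (R 0 p $ 1)\<^sup>2 / (R 0 p $ 3) ^ 4"
        using pos[of 0] up[OF bound(1)] low[of "p$1"] z by (intro key[of "p$3"]) (simp_all add: comp)
      then show ?thesis by (auto simp: \<phi>_def comp mult.commute)
    next
      case 4
      then have "1 / 864 \<le> (p$2)\<^sup>2 * (R 2 p $ 1)\<^sup>2 / (R 2 p $ 3) ^ 4"
        using pos[of 2] up[OF bound(1)] low[of "p$1"] z by (intro key[of "p$3"]) (simp_all add: comp)
      then show ?thesis by (auto simp: \<phi>_def comp mult.commute)
    qed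
    then show ?thesis using \<phi>_nonneg[of "R 0 p"] \<phi>_nonneg[of "R 1 p"] \<phi>_nonneg[of "R 2 p"] \<phi>_nonneg[of "R 3 p"]
      by auto
  qed
  \<comment> \<open>Four copies of \<open>\<phi> p / 2\<close> must be paid for: the product of
    heights supplies ln(1 + 6 \<phi>) \<ge> 2 \<phi>. What is left is the value of
    \<open>\<phi>\<close> after reflection, and 1/864 halved and averaged over four sides is
    1/6912.\<close>
  show ?thesis unfolding C_def[symmetric]
  proof (rule drift_ge_gauge[where V = "\<lambda>p. ln (p$3) + \<phi> p / 2" and C = "1 / 8", OF l])
    show "ln (p$3) + \<phi> p / 2 \<le> ln (p$3) + 1 / 8" if "light p" for p using \<phi>_le[OF that] by simp
    fix p assume p: "light p"
    have z: "p$3 > 0" and eq: "p$1 * p$1 + p$2 * p$2 = p$3 * p$3"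
      using p by (auto simp: light_def mink_def)
    have pos: "R i p $ 3 > 0" for i using light_refl[OF p] by (simp add: light_def)
    define t where "t = 6 * \<phi> p"
    have t: "0 \<le> t" "t \<le> 3 / 2" using \<phi>_nonneg \<phi>_le[OF p] by (simp_all add: t_def)
    have "R 0 p $ 3 * R 1 p $ 3 * R 2 p $ 3 * R 3 p $ 3
        = (C\<^sup>2 * (p$3)\<^sup>2 - S\<^sup>2 * (p$1)\<^sup>2) * (C\<^sup>2 * (p$3)\<^sup>2 - S\<^sup>2 * (p$2)\<^sup>2)"
      unfolding comp by algebra
    also have "\<dots> = C\<^sup>2 * (C\<^sup>2 - S\<^sup>2) * (p$3) ^ 4 + (S\<^sup>2)\<^sup>2 * ((p$1)\<^sup>2 * (p$2)\<^sup>2)"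
      using eq by algebra
    also have "\<dots> = (p$3) ^ 4 * (C\<^sup>2 + (S\<^sup>2)\<^sup>2 * \<phi> p)"
      unfolding CS using z by (simp add: \<phi>_def field_simps)
    also have "\<dots> \<ge> (p$3) ^ 4 * (C\<^sup>2 + 6 * C\<^sup>2 * \<phi> p)"
      using quad \<phi>_nonneg by (intro mult_left_mono add_left_mono mult_right_mono) auto
    finally have "(p$3) ^ 4 * (C\<^sup>2 * (1 + t)) \<le> R 0 p $ 3 * R 1 p $ 3 * R 2 p $ 3 * R 3 p $ 3"
      by (simp add: t_def algebra_simps)
    then have "ln ((p$3) ^ 4 * (C\<^sup>2 * (1 + t))) \<le> ln (R 0 p $ 3 * R 1 p $ 3 * R 2 p $ 3 * R 3 p $ 3)"
      using z C29 t by (intro ln_mono) auto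
    also have "\<dots> = ln (R 0 p $ 3) + ln (R 1 p $ 3) + ln (R 2 p $ 3) + ln (R 3 p $ 3)"
      by (simp add: ln_mult_pos pos)
    finally have lns: "4 * ln (p$3) + 2 * ln C + ln (1 + t)
        \<le> ln (R 0 p $ 3) + ln (R 1 p $ 3) + ln (R 2 p $ 3) + ln (R 3 p $ 3)"
      using z C29 t by (simp add: ln_mult_pos ln_realpow)
    have "2 * \<phi> p \<le> ln (1 + t)"
    proof -
      have "ln (1 / (1 + t)) \<le> 1 / (1 + t) - 1" using t by (intro ln_le_minus_one) auto
      then have "t / (1 + t) \<le> ln (1 + t)" using t by (simp add: ln_div field_simps)
      moreover have "t / 3 \<le> t / (1 + t)" using t by (intro divide_left_mono) auto
      ultimately show ?thesis by (simp add: t_def)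
    qed
    then show "real n * (ln (p$3) + \<phi> p / 2 + (ln C / 2 + 1 / 6912))
        \<le> (\<Sum>i<n. ln (R i p $ 3) + \<phi> (R i p) / 2)"
      using lns gain[OF p] unfolding four unfolding n by simp
  qed
qed

end

section \<open>Comparing the bounds\<close>

text \<open>Bernoulli applied to (1 + 1/b^2)^n bounds a^(2n) - b^(2n) from below; dividing by a^n +
  b^n \<le> 2 a^n gives a^n - b^n \<ge> k a^(n-2). The condition on \<open>k\<close> is exactly what
  this yields.\<close>

lemma power_gap_ge:
  fixes a b k t :: real
  assumes ab: "0 < a" "0 < b" "a\<^sup>2 = 1 + b\<^sup>2" and n: "n \<ge> 2"
    and t: "0 \<le> t" "t \<le> a\<^sup>2" and k: "0 \<le> k" "2 * k * (a\<^sup>2 + real n - 1) \<le> real n * a\<^sup>2"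
  shows "t ^ (n - 2) * k\<^sup>2 \<le> (a ^ n - b ^ n)\<^sup>2"
proof -
  define A B where "A = a\<^sup>2" and "B = b\<^sup>2"
  have AB: "A = 1 + B" "B > 0" using ab by (auto simp: A_def B_def)
  have "b\<^sup>2 \<le> a\<^sup>2" using ab by simp
  then have ba: "b \<le> a" by (rule power2_le_imp_le) (use ab in simp)
  have "1 + real n * (1 / B) \<le> (1 + 1 / B) ^ n"
    by (rule Bernoulli_inequality) (use AB in \<open>auto intro: order_trans[of _ 0]\<close>)
  then have "B ^ n * (1 + real n / B) \<le> B ^ n * (1 + 1 / B) ^ n"
    using AB by (intro mult_left_mono) auto
  also have "\<dots> = A ^ n" using AB by (simp add: power_mult_distrib[symmetric] distrib_left add.commute)
  finally have "B ^ n * (B + real n) \<le> A ^ n * B" using AB by (simp add: field_simps)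
  then have gap: "A ^ n * real n \<le> (A ^ n - B ^ n) * (B + real n)" by (simp add: algebra_simps)
  have nn: "n = (n - 2) + 2" using n by simp
  have An: "A ^ n = A ^ (n - 2) * A\<^sup>2" by (subst nn, subst power_add) simp
  have "2 * k * (B + real n) \<le> real n * A" using k AB by (simp add: A_def)
  then have "A ^ n * (2 * k * (B + real n)) \<le> A ^ n * (real n * A)"
    using AB by (intro mult_left_mono) auto
  also have "\<dots> \<le> A * ((A ^ n - B ^ n) * (B + real n))"
    using gap AB by (simp add: mult_left_mono mult_ac)
  finally have "(2 * k * A ^ n) * (B + real n) \<le> (A * (A ^ n - B ^ n)) * (B + real n)"
    by (simp add: algebra_simps)
  then have 1: "2 * k * A ^ n \<le> A * (A ^ n - B ^ n)"
    using AB n by (simp add: mult_le_cancel_right)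
  have an: "A ^ n = a ^ n * a ^ n" "B ^ n = b ^ n * b ^ n"
    by (simp_all add: A_def B_def power2_eq_square power_mult_distrib)
  have "A ^ n - B ^ n = (a ^ n - b ^ n) * (a ^ n + b ^ n)" unfolding an by (simp add: algebra_simps)
  also have "\<dots> \<le> (a ^ n - b ^ n) * (2 * a ^ n)"
    using ab ba by (intro mult_left_mono) (auto simp: power_mono)
  finally have "A * (A ^ n - B ^ n) \<le> A * ((a ^ n - b ^ n) * (2 * a ^ n))"
    using AB by (intro mult_left_mono) auto
  with 1 have "(2 * a ^ n) * (k * a ^ n) \<le> (2 * a ^ n) * (A * (a ^ n - b ^ n))"
    unfolding an by (simp add: algebra_simps)
  then have "k * a ^ n \<le> A * (a ^ n - b ^ n)" using ab by (simp add: mult_le_cancel_left)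
  then have "(k * a ^ n)\<^sup>2 \<le> (A * (a ^ n - b ^ n))\<^sup>2"
    using k ab by (intro power_mono) auto
  then have "k\<^sup>2 * A ^ n \<le> A\<^sup>2 * (a ^ n - b ^ n)\<^sup>2"
    unfolding an by (simp add: power_mult_distrib power2_eq_square[of "a ^ n"])
  then have "A\<^sup>2 * (A ^ (n - 2) * k\<^sup>2) \<le> A\<^sup>2 * (a ^ n - b ^ n)\<^sup>2" unfolding An by (simp add: mult_ac)
  then have "A ^ (n - 2) * k\<^sup>2 \<le> (a ^ n - b ^ n)\<^sup>2" using AB by (simp add: mult_le_cancel_left)
  moreover have "t ^ (n - 2) * k\<^sup>2 \<le> A ^ (n - 2) * k\<^sup>2"
    using t by (intro mult_right_mono power_mono) (auto simp: A_def)
  ultimately show ?thesis by linarith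
qed

text \<open>Here \<open>k = n / 4\<close> is admissible, and it exceeds 1 from \<open>n = 5\<close>
  on.\<close>

lemma power_gap_large:
  fixes a b :: real
  assumes ab: "0 < a" "0 < b" "a\<^sup>2 = 1 + b\<^sup>2" and n: "n \<ge> 5" and a: "real n - 1 \<le> a\<^sup>2"
  shows "(real n - 1) ^ (n - 2) < (a ^ n - b ^ n)\<^sup>2"
proof -
  have "2 * (real n / 4) * (a\<^sup>2 + real n - 1) \<le> real n * a\<^sup>2"
    using a n mult_left_mono[OF a, of "real n"] by (simp add: algebra_simps)
  then have "(real n - 1) ^ (n - 2) * (real n / 4)\<^sup>2 \<le> (a ^ n - b ^ n)\<^sup>2"
    using n a by (intro power_gap_ge ab) auto
  moreover have "(real n - 1) ^ (n - 2) * 1 < (real n - 1) ^ (n - 2) * (real n / 4)\<^sup>2"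
    using n by (intro mult_strict_left_mono) (auto simp: one_less_power)
  ultimately show ?thesis by linarith
qed

text \<open>At this threshold \<open>power_gap_ge\<close> yields only about 22 instead of 64 = 4^3.
  Multiplying by \<open>a + b\<close> expresses everything through the symmetric quantities
  \<open>s\<close> and \<open>p\<close>, where \<open>p\<close> is nearly s/2.\<close>

lemma power_gap_5:
  fixes a b :: real
  assumes ab: "0 < a" "0 < b" "a\<^sup>2 = 1 + b\<^sup>2" and a: "11 / 4 \<le> a\<^sup>2"
  shows "64 < (a ^ 5 - b ^ 5)\<^sup>2"
proof -
  define s p where "s = a\<^sup>2 + b\<^sup>2" and "p = a * b"
  define f where "f = a ^ 5 - b ^ 5"
  have s: "s \<ge> 9 / 2" using a ab by (simp add: s_def)
  have "s\<^sup>2 = 4 * p\<^sup>2 + (a\<^sup>2 - b\<^sup>2)\<^sup>2" unfolding s_def p_def by algebra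
  then have p2: "p\<^sup>2 = (s\<^sup>2 - 1) / 4" using ab by simp
  have s2: "s\<^sup>2 \<ge> 81 / 4" using power_mono[OF s, of 2] by (simp add: power2_eq_square)
  have "(12 / 25 * s)\<^sup>2 \<le> p\<^sup>2" unfolding p2 using s2 by (simp add: power_mult_distrib power_divide)
  then have p: "12 / 25 * s \<le> p" by (rule power2_le_imp_le) (use ab in \<open>simp add: p_def\<close>)
  have "f * (a + b) = (a\<^sup>2 - b\<^sup>2) * (s\<^sup>2 - p\<^sup>2 + p * s)"
    unfolding f_def s_def p_def by algebra
  also have "\<dots> = s\<^sup>2 - p\<^sup>2 + p * s" using ab by simp
  also have "\<dots> \<ge> 123 / 100 * s\<^sup>2"
  proof -
    have "12 / 25 * s\<^sup>2 \<le> p * s" using mult_right_mono[OF p, of s] s by (simp add: power2_eq_square)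
    then show ?thesis unfolding p2 by (simp add: diff_divide_distrib)
  qed
  finally have "123 / 100 * s\<^sup>2 \<le> f * (a + b)" .
  then have "(123 / 100 * s\<^sup>2)\<^sup>2 \<le> (f * (a + b))\<^sup>2" by (intro power_mono) auto
  also have "\<dots> = f\<^sup>2 * (s + 2 * p)" unfolding s_def p_def by algebra
  also have "\<dots> \<le> f\<^sup>2 * (2 * s)"
  proof (intro mult_left_mono)
    have "0 \<le> (a - b)\<^sup>2" by simp
    then show "s + 2 * p \<le> 2 * s" by (simp add: s_def p_def power2_diff)
  qed simp
  finally have "s * (15129 / 10000 * s ^ 3) \<le> s * (2 * f\<^sup>2)"
    by (simp add: power_mult_distrib power_divide) (simp add: power2_eq_square power3_eq_cube power4_eq_xxxx mult_ac)
  then have "15129 / 10000 * s ^ 3 \<le> 2 * f\<^sup>2" using s by (simp add: mult_le_cancel_left)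
  moreover have "(9 / 2) ^ 3 \<le> s ^ 3" using s by (intro power_mono) auto
  ultimately show ?thesis unfolding f_def[symmetric] by (simp add: power3_eq_cube)
qed

text \<open>The Bernoulli bound is again too weak for 625 = 5^4, but a difference of cubes with
  \<open>a\<^sup>2 - b\<^sup>2 = 1\<close> is explicit.\<close>

lemma power_gap_6:
  fixes a b :: real
  assumes ab: "0 < a" "0 < b" "a\<^sup>2 = 1 + b\<^sup>2" and a: "7 / 2 \<le> a\<^sup>2"
  shows "625 < (a ^ 6 - b ^ 6)\<^sup>2"
proof -
  have "a ^ 6 - b ^ 6 = (a\<^sup>2 - b\<^sup>2) * (3 * a\<^sup>2 * b\<^sup>2 + (a\<^sup>2 - b\<^sup>2)\<^sup>2)" by algebra
  also have "\<dots> = 3 * (a\<^sup>2 * b\<^sup>2) + 1" using ab by simp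
  finally have eq: "a ^ 6 - b ^ 6 = 3 * (a\<^sup>2 * b\<^sup>2) + 1" .
  have "7 / 2 * (5 / 2) \<le> a\<^sup>2 * b\<^sup>2" using a ab by (intro mult_mono) auto
  then have "26 \<le> a ^ 6 - b ^ 6" unfolding eq by simp
  then have "26\<^sup>2 \<le> (a ^ 6 - b ^ 6)\<^sup>2" by (intro power_mono) auto
  then show ?thesis by simp
qed

lemma pi_squared_less: "pi\<^sup>2 < 3969 / 400"
  using power_strict_mono[OF pi_less_63_20, of 2] by (simp add: power2_eq_square)

text \<open>\<open>y\<close> is a rational upper bound for (pi/n)^2; sin^2 x \<le> x^2 - x^4/4, and
  y - y^2/4 increases up to \<open>y = 2\<close>.\<close>

lemma inverse_sin_squared:
  assumes "n \<ge> 4" "(3969 / 400) / (real n)\<^sup>2 \<le> y"  "y \<le> 2" "t * (y - y\<^sup>2 / 4) \<le> 1" "t > 0"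
  shows "t < 1 / (sin (pi / real n))\<^sup>2"
proof -
  define x where "x = pi / real n"
  have x: "0 < x" "x\<^sup>2 < y"
  proof -
    show "0 < x" using assms by (simp add: x_def)
    have "x\<^sup>2 < (3969 / 400) / (real n)\<^sup>2"
      unfolding x_def power_divide using assms pi_squared_less by (intro divide_strict_right_mono) auto
    then show "x\<^sup>2 < y" using assms by linarith
  qed
  have "0 \<le> 1 - x\<^sup>2 / 2" using x assms by simp
  then have "(1 - x\<^sup>2 / 2)\<^sup>2 \<le> (cos x)\<^sup>2" using cos_ge_parabola by (intro power_mono) auto
  then have "(sin x)\<^sup>2 \<le> x\<^sup>2 - (x\<^sup>2)\<^sup>2 / 4"
    by (simp add: sin_squared_eq power2_diff power_divide)
  also have "\<dots> < y - y\<^sup>2 / 4"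
  proof -
    have "0 < (y - x\<^sup>2) * (1 - (y + x\<^sup>2) / 4)" using x assms by (intro mult_pos_pos) auto
    moreover have "(y - x\<^sup>2) * (1 - (y + x\<^sup>2) / 4) = y - x\<^sup>2 - (y\<^sup>2 - (x\<^sup>2)\<^sup>2) / 4"
      by (simp add: power2_eq_square field_simps)
    ultimately show ?thesis by (simp add: diff_divide_distrib)
  qed
  finally have "t * (sin x)\<^sup>2 < 1"
    using assms(4) mult_strict_left_mono[OF _ assms(5)] by (meson less_le_trans)
  moreover have "0 < x \<and> x < pi" using x assms by (simp add: x_def field_simps)
  then have "sin x > 0" using sin_gt_zero[of x] by blast
  then have "(sin x)\<^sup>2 > 0" by simp
  ultimately show ?thesis unfolding x_def[symmetric] by (simp add: field_simps)
qed

text \<open>1/sin^2(pi/n) is the limit of \<open>a\<^sup>2\<close> as \<open>m\<close> grows, so a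
  threshold strictly below it is eventually passed. In the small cases \<open>y\<close> is
  (63/20)^2/n^2 rounded up.\<close>

lemma power_gap_threshold:
  assumes n: "n \<ge> 5"
  obtains t where "t < 1 / (sin (pi / real n))\<^sup>2"
    "\<And>a b :: real. 0 < a \<Longrightarrow> 0 < b \<Longrightarrow> a\<^sup>2 = 1 + b\<^sup>2 \<Longrightarrow> t \<le> a\<^sup>2
      \<Longrightarrow> (real n - 1) ^ (n - 2) < (a ^ n - b ^ n)\<^sup>2"
proof -
  consider "n = 5" | "n = 6" | "n = 7" | "n = 8" | "n \<ge> 9" using n by linarith
  then show ?thesis
  proof cases
    case 1
    show ?thesis
    proof (rule that)
      show "11 / 4 < 1 / (sin (pi / real n))\<^sup>2"
        by (rule inverse_sin_squared[where y = "397 / 1000"]) (simp_all add: 1 power2_eq_square)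
      show "(real n - 1) ^ (n - 2) < (a ^ n - b ^ n)\<^sup>2"
        if "0 < a" "0 < b" "a\<^sup>2 = 1 + b\<^sup>2" "11 / 4 \<le> a\<^sup>2" for a b :: real
        using power_gap_5[OF that] by (simp add: 1)
    qed
  next
    case 2
    show ?thesis
    proof (rule that)
      show "7 / 2 < 1 / (sin (pi / real n))\<^sup>2" by (simp add: 2 sin_30 power_divide)
      show "(real n - 1) ^ (n - 2) < (a ^ n - b ^ n)\<^sup>2"
        if "0 < a" "0 < b" "a\<^sup>2 = 1 + b\<^sup>2" "7 / 2 \<le> a\<^sup>2" for a b :: real
        using power_gap_6[OF that] by (simp add: 2)
    qed
  next
    case 3
    show ?thesis
    proof (rule that)
      show "103 / 20 < 1 / (sin (pi / real n))\<^sup>2"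
        by (rule inverse_sin_squared[where y = "2026 / 10000"]) (simp_all add: 3 power2_eq_square)
      show "(real n - 1) ^ (n - 2) < (a ^ n - b ^ n)\<^sup>2"
        if "0 < a" "0 < b" "a\<^sup>2 = 1 + b\<^sup>2" "103 / 20 \<le> a\<^sup>2" for a b :: real
        using power_gap_ge[OF that(1-3), of n "103 / 20" "8 / 5"] that(4)
        by (simp add: 3 power2_eq_square power_divide)
    qed
  next
    case 4
    show ?thesis
    proof (rule that)
      show "32 / 5 < 1 / (sin (pi / real n))\<^sup>2"
        by (rule inverse_sin_squared[where y = "1551 / 10000"]) (simp_all add: 4 power2_eq_square)
      show "(real n - 1) ^ (n - 2) < (a ^ n - b ^ n)\<^sup>2"
        if "0 < a" "0 < b" "a\<^sup>2 = 1 + b\<^sup>2" "32 / 5 \<le> a\<^sup>2" for a b :: real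
        using power_gap_ge[OF that(1-3), of n "32 / 5" "19 / 10"] that(4)
        by (simp add: 4 power2_eq_square power_divide)
    qed
  next
    case 5
    \<comment> \<open>From \<open>n = 9\<close> on, n - 1 itself is below the limit, because (n - 1)
      3969/400 \<le> n^2.\<close>
    define y where "y = (3969 / 400) / (real n)\<^sup>2"
    have n2: "9 * real n \<le> real n * real n" using 5 by (intro mult_right_mono) auto
    have y: "(real n - 1) * y \<le> 1" "0 < y" "y \<le> 2"
    proof -
      have "(real n - 9) * (real n - 1) \<ge> 0" using 5 by (intro mult_nonneg_nonneg) auto
      then have "(real n - 1) * (3969 / 400) \<le> (real n)\<^sup>2"
        by (simp add: power2_eq_square algebra_simps)
      then show "(real n - 1) * y \<le> 1" "0 < y" "y \<le> 2"
        using 5 n2 by (auto simp: y_def field_simps power2_eq_square)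
    qed
    show ?thesis
    proof (rule that)
      have "(real n - 1) * (y - y\<^sup>2 / 4) \<le> (real n - 1) * y" using 5 by (intro mult_left_mono) auto
      then have "(real n - 1) * (y - y\<^sup>2 / 4) \<le> 1" using y(1) by linarith
      then show "real n - 1 < 1 / (sin (pi / real n))\<^sup>2"
        using 5 y(3) by (intro inverse_sin_squared[of n y]) (simp_all add: y_def)
      show "(real n - 1) ^ (n - 2) < (a ^ n - b ^ n)\<^sup>2"
        if "0 < a" "0 < b" "a\<^sup>2 = 1 + b\<^sup>2" "real n - 1 \<le> a\<^sup>2" for a b :: real
        using power_gap_large[OF that(1-3) n that(4)] .
    qed
  qed
qed

section \<open>From the bounds to the strict inequality\<close>

definition strict_inequality :: "nat \<Rightarrow> nat \<Rightarrow> bool" where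
  "strict_inequality n m \<longleftrightarrow> (\<forall>x0\<in>hyp_plane. \<exists>h l v.
     (\<lambda>k. entropy_k n m k / real k) \<longlonglongrightarrow> h \<and>
     (\<lambda>k. drift_k n m x0 k / real k) \<longlonglongrightarrow> l \<and>
     (\<lambda>k. ln (real (ball_card n m x0 k)) / real k) \<longlonglongrightarrow> v \<and> h < l * v)"

context hyperbolic_polygon
begin

lemma strict_inequalityI:
  assumes c: "(real n - 2) / real n * ln (real n - 1) < c"
    and drift: "\<And>l. (\<lambda>k. mean_log_D k / real k) \<longlonglongrightarrow> l \<Longrightarrow> c \<le> l"
  shows "strict_inequality n m"
  unfolding strict_inequality_def
proof
  fix x0 assume x0: "x0 \<in> hyp_plane"
  obtain h where h: "(\<lambda>k. entropy_k n m k / real k) \<longlonglongrightarrow> h"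
    "h \<le> (real n - 2) / real n * ln (real n - 1)" using entropy_limit[OF n4] by blast
  obtain l where l: "(\<lambda>k. mean_log_D k / real k) \<longlonglongrightarrow> l" using mean_log_D_limit by blast
  obtain v where v: "(\<lambda>k. ln (real (ball_card n m x0 k)) / real k) \<longlonglongrightarrow> v" "v \<ge> 1"
    using volume_limit[OF x0] by blast
  have "0 \<le> (real n - 2) / real n * ln (real n - 1)" using n4 by simp
  then have "0 \<le> l" "h < l" using c drift[OF l] h by linarith+
  then have "h < l * v" using v mult_left_mono[of 1 v l] by simp
  then show "\<exists>h l v. (\<lambda>k. entropy_k n m k / real k) \<longlonglongrightarrow> h \<and>
     (\<lambda>k. drift_k n m x0 k / real k) \<longlonglongrightarrow> l \<and>
     (\<lambda>k. ln (real (ball_card n m x0 k)) / real k) \<longlonglongrightarrow> v \<and> h < l * v"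
    using h(1) drift_limit[OF x0 l] v(1) by blast
qed

lemma strict_inequality_power_gap:
  assumes "(real n - 1) ^ (n - 2) < (a ^ n - b ^ n)\<^sup>2"
  shows "strict_inequality n m"
proof (rule strict_inequalityI[OF _ drift_ge])
  have "ln ((real n - 1) ^ (n - 2)) < ln ((a ^ n - b ^ n)\<^sup>2)"
    using assms n4 by (subst ln_less_cancel_iff) (auto intro: order.strict_trans1[OF zero_le_power])
  then have "(real n - 2) * ln (real n - 1) < 2 * ln (a ^ n - b ^ n)"
    using n4 power_b_less_a by (simp add: ln_realpow of_nat_diff)
  then show "(real n - 2) / real n * ln (real n - 1) < 2 / real n * ln (a ^ n - b ^ n)"
    using divide_strict_right_mono[of _ _ "real n"] n_pos by fastforce
qed

lemma a_sq_eq: "a\<^sup>2 = (cos (pi / real m))\<^sup>2 / (sin (pi / real n))\<^sup>2"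
  by (simp add: a_def power_divide)

text \<open>Uniformity in \<open>m\<close> comes from using only cos^2(pi/m) \<ge> 1/2. This costs a
  factor 2, and twice 3969/400 is just below 20.\<close>

lemma strict_inequality_large:
  assumes n: "n \<ge> 20"
  shows "strict_inequality n m"
proof -
  have "(sin (pi / real n))\<^sup>2 \<le> (pi / real n)\<^sup>2"
    using sin_pi_n by (intro power_mono sin_x_le_x) auto
  also have "\<dots> \<le> (3969 / 400) / (real n)\<^sup>2"
    unfolding power_divide using pi_squared_less by (intro divide_right_mono) auto
  finally have sin: "(sin (pi / real n))\<^sup>2 * (real n)\<^sup>2 \<le> 3969 / 400" using n by (simp add: field_simps)
  have "20 * real n \<le> real n * real n" using n by (intro mult_right_mono) auto
  then have "(real n - 1) * (3969 / 400) * 2 \<le> (real n)\<^sup>2" unfolding power2_eq_square by (simp add: algebra_simps)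
  then have "(real n - 1) * ((sin (pi / real n))\<^sup>2 * (real n)\<^sup>2) * 2 \<le> (real n)\<^sup>2"
    using mult_left_mono[OF sin, of "real n - 1"] n by linarith
  then have "(real n)\<^sup>2 * ((real n - 1) * (sin (pi / real n))\<^sup>2 * 2) \<le> (real n)\<^sup>2 * 1"
    by (simp add: mult_ac)
  then have "(real n - 1) * (sin (pi / real n))\<^sup>2 * 2 \<le> 1"
    using n by (subst (asm) mult_le_cancel_left_pos) auto
  then have "(real n - 1) * (sin (pi / real n))\<^sup>2 \<le> (cos (pi / real m))\<^sup>2"
    using cos_sq_ge_half[OF m4] by linarith
  then have "real n - 1 \<le> a\<^sup>2"
    unfolding a_sq_eq using sin_pi_n by (simp add: pos_le_divide_eq)
  then show ?thesis
    using n a_gt_1 b_pos a_sq by (intro strict_inequality_power_gap power_gap_large) auto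
qed

end

lemma cos_pi_over_tendsto_1: "(\<lambda>m. (cos (pi / real m))\<^sup>2) \<longlonglongrightarrow> 1"
proof -
  have "(\<lambda>m. pi / real m) \<longlonglongrightarrow> 0" by real_asymp
  then have "(\<lambda>m. (cos (pi / real m))\<^sup>2) \<longlonglongrightarrow> (cos 0)\<^sup>2" by (intro tendsto_intros)
  then show ?thesis by simp
qed

lemma eventually_strict_inequality:
  assumes n: "n \<ge> 5"
  shows "\<forall>\<^sub>F m in sequentially. even m \<longrightarrow> strict_inequality n m"
proof -
  obtain t where t: "t < 1 / (sin (pi / real n))\<^sup>2"
    "\<And>a b :: real. 0 < a \<Longrightarrow> 0 < b \<Longrightarrow> a\<^sup>2 = 1 + b\<^sup>2 \<Longrightarrow> t \<le> a\<^sup>2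
      \<Longrightarrow> (real n - 1) ^ (n - 2) < (a ^ n - b ^ n)\<^sup>2"
    using power_gap_threshold[OF n] by blast
  have "(\<lambda>m. (cos (pi / real m))\<^sup>2 / (sin (pi / real n))\<^sup>2) \<longlonglongrightarrow> 1 / (sin (pi / real n))\<^sup>2"
    using sin_gt_zero[of "pi / real n"] n
    by (intro tendsto_divide[OF cos_pi_over_tendsto_1 tendsto_const]) (auto simp: field_simps)
  then have "\<forall>\<^sub>F m in sequentially. t < (cos (pi / real m))\<^sup>2 / (sin (pi / real n))\<^sup>2"
    using t(1) by (rule order_tendstoD)
  then show ?thesis
    using eventually_ge_at_top[of 4]
  proof eventually_elim
    case (elim m)
    show ?case
    proof
      assume "even m"
      then interpret hyperbolic_polygon n m by unfold_locales (use n elim in auto)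
      show "strict_inequality n m"
        using elim a_gt_1 b_pos a_sq
        by (intro strict_inequality_power_gap t(2)) (auto simp: a_sq_eq)
    qed
  qed
qed

text \<open>The logarithmic terms have the same limit, so the fixed surplus 1/6912 decides.\<close>

lemma eventually_strict_inequality_square:
  "\<forall>\<^sub>F m in sequentially. even m \<longrightarrow> strict_inequality 4 m"
proof -
  have lim: "(\<lambda>m. 4 * (cos (pi / real m))\<^sup>2 - 1) \<longlonglongrightarrow> 4 * 1 - 1"
    by (intro tendsto_intros cos_pi_over_tendsto_1)
  then have "\<forall>\<^sub>F m in sequentially. 29 / 10 < 4 * (cos (pi / real m))\<^sup>2 - 1"
    by (rule order_tendstoD) simp
  moreover have "\<forall>\<^sub>F m in sequentially. ln 3 / 2 < ln (4 * (cos (pi / real m))\<^sup>2 - 1) / 2 + 1 / 6912"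
  proof (rule order_tendstoD)
    show "(\<lambda>m. ln (4 * (cos (pi / real m))\<^sup>2 - 1) / 2 + 1 / 6912) \<longlonglongrightarrow> ln (4 * 1 - 1) / 2 + 1 / 6912"
      by (intro tendsto_intros cos_pi_over_tendsto_1) auto
  qed simp
  ultimately show ?thesis
    using eventually_ge_at_top[of 5]
  proof eventually_elim
    case (elim m)
    show ?case
    proof
      assume "even m"
      then interpret hyperbolic_polygon 4 m by unfold_locales (use elim in auto)
      have "a\<^sup>2 = 2 * (cos (pi / real m))\<^sup>2"
        unfolding a_sq_eq by (simp add: sin_45 power_divide)
      then have "a\<^sup>2 + b\<^sup>2 = 4 * (cos (pi / real m))\<^sup>2 - 1" using a_sq by simp
      then show "strict_inequality 4 m"
        using elim by (intro strict_inequalityI[OF _ drift_ge_square]) auto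
    qed
  qed
qed

theorem theorem1:
  shows "finite {(n::nat, m::nat). n > 3 \<and> m > 3 \<and> even m \<and>
     \<not> (\<forall>x0. x0 \<in> hyp_plane \<and> trivial_stab n m x0 \<longrightarrow>
           (\<exists>h l v.
              ((\<lambda>k. entropy_k n m k / real k) \<longlonglongrightarrow> h) \<and>
              ((\<lambda>k. drift_k n m x0 k / real k) \<longlonglongrightarrow> l) \<and>
              ((\<lambda>k. ln (real (ball_card n m x0 k)) / real k) \<longlonglongrightarrow> v) \<and>
              h < l * v))}"
    (is "finite ?bad")
proof -
  define E where "E = (\<lambda>n. {m. even m \<and> m > 3 \<and> \<not> strict_inequality n m})"
  have finite_E: "finite (E n)" if "n \<ge> 4" for n
  proof -
    have "\<forall>\<^sub>F m in sequentially. even m \<longrightarrow> strict_inequality n m"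
      using eventually_strict_inequality[of n] eventually_strict_inequality_square that
      by (cases "n = 4") auto
    then obtain M where "\<And>m. m \<ge> M \<Longrightarrow> even m \<Longrightarrow> strict_inequality n m"
      by (auto simp: eventually_sequentially)
    then have "E n \<subseteq> {..<M}" by (force simp: E_def not_le[symmetric])
    then show ?thesis by (rule finite_subset) simp
  qed
  have large: "strict_inequality n m" if "n \<ge> 20" "even m" "m > 3" for n m
  proof -
    interpret hyperbolic_polygon n m by unfold_locales (use that in auto)
    show ?thesis by (rule strict_inequality_large[OF that(1)])
  qed
  have "?bad \<subseteq> (SIGMA n:{4..<20}. E n)"
  proof
    fix z assume z: "z \<in> ?bad"
    obtain n m where nm: "z = (n, m)" by (cases z)
    have "\<not> strict_inequality n m" "n > 3" "m > 3" "even m"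
      using z unfolding nm strict_inequality_def by blast+
    then show "z \<in> (SIGMA n:{4..<20}. E n)" using large[of n m] by (auto simp: nm E_def not_le[symmetric])
  qed
  then show ?thesis
    by (rule finite_subset) (use finite_E in \<open>auto intro!: finite_SigmaI\<close>)
qed

end
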